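(* Let $\alpha$ be an irrational real number and $\beta\in\mathbb{R}$. There exists an increasing sequence $(x_k)_{k\in\mathbb{N}}$ of positive integers such that the following holds: for every fixed $\varepsilon>0$, if $2\le y<x_k^{1/2}$, $y<z\le x_k$ and $\delta=x_k^{-1/4+\varepsilon}$, then $$\sum_{\substack{n\in S^*(x_k;y,z)\\ \lVert \alpha n+\beta\rVert<\delta}}1 \;=\; 2\delta\,\Psi^*(x_k;y,z)+O\big(x_k^{3/4+\varepsilon/2+o(1)}\big),$$ where the error term means: for every fixed $\eta>0$ the difference is $\ll x_k^{3/4+\varepsilon/2+\eta}$ for all sufficiently large $k$. Moreover, for every fixed positive integer $A$, the same asymptotic formula holds for the sequence $x_k=k$ ($k\in\mathbb{N}$), uniformly for all $\alpha\in\mathcal{I}(A)$.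
   Context: For real $x$, $\lVert x\rVert=\min_{v\in\mathbb{Z}}|x-v|$. $\mu$ denotes the Möbius function. For real numbers $0<y\le z\le x$, $S^*(x;y,z)=\{a\in[1,x]\cap\mathbb{N}: \mu^2(a)=1,\ p\mid a \text{ (p prime)}\implies p\in[y,z]\}$ is the set of square-free integers in $[1,x]$ all of whose prime factors lie in $[y,z]$, and $\Psi^*(x;y,z)=\#S^*(x;y,z)$. For a positive integer $A$, $\mathcal{I}(A)=\{\alpha\in\mathbb{R}\setminus\mathbb{Q}: \alpha=[a_0;a_1,a_2,\ldots],\ |a_j|\le A \text{ for all } j\ge 0\}$, where $[a_0;a_1,\ldots]$ is the continued fraction expansion of $\alpha$.
   Formalization: Proved for 0<ε<1/4 rather than every ε>0: for ε≥1/4 one has δ≥1, so the left side is Ψ*, and with y=2, z=x_k the difference (2δ−1)Ψ* has order x_k^{3/4+ε}, so the stated formula fails. *)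

theory Defs
  imports Complex_Main "HOL-Computational_Algebra.Primes" "HOL-Computational_Algebra.Squarefree"
begin

definition dist_int :: "real \<Rightarrow> real" where
  "dist_int x = (INF v::int. \<bar>x - of_int v\<bar>)"

text \<open>The infimum is attained, so it is a minimum.\<close>

lemma dist_int_eq_round: "dist_int x = \<bar>x - of_int (round x)\<bar>"
  unfolding dist_int_def
proof (rule cInf_eq_minimum)
  show "\<bar>x - of_int (round x)\<bar> \<in> range (\<lambda>v::int. \<bar>x - of_int v\<bar>)"
    by blast
next
  fix y assume "y \<in> range (\<lambda>v::int. \<bar>x - of_int v\<bar>)"
  then show "\<bar>x - of_int (round x)\<bar> \<le> y"
    using round_diff_minimal[of x] by auto
qed

definition sqfree_smooth :: "real \<Rightarrow> real \<Rightarrow> real \<Rightarrow> nat set" where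
  "sqfree_smooth x y z =
     {a. 1 \<le> a \<and> real a \<le> x \<and> squarefree a \<and>
         (\<forall>p. prime p \<and> p dvd a \<longrightarrow> y \<le> real p \<and> real p \<le> z)}"

lemma finite_sqfree_smooth: "finite (sqfree_smooth x y z)"
proof (rule finite_subset)
  show "sqfree_smooth x y z \<subseteq> {..nat \<lfloor>x\<rfloor>}"
    by (auto simp: sqfree_smooth_def le_nat_floor)
qed simp

definition sqfree_smooth_count :: "real \<Rightarrow> real \<Rightarrow> real \<Rightarrow> nat" where
  "sqfree_smooth_count x y z = card (sqfree_smooth x y z)"

text \<open>Complete quotients and partial quotients of the (regular) continued fraction
  expansion; for irrational arguments the algorithm never divides by zero.\<close>

primrec complete_quot :: "real \<Rightarrow> nat \<Rightarrow> real" where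
  "complete_quot \<alpha> 0 = \<alpha>"
| "complete_quot \<alpha> (Suc j) = 1 / frac (complete_quot \<alpha> j)"

definition partial_quot :: "real \<Rightarrow> nat \<Rightarrow> int" where
  "partial_quot \<alpha> j = \<lfloor>complete_quot \<alpha> j\<rfloor>"

definition bounded_cf :: "nat \<Rightarrow> real set" where
  "bounded_cf A = {\<alpha>. \<alpha> \<notin> \<rat> \<and> (\<forall>j. \<bar>partial_quot \<alpha> j\<bar> \<le> int A)}"

end

theory Submission
  imports Defs "HOL-Analysis.Analysis"
begin

text \<open>
  Put \<open>s = sqrt x\<close>. Of \<open>\<alpha>\<close> only one property is used: the multiples \<open>d \<alpha>\<close> with
  \<open>1 \<le> d \<le> c s\<close> stay at distance at least \<open>c / s\<close> from the integers. If \<open>\<alpha>\<close> has bounded partial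
  quotients this holds for every \<open>x\<close>, and in general it holds for \<open>x = q\<^sup>2\<close> where \<open>q\<close> is the
  denominator of a Dirichlet approximation.

  Smoothing the indicator of \<open>dist_int t < \<delta>\<close> with a Fejer kernel of degree
  \<open>H = x powr (1/4 - \<epsilon>/2)\<close> costs an admissible error and leaves
  \<open>F n = 2 Re (\<Sum>h. \<gamma> h e(h \<alpha> n))\<close> to be summed over the squarefree integers in question.
  In a bilinear sum over \<open>F (m n)\<close> the variable \<open>l = h m\<close> is treated as one, and the large sieve
  bounds the operator norm of the matrix \<open>F (m n)\<close>; this suffices whenever one of the factors lies between
  \<open>V = x powr (1/4)\<close> and \<open>V s\<close>. Sums over progressions to moduli up to \<open>s\<close> are geometric.

  Every \<open>n\<close> is \<open>e\<close> or \<open>e p\<close> with \<open>e\<close> free of primes above \<open>s\<close> and \<open>p > s\<close> prime. If \<open>e > V\<close>, then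
  multiplying the primes of \<open>e\<close> in increasing order until \<open>V\<close> is exceeded gives a factor in
  the bilinear range. If \<open>e \<le> V\<close>, detect \<open>p\<close> by Legendre's formula; its divisors \<open>f \<le> V\<close> give
  progressions to modulus \<open>e f \<le> s\<close>, and those with \<open>f > V\<close> split as before.
\<close>

section \<open>Distance to the nearest integer and well-spaced points\<close>

text \<open>The exponents balance the losses against \<open>E = x powr (3/4 + \<epsilon>/2)\<close>.
  Smoothing costs about \<open>x / H\<close>, which fixes \<open>H\<close>. A bilinear sum with a
  factor near \<open>V\<close> costs about the square root of
  \<open>\<delta> * x\<^sup>2 / V\<close>, which fixes \<open>V\<close>. Moreover
  \<open>V * s = x / V\<close>: the bilinear range is symmetric under passing to the cofactor, and
  it is just long enough for a product up to \<open>V\<close> to absorb one more prime up to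
  \<open>s\<close>. The obstacle is that the two factors obtained in this way remain coupled: by the
  order of their primes, by the size of their product and, in the sieve part, by the interval that
  contains the prime. An estimate for fixed coefficients would not survive such conditions; a bound
  for the operator norm does, at the price of one logarithm for each of them. All logarithms and
  divisor functions are absorbed into the single parameter \<open>T\<close>, which enters the final
  bound to the power 11 and is therefore chosen of order \<open>x powr (\<eta>/11)\<close>.\<close>

lemma dist_int_le: "dist_int t \<le> \<bar>t - of_int m\<bar>"
  unfolding dist_int_eq_round by (rule round_diff_minimal)

lemma dist_int_nonneg: "0 \<le> dist_int t"
  by (simp add: dist_int_eq_round)

lemma dist_int_le_half: "dist_int t \<le> 1 / 2"
  using of_int_round_abs_le[of t] by (simp add: dist_int_eq_round abs_minus_commute)

lemma dist_int_greatest: "(\<And>m::int. c \<le> \<bar>t - of_int m\<bar>) \<Longrightarrow> c \<le> dist_int t"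
  by (simp add: dist_int_eq_round)

lemma dist_int_minus: "dist_int (- t) = dist_int t"
proof (rule antisym)
  have *: "dist_int (- u) \<le> dist_int u" for u
    using dist_int_le[of "-u" "- round u"] by (simp add: dist_int_eq_round)
  show "dist_int (- t) \<le> dist_int t" "dist_int t \<le> dist_int (- t)"
    using *[of t] *[of "-t"] by simp_all
qed

lemma dist_int_minus_commute: "dist_int (s - t) = dist_int (t - s)"
  using dist_int_minus[of "s - t"] by simp

lemma sum_inverse_le_ln: "(\<Sum>j=1..n. 1 / real j) \<le> 1 + ln (real n)" if "n \<ge> 1"
  using that
proof (induction n rule: dec_induct)
  case base
  then show ?case by simp
next
  case (step n)
  have "ln (real n / real (Suc n)) \<le> real n / real (Suc n) - 1"
    using step by (intro ln_le_minus_one) auto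
  then have "1 / real (Suc n) \<le> ln (real (Suc n)) - ln (real n)"
    using step by (simp add: ln_div field_simps)
  then show ?case using step.IH by simp
qed

text \<open>Cut the circle into cells of length \<open>\<kappa>\<close> starting at 0; by the
  spacing each contains at most one point. The two cells that touch 0 contribute at most
  \<open>P\<close> each, the others a harmonic sum on either side.\<close>

lemma sum_spaced_points_le:
  fixes f :: "'a \<Rightarrow> real"
  assumes fin: "finite A" and P: "0 < P" and \<kappa>: "0 < \<kappa>" "\<kappa> \<le> 1"
    and sep: "\<And>i j. i \<in> A \<Longrightarrow> j \<in> A \<Longrightarrow> i \<noteq> j \<Longrightarrow> \<kappa> \<le> dist_int (f i - f j)"
  shows "(\<Sum>i\<in>A. 1 / (1 / P + dist_int (f i))) \<le> 2 * P + 2 / \<kappa> * (1 + ln (1 / \<kappa>))"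
proof -
  define s where "s i = f i - of_int (round (f i))" for i
  define k where "k i = \<lfloor>s i / \<kappa>\<rfloor>" for i
  define K where "K = nat \<lfloor>1 / (2 * \<kappa>)\<rfloor>"
  \<comment> \<open>\<open>g j\<close> bounds the term of a point in the cell from
    \<open>j * \<kappa>\<close> to \<open>(j + 1) * \<kappa>\<close>. A cell on the negative side is
    as close to 0 as its right end, whence \<open>- j - 1\<close>; the cells 0 and -1 touch
    0.\<close>
  define g where "g j = (if j \<ge> 1 then 1 / (\<kappa> * of_int j)
     else if j \<le> -2 then 1 / (\<kappa> * of_int (- j - 1)) else P)" for j :: int
  have s: "dist_int (f i) = \<bar>s i\<bar>" for i
    by (simp add: s_def dist_int_eq_round)
  have s_half: "\<bar>s i\<bar> \<le> 1/2" for i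
    using dist_int_le_half[of "f i"] by (simp add: s)
  have k: "of_int (k i) * \<kappa> \<le> s i" "s i < (of_int (k i) + 1) * \<kappa>" for i
  proof -
    have "of_int (k i) \<le> s i / \<kappa>" "s i / \<kappa> < of_int (k i) + 1"
      unfolding k_def by linarith+
    then show "of_int (k i) * \<kappa> \<le> s i" "s i < (of_int (k i) + 1) * \<kappa>"
      using \<kappa> by (simp_all add: field_simps)
  qed
  have inj: "inj_on k A"
  proof (rule inj_onI, rule ccontr)
    fix i j assume ij: "i \<in> A" "j \<in> A" "k i = k j" "i \<noteq> j"
    have "dist_int (f i - f j) \<le> \<bar>f i - f j - of_int (round (f i) - round (f j))\<bar>"
      by (rule dist_int_le)
    also have "\<dots> = \<bar>s i - s j\<bar>" by (simp add: s_def)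
    also have "\<dots> < \<kappa>" using k[of i] k[of j] ij(3) by (simp add: algebra_simps)
    finally show False using sep[OF ij(1,2,4)] by simp
  qed
  have K: "real n \<le> 1 / (2 * \<kappa>) \<Longrightarrow> n \<le> K" for n
    unfolding K_def by (simp add: le_nat_floor)
  have k_range: "k i \<in> {- int K - 1..int K}" for i
  proof -
    have "of_int (k i) \<le> 1 / (2 * \<kappa>)"
      using k(1)[of i] s_half[of i] \<kappa> by (simp add: field_simps)
    then have "k i \<le> int K"
      using K[of "nat (k i)"] by (cases "k i \<ge> 0") auto
    moreover have "of_int (- k i - 1) \<le> 1 / (2 * \<kappa>)"
      using k(2)[of i] s_half[of i] \<kappa> by (simp add: field_simps)
    then have "- k i - 1 \<le> int K"
      using K[of "nat (- k i - 1)"] by (cases "- k i - 1 \<ge> 0") auto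
    ultimately show ?thesis by simp
  qed
  have g: "1 / (1 / P + dist_int (f i)) \<le> g (k i)" for i
  proof -
    consider "k i \<ge> 1" | "k i \<le> -2" | "k i = 0 \<or> k i = -1" by linarith
    then show ?thesis
    proof cases
      case 1
      have "\<kappa> * of_int (k i) \<le> 1 / P + \<bar>s i\<bar>"
        using k(1)[of i] P by (smt (verit) divide_nonneg_pos mult.commute)
      with 1 show ?thesis using \<kappa> P
        by (simp add: g_def s frac_le)
    next
      case 2
      have "\<kappa> * of_int (- k i - 1) \<le> - s i"
        using k(2)[of i] by (simp add: algebra_simps)
      then have "\<kappa> * of_int (- k i - 1) \<le> 1 / P + \<bar>s i\<bar>"
        using P by (smt (verit) divide_nonneg_pos)
      moreover have "0 < \<kappa> * of_int (- k i - 1)" using 2 \<kappa> by (intro mult_pos_pos) linarith+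
      ultimately show ?thesis using 2
        by (simp add: g_def s frac_le)
    next
      case 3
      then have "1 / (1 / P + \<bar>s i\<bar>) \<le> 1 / (1 / P)"
        using P by (intro frac_le) auto
      with 3 show ?thesis by (auto simp: g_def s)
    qed
  qed
  have g_nonneg: "g j \<ge> 0" for j
    using P \<kappa> by (auto simp: g_def)
  have harm: "(\<Sum>j=1..K. 1 / (\<kappa> * real j)) \<le> 1 / \<kappa> * (1 + ln (1 / \<kappa>))"
  proof (cases "K \<ge> 1")
    case True
    have "real K \<le> 1 / (2 * \<kappa>)" unfolding K_def using \<kappa> by (simp add: of_nat_floor)
    also have "\<dots> \<le> 1 / \<kappa>" using \<kappa> by (simp add: field_simps)
    finally have "ln (real K) \<le> ln (1 / \<kappa>)" using True \<kappa> by simp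
    then have "(\<Sum>j=1..K. 1 / real j) \<le> 1 + ln (1 / \<kappa>)"
      using sum_inverse_le_ln[OF True] by simp
    then have "1 / \<kappa> * (\<Sum>j=1..K. 1 / real j) \<le> 1 / \<kappa> * (1 + ln (1 / \<kappa>))"
      using \<kappa> by (intro mult_left_mono) auto
    then show ?thesis by (simp add: sum_distrib_left)
  next
    case False
    have "0 \<le> ln (1 / \<kappa>)" using \<kappa> by simp
    with False show ?thesis using \<kappa> by simp
  qed
  have "(\<Sum>i\<in>A. 1 / (1 / P + dist_int (f i))) \<le> (\<Sum>i\<in>A. g (k i))"
    by (rule sum_mono) (rule g)
  also have "\<dots> = (\<Sum>j\<in>k ` A. g j)"
    using inj by (simp add: sum.reindex)
  also have "\<dots> \<le> (\<Sum>j\<in>{- int K - 1..int K}. g j)"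
    using k_range g_nonneg by (intro sum_mono2) auto
  also have "{- int K - 1..int K} = {-1, 0} \<union> (int ` {1..K} \<union> (\<lambda>j. - int j - 1) ` {1..K})"
  proof -
    have "j \<in> int ` {1..K}" if "1 \<le> j" "j \<le> int K" for j
      using that by (intro image_eqI[of _ _ "nat j"]) auto
    moreover have "j \<in> (\<lambda>j. - int j - 1) ` {1..K}" if "j \<le> -2" "- int K - 1 \<le> j" for j
      using that by (intro image_eqI[of _ _ "nat (- j - 1)"]) auto
    ultimately show ?thesis by auto (smt (verit))+
  qed
  also have "sum g \<dots> = sum g {-1, 0} + (sum g (int ` {1..K}) + sum g ((\<lambda>j. - int j - 1) ` {1..K}))"
    by (subst sum.union_disjoint, force, force, force, subst sum.union_disjoint) auto
  also have "sum g {-1, 0} = 2 * P" by (simp add: g_def)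
  also have "sum g (int ` {1..K}) = (\<Sum>j=1..K. 1 / (\<kappa> * real j))"
    by (subst sum.reindex) (auto simp: g_def intro!: sum.cong)
  also have "sum g ((\<lambda>j. - int j - 1) ` {1..K}) = (\<Sum>j=1..K. 1 / (\<kappa> * real j))"
    by (subst sum.reindex) (auto simp: g_def inj_on_def intro!: sum.cong)
  finally show ?thesis using harm by (simp add: add_divide_distrib)
qed

section \<open>Sums over the multiples of a number whose small multiples avoid the integers\<close>

text \<open>The separation hypothesis becomes weaker as \<open>T\<close> grows, so \<open>T\<close>
  can be enlarged at will. It is taken large enough to dominate the logarithm produced by
  \<open>sum_spaced_points_le\<close>.\<close>

locale separated_multiples =
  fixes \<alpha> s T :: real
  assumes T1: "1 \<le> T" and s1: "1 \<le> s"
    and sep: "\<And>d::nat. 1 \<le> d \<Longrightarrow> real d \<le> s / T \<Longrightarrow> 1 / (T * s) \<le> dist_int (\<alpha> * real d)"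
    and log_le: "1 + ln (T * s) \<le> T"
begin

text \<open>Two elements of \<open>A\<close> differ by at most \<open>s / T\<close>, so the points
  have spacing \<open>1 / (T * s)\<close>. The shift \<open>\<theta>\<close> cancels in differences;
  it later carries the end points of the arc and the fixed row index of the large sieve.\<close>

lemma sum_block_le:
  assumes P: "0 < P" and fin: "finite A"
    and A: "\<And>m n. m \<in> A \<Longrightarrow> n \<in> A \<Longrightarrow> real m - real n \<le> s / T"
  shows "(\<Sum>n\<in>A. 1 / (1 / P + dist_int (\<alpha> * real n + \<theta>))) \<le> 2 * T\<^sup>2 * (P + s)"
proof -
  have Ts: "1 \<le> T * s" using T1 s1 mult_mono[of 1 T 1 s] by simp
  have sep': "1 / (T * s) \<le> dist_int (\<alpha> * real m + \<theta> - (\<alpha> * real n + \<theta>))"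
    if "m \<in> A" "n \<in> A" "n < m" for m n
  proof -
    have "1 / (T * s) \<le> dist_int (\<alpha> * real (m - n))"
      using that A[of m n] by (intro sep) (auto simp: of_nat_diff)
    with that show ?thesis by (simp add: of_nat_diff algebra_simps)
  qed
  have "(\<Sum>n\<in>A. 1 / (1 / P + dist_int (\<alpha> * real n + \<theta>)))
      \<le> 2 * P + 2 / (1 / (T * s)) * (1 + ln (1 / (1 / (T * s))))"
  proof (rule sum_spaced_points_le[OF fin P])
    show "0 < 1 / (T * s)" "1 / (T * s) \<le> 1" using Ts by auto
    fix m n assume mn: "m \<in> A" "n \<in> A" "m \<noteq> n"
    show "1 / (T * s) \<le> dist_int (\<alpha> * real m + \<theta> - (\<alpha> * real n + \<theta>))"
      using sep'[OF mn(1,2)] sep'[OF mn(2,1)] mn(3)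
      by (metis dist_int_minus_commute nat_neq_iff)
  qed
  also have "\<dots> = 2 * P + 2 * (T * s) * (1 + ln (T * s))" by simp
  also have "\<dots> \<le> 2 * P + 2 * (T * s) * T"
    using log_le Ts by (intro add_left_mono mult_left_mono) auto
  also have "\<dots> = 2 * 1 * P + 2 * T\<^sup>2 * s" by (simp add: power2_eq_square)
  also have "\<dots> \<le> 2 * T\<^sup>2 * P + 2 * T\<^sup>2 * s"
    using T1 P by (intro add_mono mult_right_mono mult_left_mono) (auto simp: one_le_power)
  finally show ?thesis by (simp add: algebra_simps)
qed

lemma sum_interval_le:
  assumes P: "0 < P"
  shows "(\<Sum>n=1..N. 1 / (1 / P + dist_int (\<alpha> * real n + \<theta>))) \<le> 2 * T^3 * (real N / s + 1) * (P + s)"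
proof -
  \<comment> \<open>Integers with the same quotient by \<open>B\<close> differ by at most
    \<open>B - 1\<close>, hence by at most \<open>s / T\<close>, and the number of such blocks is at
    most \<open>T * (N / s + 1)\<close>.\<close>
  define B where "B = nat \<lfloor>s / T\<rfloor> + 1"
  have B: "s / T \<le> real B" "real B - 1 \<le> s / T" "B \<ge> 1"
    using T1 s1 unfolding B_def by (auto simp: of_nat_floor) linarith
  let ?f = "\<lambda>n. 1 / (1 / P + dist_int (\<alpha> * real n + \<theta>))"
  have "(\<Sum>n=1..N. ?f n) = (\<Sum>b\<in>{0..N div B}. \<Sum>n\<in>{n\<in>{1..N}. n div B = b}. ?f n)"
    by (rule sum.group[symmetric]) (auto intro: div_le_mono)
  also have "\<dots> \<le> (\<Sum>b\<in>{0..N div B}. 2 * T\<^sup>2 * (P + s))"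
  proof (rule sum_mono, rule sum_block_le[OF P], simp)
    fix b m n assume "m \<in> {n\<in>{1..N}. n div B = b}" "n \<in> {n\<in>{1..N}. n div B = b}"
    then have "m div B = n div B" by simp
    moreover have "m mod B < B" using B(3) by simp
    moreover have "n div B * B \<le> n" by simp
    ultimately have "m < n + B"
      using div_mult_mod_eq[of m B] by (metis add_less_le_mono add.commute)
    then have "real m \<le> real n + real B - 1" by linarith
    then show "real m - real n \<le> s / T" using B(2) by linarith
  qed
  also have "\<dots> = (real (N div B) + 1) * (2 * T\<^sup>2 * (P + s))" by simp
  also have "\<dots> \<le> (T * (real N / s + 1)) * (2 * T\<^sup>2 * (P + s))"
  proof (rule mult_right_mono)
    have "real (N div B) \<le> real N / real B" by (rule of_nat_div_le_of_nat)
    also have "\<dots> \<le> real N / (s / T)" using B T1 s1 by (intro divide_left_mono) auto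
    finally show "real (N div B) + 1 \<le> T * (real N / s + 1)"
      using T1 by (simp add: algebra_simps)
  qed (use P s1 in auto)
  also have "\<dots> = 2 * T^3 * (real N / s + 1) * (P + s)"
    by (simp only: power2_eq_square power3_eq_cube mult_ac)
  finally show ?thesis .
qed

end

section \<open>Fejer approximation of an arc\<close>

definition unit_exp :: "real \<Rightarrow> complex" where
  "unit_exp t = cis (2 * pi * t)"

lemma norm_unit_exp [simp]: "norm (unit_exp t) = 1"
  by (simp add: unit_exp_def)

lemma unit_exp_0 [simp]: "unit_exp 0 = 1"
  by (simp add: unit_exp_def)

lemma unit_exp_add: "unit_exp (s + t) = unit_exp s * unit_exp t"
  by (simp add: unit_exp_def cis_mult algebra_simps)

lemma unit_exp_minus: "unit_exp (- t) = cnj (unit_exp t)"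
  by (simp add: unit_exp_def cis_cnj)

lemma unit_exp_of_nat_mult: "unit_exp (real k * t) = unit_exp t ^ k"
  by (induction k) (simp_all add: distrib_right unit_exp_add)

text \<open>The sharp constant would be 2. This weaker form follows from the mean value theorem
  while the cosine is at least 1/2, and from monotonicity beyond that.\<close>

lemma sin_pi_ge: "u \<le> sin (pi * u)" if "0 \<le> u" "u \<le> 1 / 2"
proof (cases "u \<le> 1 / 3")
  case True
  show ?thesis
  proof (cases "u = 0")
    case False
    with that have "0 < pi * u" by simp
    then obtain z where z: "0 < z" "z < pi * u" "sin (pi * u) - sin 0 = (pi * u - 0) * cos z"
      using MVT2[of 0 "pi * u" sin cos] by (metis DERIV_sin)
    have "z \<le> pi / 3" proof -
      have "pi * u \<le> pi * (1 / 3)" using True by (intro mult_left_mono) auto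
      then have "z < pi * (1 / 3)" using z(2) by (rule less_le_trans[rotated])
      then show ?thesis by simp
    qed
    then have "cos (pi / 3) \<le> cos z" using z by (intro cos_monotone_0_pi_le) auto
    then have "1 / 2 \<le> cos z" by (simp add: cos_60)
    then have "pi * u * (1 / 2) \<le> sin (pi * u)" using z(3) that mult_left_mono[of "1 / 2" "cos z" "pi * u"] by (simp only: sin_zero diff_zero) auto
    moreover have "2 * u \<le> pi * u" using that pi_ge_two by (intro mult_right_mono) auto
    ultimately show ?thesis by simp
  qed simp
next
  case False
  have "sin (pi / 6) \<le> sin (pi * u)"
    using that False by (intro sin_monotone_2pi_le) (auto simp: field_simps)
  then show ?thesis using that by (simp add: sin_30)
qed

lemma norm_unit_exp_diff_one: "2 * dist_int t \<le> norm (unit_exp t - 1)"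
proof -
  define u where "u = t - of_int (round t)"
  have u: "\<bar>u\<bar> = dist_int t" "\<bar>u\<bar> \<le> 1 / 2"
    using dist_int_le_half[of t] by (simp_all add: u_def dist_int_eq_round)
  have "2 * pi * t = 2 * pi * u + 2 * pi * of_int (round t)"
    by (simp add: u_def algebra_simps)
  then have "unit_exp t = cis (2 * pi * u)"
    by (simp add: unit_exp_def cis_mult[symmetric] cis_multiple_2pi)
  then have "(norm (unit_exp t - 1))\<^sup>2 = (cos (2 * pi * u) - 1)\<^sup>2 + (sin (2 * pi * u))\<^sup>2"
    by (simp add: cmod_power2)
  also have "\<dots> = 2 - 2 * cos (2 * (pi * u))"
    using sin_cos_squared_add3[of "2 * (pi * u)"]
    by (simp add: power2_eq_square algebra_simps)
  also have "\<dots> = (2 * sin (pi * \<bar>u\<bar>))\<^sup>2"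
    by (subst cos_double_sin) (auto simp: power2_eq_square abs_if)
  finally have "norm (unit_exp t - 1) = \<bar>2 * sin (pi * \<bar>u\<bar>)\<bar>"
    by (metis abs_norm_cancel real_sqrt_abs)
  moreover have "\<bar>u\<bar> \<le> sin (pi * \<bar>u\<bar>)" using u by (intro sin_pi_ge) auto
  ultimately show ?thesis using u by simp
qed

text \<open>The usual minimum of the length and the reciprocal distance, written up to a constant as
  one fraction of the shape that \<open>sum_spaced_points_le\<close> can sum.\<close>

lemma norm_sum_unit_exp_lessThan_le:
  assumes "0 < L"
  shows "norm (\<Sum>k<L. unit_exp (real k * t)) \<le> 2 / (1 / real L + dist_int t)"
proof (cases "dist_int t \<le> 1 / real L")
  case True
  have "norm (\<Sum>k<L. unit_exp (real k * t)) \<le> (\<Sum>k<L. norm (unit_exp (real k * t)))"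
    by (rule norm_sum)
  also have "\<dots> = real L" by simp
  also have "\<dots> = 2 / (2 / real L)" using assms by simp
  also have "\<dots> \<le> 2 / (1 / real L + dist_int t)"
    using assms True dist_int_nonneg[of t] by (intro divide_left_mono mult_pos_pos add_pos_nonneg) auto
  finally show ?thesis .
next
  case False
  then have nd: "0 < dist_int t" using assms by (meson less_le_trans linorder_not_le zero_less_divide_1_iff of_nat_0_less_iff less_trans)
  then have ne: "unit_exp t \<noteq> 1" using norm_unit_exp_diff_one[of t] by auto
  have "(\<Sum>k<L. unit_exp (real k * t)) = (unit_exp t ^ L - 1) / (unit_exp t - 1)"
    using geometric_sum[OF ne] by (simp add: unit_exp_of_nat_mult)
  then have "norm (\<Sum>k<L. unit_exp (real k * t)) = norm (unit_exp t ^ L - 1) / norm (unit_exp t - 1)"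
    by (simp add: norm_divide)
  also have "\<dots> \<le> 2 / (2 * dist_int t)"
    using nd norm_unit_exp_diff_one[of t] norm_triangle_ineq4[of "unit_exp t ^ L" 1]
    by (intro frac_le) (auto simp: norm_power)
  also have "\<dots> \<le> 2 / (1 / real L + dist_int t)"
    using False assms by (intro divide_left_mono) (auto intro!: add_pos_nonneg mult_pos_pos dist_int_nonneg nd)
  finally show ?thesis .
qed

lemma norm_sum_unit_exp_le:
  assumes "a < b"
  shows "norm (\<Sum>k\<in>{a<..b}. unit_exp (real k * t)) \<le> 2 / (1 / real (b - a) + dist_int t)"
proof -
  have "(\<Sum>k\<in>{a<..b}. unit_exp (real k * t)) = (\<Sum>k<b - a. unit_exp (real (a + 1) * t + real k * t))"
    by (rule sum.reindex_bij_witness[of _ "\<lambda>k. a + 1 + k" "\<lambda>k. k - a - 1"])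
       (use assms in \<open>auto simp: of_nat_diff algebra_simps\<close>)
  also have "\<dots> = unit_exp (real (a + 1) * t) * (\<Sum>k<b - a. unit_exp (real k * t))"
    unfolding unit_exp_add by (simp add: sum_distrib_left)
  finally show ?thesis
    using norm_sum_unit_exp_lessThan_le[of "b - a" t] assms by (simp add: norm_mult)
qed

section \<open>The Fejer kernel\<close>

text \<open>The customary Fejer kernel divided once more by \<open>H\<close>: with this
  normalisation the translates by multiples of \<open>1 / H\<close> form a partition of unity, see
  \<open>sum_fejer_shifts\<close>.\<close>

definition fejer :: "nat \<Rightarrow> real \<Rightarrow> real" where
  "fejer H t = (norm (\<Sum>k<H. unit_exp (real k * t)))\<^sup>2 / (real H)\<^sup>2"

lemma fejer_nonneg: "0 \<le> fejer H t"
  by (simp add: fejer_def)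

lemma fejer_le:
  assumes "0 < H"
  shows "fejer H t \<le> 4 / (1 + real H * dist_int t)\<^sup>2"
proof -
  have "(norm (\<Sum>k<H. unit_exp (real k * t)))\<^sup>2 \<le> (2 / (1 / real H + dist_int t))\<^sup>2"
    by (intro power_mono norm_sum_unit_exp_lessThan_le assms) auto
  then have "fejer H t \<le> (2 / (1 / real H + dist_int t))\<^sup>2 / (real H)\<^sup>2"
    unfolding fejer_def by (intro divide_right_mono) auto
  also have "\<dots> = (2 / ((1 / real H + dist_int t) * real H))\<^sup>2"
    by (simp add: power_divide power_mult_distrib)
  also have "(1 / real H + dist_int t) * real H = 1 + real H * dist_int t"
    using assms by (simp add: field_simps)
  finally show ?thesis by (simp add: power_divide)
qed

text \<open>Passing from \<open>H\<close> to \<open>Suc H\<close> adds the cross terms of one new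
  exponential with all earlier ones, one for each frequency from 1 to \<open>H\<close>.\<close>

lemma fejer_expansion:
  "(norm (\<Sum>k<H. unit_exp (real k * t)))\<^sup>2
     = real H + 2 * (\<Sum>h=1..<H. (real H - real h) * Re (unit_exp (real h * t)))"
proof (induction H)
  case 0
  then show ?case by simp
next
  case (Suc H)
  define D where "D = (\<Sum>k<H. unit_exp (real k * t))"
  have "Re (unit_exp (real H * t) * cnj D) = (\<Sum>k<H. Re (unit_exp (real (H - k) * t)))"
    unfolding D_def cnj_sum sum_distrib_left Re_sum
    by (rule sum.cong) (simp_all add: unit_exp_minus[symmetric] unit_exp_add[symmetric] of_nat_diff algebra_simps)
  also have "\<dots> = (\<Sum>h=1..<Suc H. Re (unit_exp (real h * t)))"
    by (rule sum.reindex_bij_witness[of _ "\<lambda>h. H - h" "\<lambda>k. H - k"]) auto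
  finally have cross: "Re (unit_exp (real H * t) * cnj D) = (\<Sum>h=1..<Suc H. Re (unit_exp (real h * t)))" .
  have n1: "(Re (unit_exp (real H * t)))\<^sup>2 + (Im (unit_exp (real H * t)))\<^sup>2 = 1"
    using norm_unit_exp[of "real H * t"] by (simp add: cmod_def)
  have "(norm (D + unit_exp (real H * t)))\<^sup>2
      = (norm D)\<^sup>2 + 1 + 2 * Re (unit_exp (real H * t) * cnj D)"
    unfolding cmod_power2 using n1 by (simp add: power2_eq_square algebra_simps)
  also have "\<dots> = real (Suc H) + 2 * ((\<Sum>h=1..<H. (real H - real h) * Re (unit_exp (real h * t)))
        + (\<Sum>h=1..<Suc H. Re (unit_exp (real h * t))))"
    using Suc.IH cross by (simp add: D_def)
  also have "(\<Sum>h=1..<H. (real H - real h) * Re (unit_exp (real h * t)))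
      = (\<Sum>h=1..<Suc H. (real H - real h) * Re (unit_exp (real h * t)))"
    by (cases H) auto
  also have "\<dots> + (\<Sum>h=1..<Suc H. Re (unit_exp (real h * t)))
      = (\<Sum>h=1..<Suc H. (real (Suc H) - real h) * Re (unit_exp (real h * t)))"
    unfolding sum.distrib[symmetric] by (rule sum.cong) (auto simp: algebra_simps)
  finally show ?case by (simp add: D_def)
qed

lemma dist_int_fraction_ge:
  assumes "\<not> int H dvd k" "0 < H"
  shows "1 / real H \<le> dist_int (of_int k / real H)"
proof (rule dist_int_greatest)
  fix m :: int
  have "k - m * int H \<noteq> 0" using assms(1) by auto
  then have "1 \<le> \<bar>k - m * int H\<bar>" by linarith
  then have "1 \<le> \<bar>of_int k - of_int m * real H\<bar>"
    by (metis of_int_1_le_iff of_int_abs of_int_diff of_int_mult of_int_of_nat_eq)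
  moreover have "of_int k / real H - of_int m = (of_int k - of_int m * real H) / real H"
    using assms(2) by (simp add: field_simps)
  ultimately show "1 / real H \<le> \<bar>of_int k / real H - of_int m\<bar>"
    using assms(2) by (simp add: divide_right_mono)
qed

lemma sum_roots_of_unity:
  assumes "\<not> int H dvd k" "0 < H"
  shows "(\<Sum>j<H. unit_exp (real j * (of_int k / real H))) = 0"
proof -
  have "0 < dist_int (of_int k / real H)"
    using dist_int_fraction_ge[OF assms] assms(2) by (meson less_le_trans of_nat_0_less_iff zero_less_divide_1_iff)
  then have ne: "unit_exp (of_int k / real H) \<noteq> 1"
    using norm_unit_exp_diff_one[of "of_int k / real H"] by auto
  have "unit_exp (of_int k / real H) ^ H = unit_exp (real H * (of_int k / real H))"
    by (rule unit_exp_of_nat_mult[symmetric])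
  also have "\<dots> = unit_exp (of_int k)" using assms(2) by simp
  also have "\<dots> = 1" by (simp add: unit_exp_def cis_multiple_2pi)
  finally show ?thesis
    using geometric_sum[OF ne, of H] by (simp only: unit_exp_of_nat_mult) simp
qed

text \<open>In \<open>fejer_expansion\<close> the shifts run through all residues modulo
  \<open>H\<close>, which annihilates every frequency strictly between 0 and \<open>H\<close>; only
  the constant term survives.\<close>

lemma sum_fejer_shifts:
  assumes "0 < H"
  shows "(\<Sum>j<H. fejer H (t - real j / real H)) = 1"
proof -
  have zero: "(\<Sum>j<H. unit_exp (real h * (t - real j / real H))) = 0" if "h \<in> {1..<H}" for h
  proof -
    have "\<not> int H dvd - int h" using that by (auto simp: zdvd_not_zless)
    then have "(\<Sum>j<H. unit_exp (real j * (of_int (- int h) / real H))) = 0"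
      using assms by (rule sum_roots_of_unity)
    moreover have "(\<Sum>j<H. unit_exp (real h * (t - real j / real H)))
        = unit_exp (real h * t) * (\<Sum>j<H. unit_exp (real j * (of_int (- int h) / real H)))"
      unfolding sum_distrib_left unit_exp_add[symmetric] by (rule sum.cong) (auto simp: algebra_simps)
    ultimately show ?thesis by simp
  qed
  have "(\<Sum>j<H. (norm (\<Sum>k<H. unit_exp (real k * (t - real j / real H))))\<^sup>2)
      = (\<Sum>j<H. real H) + 2 * (\<Sum>h=1..<H. (real H - real h) *
          (\<Sum>j<H. Re (unit_exp (real h * (t - real j / real H)))))"
    unfolding fejer_expansion sum.distrib sum_distrib_left[symmetric]
    by (subst sum.swap) (simp add: sum_distrib_left)
  also have "(\<Sum>h=1..<H. (real H - real h) *
          (\<Sum>j<H. Re (unit_exp (real h * (t - real j / real H))))) = 0"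
    using zero by (intro sum.neutral) (simp add: Re_sum[symmetric])
  finally have "(\<Sum>j<H. (norm (\<Sum>k<H. unit_exp (real k * (t - real j / real H))))\<^sup>2) = (real H)\<^sup>2"
    by (simp add: power2_eq_square)
  then show ?thesis
    using assms by (simp add: fejer_def sum_divide_distrib[symmetric])
qed

text \<open>One point lies inside the arc and the other outside, so the way between them passes an
  end point of the arc. The two versions measure from the inner and from the outer point; in
  \<open>fejer_approx\<close> the fixed point can be either.\<close>

lemma dist_int_crossing:
  assumes "dist_int t < \<delta>" "\<delta> \<le> dist_int s"
  shows "min (dist_int (t - \<delta>)) (dist_int (t + \<delta>)) \<le> dist_int (t - s)"
    and "min (dist_int (s - \<delta>)) (dist_int (s + \<delta>)) \<le> dist_int (t - s)"
proof -
  define m where "m = round t"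
  define k where "k = round (t - s)"
  define t' where "t' = t - of_int m"
  define s' where "s' = s - of_int (m - k)"
  have t': "\<bar>t'\<bar> < \<delta>" using assms(1) by (simp add: t'_def m_def dist_int_eq_round)
  have ts: "dist_int (t - s) = \<bar>t' - s'\<bar>"
    by (simp add: t'_def s'_def k_def dist_int_eq_round)
  have s': "\<delta> \<le> \<bar>s'\<bar>" using assms(2) dist_int_le[of s "m - k"] by (simp add: s'_def)
  have "dist_int (t - \<delta>) \<le> \<bar>t' - \<delta>\<bar>" "dist_int (t + \<delta>) \<le> \<bar>t' + \<delta>\<bar>"
    using dist_int_le[of "t - \<delta>" m] dist_int_le[of "t + \<delta>" m] by (simp_all add: t'_def algebra_simps)
  moreover have "dist_int (s - \<delta>) \<le> \<bar>s' - \<delta>\<bar>" "dist_int (s + \<delta>) \<le> \<bar>s' + \<delta>\<bar>"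
    using dist_int_le[of "s - \<delta>" "m - k"] dist_int_le[of "s + \<delta>" "m - k"] by (simp_all add: s'_def algebra_simps)
  ultimately show "min (dist_int (t - \<delta>)) (dist_int (t + \<delta>)) \<le> dist_int (t - s)"
    "min (dist_int (s - \<delta>)) (dist_int (s + \<delta>)) \<le> dist_int (t - s)"
    using t' s' unfolding ts by linarith+
qed

definition grid_near :: "nat \<Rightarrow> real \<Rightarrow> nat set" where
  "grid_near H \<delta> = {j\<in>{..<H}. dist_int (real j / real H) < \<delta>}"

text \<open>Since the translates sum to 1, the error is the weight of the grid points on the other
  side of an end point, all at distance at least \<open>\<rho>\<close> from \<open>t\<close>. Of the
  two factors in the quadratic decay, one gives \<open>1 / (1 + H * \<rho>)\<close> and the other is
  summed over the whole grid, which gives the logarithm.\<close>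

lemma fejer_approx:
  assumes H: "0 < H"
  shows "\<bar>of_bool (dist_int t < \<delta>) - (\<Sum>j\<in>grid_near H \<delta>. fejer H (t - real j / real H))\<bar>
    \<le> 8 * (2 + ln (real H)) * (1 / (1 + real H * dist_int (t - \<delta>)) + 1 / (1 + real H * dist_int (t + \<delta>)))"
proof -
  let ?w = "\<lambda>j. fejer H (t - real j / real H)"
  define \<rho> where "\<rho> = min (dist_int (t - \<delta>)) (dist_int (t + \<delta>))"
  define u where "u j = 1 + real H * dist_int (t - real j / real H)" for j
  have \<rho>0: "0 \<le> \<rho>" by (simp add: \<rho>_def dist_int_nonneg)
  have all: "(\<Sum>j<H. 1 / u j) \<le> 2 * (2 + ln (real H))"
  proof -
    have "(\<Sum>j<H. 1 / (1 / real H + dist_int (t - real j / real H)))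
        \<le> 2 * real H + 2 / (1 / real H) * (1 + ln (1 / (1 / real H)))"
    proof (rule sum_spaced_points_le)
      fix i j assume ij: "i \<in> {..<H}" "j \<in> {..<H}" "i \<noteq> j"
      have "\<not> int H dvd int j - int i"
      proof
        assume "int H dvd int j - int i"
        then have "\<bar>int H\<bar> \<le> \<bar>int j - int i\<bar>" using ij(3) by (intro dvd_imp_le_int) auto
        with ij show False by auto
      qed
      from dist_int_fraction_ge[OF this H]
      show "1 / real H \<le> dist_int (t - real i / real H - (t - real j / real H))"
        by (simp add: diff_divide_distrib)
    qed (use H in auto)
    moreover have "1 / (1 / real H + dist_int (t - real j / real H)) = real H * (1 / u j)" for j
      using H dist_int_nonneg[of "t - real j / real H"]
      by (simp add: u_def field_simps)
    ultimately have "real H * (\<Sum>j<H. 1 / u j) \<le> real H * (2 * (2 + ln (real H)))"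
      by (simp add: sum_distrib_left algebra_simps)
    then show ?thesis using H by simp
  qed
  have part: "(\<Sum>j\<in>B. ?w j) \<le> 8 * (2 + ln (real H)) * (1 / (1 + real H * \<rho>))"
    if B: "B \<subseteq> {..<H}" "\<And>j. j \<in> B \<Longrightarrow> \<rho> \<le> dist_int (t - real j / real H)" for B
  proof -
    have "(\<Sum>j\<in>B. ?w j) \<le> (\<Sum>j\<in>B. 4 / (1 + real H * \<rho>) * (1 / u j))"
    proof (rule sum_mono)
      fix j assume "j \<in> B"
      have "?w j \<le> 4 / (u j * u j)"
        using fejer_le[OF H] by (simp add: u_def power2_eq_square)
      also have "\<dots> \<le> 4 / ((1 + real H * \<rho>) * u j)"
        using B(2)[OF \<open>j \<in> B\<close>] \<rho>0 dist_int_nonneg[of "t - real j / real H"]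
        by (intro divide_left_mono mult_right_mono)
           (auto simp: u_def mult_left_mono intro!: mult_pos_pos add_pos_nonneg)
      finally show "?w j \<le> 4 / (1 + real H * \<rho>) * (1 / u j)" by simp
    qed
    also have "\<dots> = 4 / (1 + real H * \<rho>) * (\<Sum>j\<in>B. 1 / u j)" by (simp add: sum_distrib_left)
    also have "\<dots> \<le> 4 / (1 + real H * \<rho>) * (\<Sum>j<H. 1 / u j)"
      using B(1) \<rho>0 by (intro mult_left_mono sum_mono2) (auto simp: u_def dist_int_nonneg)
    also have "\<dots> \<le> 4 / (1 + real H * \<rho>) * (2 * (2 + ln (real H)))"
      using \<rho>0 by (intro mult_left_mono all) auto
    finally show ?thesis by simp
  qed
  have split: "(\<Sum>j\<in>grid_near H \<delta>. ?w j)
      + (\<Sum>j\<in>{..<H} - grid_near H \<delta>. ?w j) = 1"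
    using sum_fejer_shifts[OF H, of t]
      sum.subset_diff[of "grid_near H \<delta>" "{..<H}" "\<lambda>j. ?w j"]
    by (auto simp: grid_near_def add.commute)
  have "\<bar>of_bool (dist_int t < \<delta>) - (\<Sum>j\<in>grid_near H \<delta>. ?w j)\<bar>
      \<le> 8 * (2 + ln (real H)) * (1 / (1 + real H * \<rho>))"
  proof (cases "dist_int t < \<delta>")
    case True
    have "(\<Sum>j\<in>{..<H} - grid_near H \<delta>. ?w j)
        \<le> 8 * (2 + ln (real H)) * (1 / (1 + real H * \<rho>))"
      unfolding \<rho>_def using dist_int_crossing(1)[OF True]
      by (intro part[unfolded \<rho>_def]) (auto simp: grid_near_def)
    moreover have "0 \<le> (\<Sum>j\<in>{..<H} - grid_near H \<delta>. ?w j)"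
      by (intro sum_nonneg fejer_nonneg)
    ultimately show ?thesis using True split by simp
  next
    case False
    have "(\<Sum>j\<in>grid_near H \<delta>. ?w j)
        \<le> 8 * (2 + ln (real H)) * (1 / (1 + real H * \<rho>))"
      unfolding \<rho>_def using dist_int_crossing(2)[of _ \<delta> t] False
      by (intro part[unfolded \<rho>_def]) (auto simp: grid_near_def dist_int_minus_commute[of t])
    moreover have "0 \<le> (\<Sum>j\<in>grid_near H \<delta>. ?w j)"
      by (intro sum_nonneg fejer_nonneg)
    ultimately show ?thesis using False by simp
  qed
  also have "\<dots> \<le> 8 * (2 + ln (real H)) *
      (1 / (1 + real H * dist_int (t - \<delta>)) + 1 / (1 + real H * dist_int (t + \<delta>)))"
  proof (rule mult_left_mono)
    show "1 / (1 + real H * \<rho>)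
      \<le> 1 / (1 + real H * dist_int (t - \<delta>)) + 1 / (1 + real H * dist_int (t + \<delta>))"
      by (auto simp: \<rho>_def min_def dist_int_nonneg)
    show "0 \<le> 8 * (2 + ln (real H))" using H by simp
  qed
  finally show ?thesis .
qed

section \<open>Fourier coefficients of the smoothed arc\<close>

text \<open>The Fourier coefficient of frequency \<open>h\<close> of the sum of Fejer kernels over
  the grid points in the arc. Frequency \<open>- h\<close> has the conjugate coefficient, hence the
  double real part in \<open>sum_fejer_grid_eq\<close>.\<close>

definition grid_coeff :: "nat \<Rightarrow> real \<Rightarrow> nat \<Rightarrow> complex" where
  "grid_coeff H \<delta> h = of_real ((1 - real h / real H) / real H) *
     (\<Sum>j\<in>grid_near H \<delta>. unit_exp (- (real h * (real j / real H))))"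

lemma finite_grid_near [simp]: "finite (grid_near H \<delta>)"
  by (simp add: grid_near_def)

lemma sum_fejer_grid_eq:
  assumes H: "0 < H"
  shows "(\<Sum>j\<in>grid_near H \<delta>. fejer H (t - real j / real H))
    = real (card (grid_near H \<delta>)) / real H
      + 2 * Re (\<Sum>h=1..<H. grid_coeff H \<delta> h * unit_exp (real h * t))"
proof -
  let ?e = "\<lambda>h j. (1 - real h / real H) / real H * Re (unit_exp (real h * (t - real j / real H)))"
  let ?J = "grid_near H \<delta>"
  have "fejer H (t - real j / real H) = 1 / real H
      + 2 * (\<Sum>h=1..<H. ?e h j)" for j
  proof -
    have *: "(1 - real h / real H) / real H = (real H - real h) / (real H)\<^sup>2" for h
      using H by (simp add: field_simps power2_eq_square)
    show ?thesis
      unfolding fejer_def fejer_expansion * add_divide_distrib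
      using H by (simp add: sum_divide_distrib[symmetric] power2_eq_square)
  qed
  then have "(\<Sum>j\<in>?J. fejer H (t - real j / real H)) = real (card ?J) / real H
      + 2 * (\<Sum>j\<in>?J. \<Sum>h=1..<H. ?e h j)"
    by (simp add: sum.distrib sum_distrib_left)
  also have "(\<Sum>j\<in>?J. \<Sum>h=1..<H. ?e h j)
      = (\<Sum>h=1..<H. \<Sum>j\<in>?J. ?e h j)"
    by (rule sum.swap)
  also have "\<dots> = (\<Sum>h=1..<H. Re (grid_coeff H \<delta> h * unit_exp (real h * t)))"
  proof (rule sum.cong[OF refl])
    fix h
    have "(\<Sum>j\<in>?J. unit_exp (- (real h * (real j / real H)))) * unit_exp (real h * t)
        = (\<Sum>j\<in>?J. unit_exp (real h * (t - real j / real H)))"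
      unfolding sum_distrib_right unit_exp_add[symmetric] by (simp add: right_diff_distrib)
    then have "grid_coeff H \<delta> h * unit_exp (real h * t)
        = of_real ((1 - real h / real H) / real H) * (\<Sum>j\<in>?J. unit_exp (real h * (t - real j / real H)))"
      by (simp only: grid_coeff_def mult.assoc)
    then show "(\<Sum>j\<in>?J. ?e h j)
        = Re (grid_coeff H \<delta> h * unit_exp (real h * t))"
      by (simp only: Re_complex_of_real Im_complex_of_real times_complex.sel Re_sum sum_distrib_left) simp
  qed
  finally show ?thesis by (simp add: Re_sum)
qed

lemma norm_grid_coeff_le:
  assumes "h < H"
  shows "norm (grid_coeff H \<delta> h) \<le> norm (\<Sum>j\<in>grid_near H \<delta>. unit_exp (- (real h * (real j / real H)))) / real H"
proof -
  have "norm (complex_of_real ((1 - real h / real H) / real H)) \<le> 1 / real H"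
    using assms by (simp only: norm_of_real) (simp add: divide_right_mono)
  then show ?thesis
    using mult_right_mono[of _ "1 / real H"]
    unfolding grid_coeff_def norm_mult by fastforce
qed

lemma norm_grid_coeff_le_card:
  assumes "h < H"
  shows "norm (grid_coeff H \<delta> h) \<le> real (card (grid_near H \<delta>)) / real H"
proof -
  have "norm (\<Sum>j\<in>grid_near H \<delta>. unit_exp (- (real h * (real j / real H))))
      \<le> (\<Sum>j\<in>grid_near H \<delta>. norm (unit_exp (- (real h * (real j / real H)))))"
    by (rule norm_sum)
  then have "norm (\<Sum>j\<in>grid_near H \<delta>. unit_exp (- (real h * (real j / real H)))) \<le> real (card (grid_near H \<delta>))"
    by simp
  then show ?thesis
    using norm_grid_coeff_le[OF assms, of \<delta>] by (meson divide_right_mono of_nat_0_le_iff order_trans)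
qed

text \<open>Parseval on the residues modulo \<open>H\<close>. The result is of order
  \<open>\<delta>\<close>, while the bound for the individual coefficients would only give order
  \<open>H * \<delta>\<^sup>2\<close>.\<close>

lemma sum_norm_grid_coeff_le:
  assumes H: "0 < H"
  shows "(\<Sum>h=1..<H. (norm (grid_coeff H \<delta> h))\<^sup>2) \<le> real (card (grid_near H \<delta>)) / real H"
proof -
  let ?e = "\<lambda>h i j. unit_exp (real h * (of_int (int j - int i) / real H))"
  let ?J = "grid_near H \<delta>"
  define S where "S h = (\<Sum>j\<in>?J. unit_exp (- (real h * (real j / real H))))" for h
  \<comment> \<open>Frequency 0 is included to have a complete set of residues and is dropped again
    at the end.\<close>
  have "complex_of_real (\<Sum>h<H. (norm (S h))\<^sup>2) = (\<Sum>h<H. S h * cnj (S h))"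
    by (simp add: complex_norm_square[symmetric])
  also have "\<dots> = (\<Sum>h<H. \<Sum>i\<in>?J. \<Sum>j\<in>?J. ?e h i j)"
    unfolding S_def cnj_sum sum_product unit_exp_minus[symmetric] unit_exp_add[symmetric]
    by (intro sum.cong refl arg_cong[of _ _ unit_exp]) (simp add: algebra_simps diff_divide_distrib)
  also have "\<dots> = (\<Sum>i\<in>?J. \<Sum>j\<in>?J. \<Sum>h<H. ?e h i j)"
    by (rule trans[OF sum.swap], rule sum.cong[OF refl], rule sum.swap)
  also have "\<dots> = (\<Sum>i\<in>?J. \<Sum>j\<in>?J. if j = i then of_nat H else 0)"
  proof (intro sum.cong refl)
    fix i j assume ij: "i \<in> ?J" "j \<in> ?J"
    show "(\<Sum>h<H. ?e h i j) = (if j = i then of_nat H else 0)"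
    proof (cases "j = i")
      case False
      have "\<not> int H dvd int j - int i"
      proof
        assume "int H dvd int j - int i"
        then have "\<bar>int H\<bar> \<le> \<bar>int j - int i\<bar>" using False by (intro dvd_imp_le_int) auto
        with ij show False by (auto simp: grid_near_def)
      qed
      from sum_roots_of_unity[OF this H] False show ?thesis by simp
    qed simp
  qed
  also have "\<dots> = of_real (real (card ?J) * real H)" by simp
  finally have "(\<Sum>h<H. (norm (S h))\<^sup>2) = real (card ?J) * real H"
    by (simp only: of_real_eq_iff)
  then have "(\<Sum>h=1..<H. (norm (S h))\<^sup>2) \<le> real (card ?J) * real H"
    using sum_mono2[of "{..<H}" "{1..<H}" "\<lambda>h. (norm (S h))\<^sup>2"] by fastforce
  then have *: "(\<Sum>h=1..<H. (norm (S h))\<^sup>2) / (real H)\<^sup>2 \<le> real (card ?J) * real H / (real H)\<^sup>2"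
    by (intro divide_right_mono) auto
  have "(\<Sum>h=1..<H. (norm (grid_coeff H \<delta> h))\<^sup>2) \<le> (\<Sum>h=1..<H. (norm (S h) / real H)\<^sup>2)"
    using norm_grid_coeff_le[of _ H \<delta>] by (intro sum_mono power_mono) (auto simp: S_def)
  also have "\<dots> = (\<Sum>h=1..<H. (norm (S h))\<^sup>2) / (real H)\<^sup>2"
    by (simp add: sum_divide_distrib power_divide)
  also note *
  finally show ?thesis using H by (simp add: power2_eq_square)
qed

lemma card_grid_near:
  assumes \<delta>: "0 < \<delta>" "\<delta> \<le> 1 / 2" and H: "0 < H"
  shows "\<bar>real (card (grid_near H \<delta>)) / real H - 2 * \<delta>\<bar> \<le> 1 / real H"
proof -
  \<comment> \<open>The grid points in question are those with \<open>j < c\<close> and, by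
    reflection, those with \<open>H - j < c\<close>. Since 0 has no mirror image below
    \<open>H\<close>, there are \<open>2 * c - 1\<close> of them;
    \<open>\<delta> \<le> 1 / 2\<close> keeps the two ranges disjoint.\<close>
  define c where "c = nat \<lceil>\<delta> * real H\<rceil>"
  have dH: "0 < \<delta> * real H" using \<delta> H by simp
  have cr: "\<delta> * real H \<le> real c" "real c < \<delta> * real H + 1"
    using dH unfolding c_def by linarith+
  have lt_iff: "real j < \<delta> * real H \<longleftrightarrow> j < c" for j
    unfolding c_def by linarith
  have nd: "dist_int (real j / real H) < \<delta> \<longleftrightarrow> j < c \<or> H < j + c" if "j < H" for j
  proof -
    have q: "0 \<le> real j / real H" "real j / real H < 1" using that by auto
    have "dist_int (real j / real H) < \<delta> \<longleftrightarrow> real j / real H < \<delta> \<or> 1 - real j / real H < \<delta>"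
    proof
      assume a: "dist_int (real j / real H) < \<delta>"
      define m where "m = round (real j / real H)"
      have "real_of_int m \<le> real j / real H + 1 / 2" "real j / real H - 1 / 2 \<le> real_of_int m"
        using of_int_round_le[of "real j / real H"] of_int_round_ge[of "real j / real H"] by (auto simp: m_def)
      then have "m < 2" "-1 < m" using q by linarith+
      then have "m = 0 \<or> m = 1" by linarith
      with a q show "real j / real H < \<delta> \<or> 1 - real j / real H < \<delta>"
        unfolding dist_int_eq_round m_def[symmetric] by auto
    next
      assume "real j / real H < \<delta> \<or> 1 - real j / real H < \<delta>"
      then show "dist_int (real j / real H) < \<delta>"
        using dist_int_le[of "real j / real H" 0] dist_int_le[of "real j / real H" 1] q by auto
    qed
    also have "real j / real H < \<delta> \<longleftrightarrow> real j < \<delta> * real H" using H by (simp add: field_simps)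
    also have "\<dots> \<longleftrightarrow> j < c" by (rule lt_iff)
    also have "1 - real j / real H < \<delta> \<longleftrightarrow> real (H - j) < \<delta> * real H"
      using H that by (simp add: field_simps of_nat_diff)
    also have "\<dots> \<longleftrightarrow> H < j + c" unfolding lt_iff using that by auto
    finally show ?thesis .
  qed
  have "\<delta> * real H \<le> real H / 2" using \<delta> mult_right_mono[of \<delta> "1/2" "real H"] by simp
  then have "2 * real c < real H + 2" using cr by linarith
  then have cH: "2 * c \<le> H + 1" by linarith
  have c1: "1 \<le> c" using cr dH by linarith
  have "grid_near H \<delta> = {..<c} \<union> {H + 1 - c..<H}"
    using nd cH c1 H by (auto simp: grid_near_def)
  moreover have "{..<c} \<inter> {H + 1 - c..<H} = {}" using cH by auto
  ultimately have "card (grid_near H \<delta>) = c + (c - 1)"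
    using cH c1 H by (simp add: card_Un_disjoint)
  then have "real (card (grid_near H \<delta>)) = 2 * real c - 1" using c1 by (simp add: of_nat_diff)
  then have "\<bar>real (card (grid_near H \<delta>)) - 2 * \<delta> * real H\<bar> \<le> 1" using cr by simp
  then have "\<bar>real (card (grid_near H \<delta>)) - 2 * \<delta> * real H\<bar> / real H \<le> 1 / real H"
    by (intro divide_right_mono) auto
  moreover have "real (card (grid_near H \<delta>)) / real H - 2 * \<delta> = (real (card (grid_near H \<delta>)) - 2 * \<delta> * real H) / real H"
    using H by (simp add: field_simps)
  ultimately show ?thesis by simp
qed

section \<open>A large sieve and the separation of variables\<close>

lemma sum_fibres_le:
  fixes g :: "'b \<Rightarrow> real"
  assumes "finite P" "finite R" "\<And>p. p \<in> P \<Longrightarrow> \<pi> p \<in> R" "\<And>l. l \<in> R \<Longrightarrow> 0 \<le> g l"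
    and "\<And>l. l \<in> R \<Longrightarrow> real (card {p\<in>P. \<pi> p = l}) \<le> c"
  shows "(\<Sum>p\<in>P. g (\<pi> p)) \<le> c * (\<Sum>l\<in>R. g l)"
proof -
  have "(\<Sum>p\<in>P. g (\<pi> p)) = (\<Sum>l\<in>R. \<Sum>p\<in>{p\<in>P. \<pi> p = l}. g (\<pi> p))"
    using assms by (intro sum.group[symmetric]) auto
  also have "\<dots> = (\<Sum>l\<in>R. real (card {p\<in>P. \<pi> p = l}) * g l)" by simp
  also have "\<dots> \<le> (\<Sum>l\<in>R. c * g l)"
    using assms by (intro sum_mono mult_right_mono) auto
  finally show ?thesis by (simp add: sum_distrib_left)
qed

lemma card_le_fibres:
  assumes "finite I" "\<And>i. i \<in> I \<Longrightarrow> \<phi> i \<in> R" "finite R" "\<And>m. real (card {i\<in>I. \<phi> i = m}) \<le> \<Phi>"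
  shows "real (card I) \<le> \<Phi> * real (card R)"
  using sum_fibres_le[of I R \<phi> "\<lambda>_. 1" \<Phi>] assms by simp

text \<open>The inequality between \<open>2 * b i * b j\<close> and the sum of the squares separates
  the indices; by the symmetry of \<open>k\<close> both halves reduce to row sums.\<close>

lemma schur_test_symmetric:
  fixes b :: "'a \<Rightarrow> real" and k :: "'a \<Rightarrow> 'a \<Rightarrow> real"
  assumes "finite J" "\<And>i j. i \<in> J \<Longrightarrow> j \<in> J \<Longrightarrow> 0 \<le> k i j" "\<And>i j. k i j = k j i"
    and W: "\<And>i. i \<in> J \<Longrightarrow> (\<Sum>j\<in>J. k i j) \<le> W"
  shows "(\<Sum>i\<in>J. \<Sum>j\<in>J. \<bar>b i\<bar> * \<bar>b j\<bar> * k i j) \<le> W * (\<Sum>i\<in>J. (b i)\<^sup>2)"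
proof -
  have "(\<Sum>i\<in>J. \<Sum>j\<in>J. \<bar>b i\<bar> * \<bar>b j\<bar> * k i j)
      \<le> (\<Sum>i\<in>J. \<Sum>j\<in>J. (b i)\<^sup>2 * k i j / 2 + (b j)\<^sup>2 * k j i / 2)"
  proof (intro sum_mono)
    fix i j assume ij: "i \<in> J" "j \<in> J"
    have "2 * (\<bar>b i\<bar> * \<bar>b j\<bar>) \<le> (b i)\<^sup>2 + (b j)\<^sup>2"
      using sum_squares_bound[of "\<bar>b i\<bar>" "\<bar>b j\<bar>"] by simp
    then have "2 * (\<bar>b i\<bar> * \<bar>b j\<bar>) * k i j \<le> ((b i)\<^sup>2 + (b j)\<^sup>2) * k i j"
      using assms ij by (intro mult_right_mono) auto
    then show "\<bar>b i\<bar> * \<bar>b j\<bar> * k i j \<le> (b i)\<^sup>2 * k i j / 2 + (b j)\<^sup>2 * k j i / 2"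
      using assms(3)[of i j] by (simp add: algebra_simps)
  qed
  also have "\<dots> = (\<Sum>i\<in>J. \<Sum>j\<in>J. (b i)\<^sup>2 * k i j)"
  proof -
    have "(\<Sum>i\<in>J. \<Sum>j\<in>J. (b j)\<^sup>2 * k j i / 2) = (\<Sum>i\<in>J. \<Sum>j\<in>J. (b i)\<^sup>2 * k i j / 2)"
      by (rule sum.swap)
    then show ?thesis by (simp add: sum.distrib) (simp add: sum_divide_distrib[symmetric])
  qed
  also have "\<dots> = (\<Sum>i\<in>J. (b i)\<^sup>2 * (\<Sum>j\<in>J. k i j))" by (simp add: sum_distrib_left)
  also have "\<dots> \<le> (\<Sum>i\<in>J. (b i)\<^sup>2 * W)"
    using W by (intro sum_mono mult_left_mono) auto
  finally show ?thesis by (simp add: sum_distrib_left mult.commute)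
qed

text \<open>Expanding the square and summing over \<open>l\<close> first leaves a kernel of
  geometric sums, to which the Schur test applies; \<open>sum_interval_le\<close> bounds its rows.
  The multiplicity \<open>\<Phi>\<close> is there because the indices will be sets of primes and
  tuples, not integers.\<close>

lemma (in separated_multiples) large_sieve:
  fixes b :: "'j \<Rightarrow> real" and \<psi> :: "'j \<Rightarrow> nat"
  assumes J: "finite J" and \<psi>: "\<And>j. j \<in> J \<Longrightarrow> \<psi> j \<in> {1..N}"
    and fib: "\<And>n. real (card {j\<in>J. \<psi> j = n}) \<le> \<Phi>" and L: "0 < L"
  shows "(\<Sum>l=1..L. (norm (\<Sum>j\<in>J. b j * unit_exp (real l * (\<alpha> * real (\<psi> j)))))\<^sup>2)
    \<le> 4 * T^3 * \<Phi> * (real N / s + 1) * (real L + s) * (\<Sum>j\<in>J. (b j)\<^sup>2)"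
proof -
  let ?e = "\<lambda>l i j. unit_exp (real l * (\<alpha> * real (\<psi> j) - \<alpha> * real (\<psi> i)))"
  define S where "S l = (\<Sum>j\<in>J. b j * unit_exp (real l * (\<alpha> * real (\<psi> j))))" for l :: nat
  define k where "k i j = 2 / (1 / real L + dist_int (\<alpha> * real (\<psi> j) - \<alpha> * real (\<psi> i)))" for i j
  have k_nonneg: "0 \<le> k i j" for i j
    unfolding k_def using L by (intro divide_nonneg_nonneg add_nonneg_nonneg dist_int_nonneg) auto
  have "complex_of_real (\<Sum>l=1..L. (norm (S l))\<^sup>2) = (\<Sum>l=1..L. cnj (S l) * S l)"
    by (simp add: complex_norm_square[symmetric] mult.commute)
  also have "\<dots> = (\<Sum>l=1..L. \<Sum>i\<in>J. \<Sum>j\<in>J. of_real (b i * b j) *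
        ?e l i j)"
    unfolding S_def cnj_sum sum_product
  proof (intro sum.cong refl)
    fix l i j
    have "?e l i j
        = cnj (unit_exp (real l * (\<alpha> * real (\<psi> i)))) * unit_exp (real l * (\<alpha> * real (\<psi> j)))"
      unfolding unit_exp_minus[symmetric] unit_exp_add[symmetric] by (simp add: algebra_simps)
    then show "cnj (of_real (b i) * unit_exp (real l * (\<alpha> * real (\<psi> i)))) *
        (of_real (b j) * unit_exp (real l * (\<alpha> * real (\<psi> j)))) = of_real (b i * b j) *
        ?e l i j"
      by simp
  qed
  also have "\<dots> = (\<Sum>i\<in>J. \<Sum>j\<in>J. of_real (b i * b j) *
      (\<Sum>l=1..L. ?e l i j))"
    unfolding sum_distrib_left by (rule trans[OF sum.swap], intro sum.cong refl, rule sum.swap)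
  finally have eq: "complex_of_real (\<Sum>l=1..L. (norm (S l))\<^sup>2) = \<dots>" .
  have "(\<Sum>l=1..L. (norm (S l))\<^sup>2) = norm (complex_of_real (\<Sum>l=1..L. (norm (S l))\<^sup>2))"
    by (simp only: norm_of_real) (simp add: sum_nonneg)
  also have "\<dots> \<le> (\<Sum>i\<in>J. \<Sum>j\<in>J. \<bar>b i\<bar> * \<bar>b j\<bar> * k i j)"
    unfolding eq
  proof (intro sum_norm_le)
    fix i j
    have "norm (\<Sum>l\<in>{0<..L}. ?e l i j) \<le> k i j"
      using norm_sum_unit_exp_le[of 0 L] L by (simp add: k_def)
    moreover have "{0<..L} = {1..L}" by auto
    ultimately show "norm (of_real (b i * b j) *
      (\<Sum>l=1..L. ?e l i j)) \<le> \<bar>b i\<bar> * \<bar>b j\<bar> * k i j"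
      by (simp only: norm_mult norm_of_real abs_mult) (intro mult_left_mono, auto)
  qed
  also have "\<dots> \<le> (4 * T^3 * \<Phi> * (real N / s + 1) * (real L + s)) * (\<Sum>j\<in>J. (b j)\<^sup>2)"
  proof (rule schur_test_symmetric[OF J])
    show "k i j = k j i" for i j by (simp add: k_def dist_int_minus_commute)
    fix i assume "i \<in> J"
    define g where "g n = 2 / (1 / real L + dist_int (\<alpha> * real n - \<alpha> * real (\<psi> i)))" for n :: nat
    have "(\<Sum>j\<in>J. k i j) = (\<Sum>j\<in>J. g (\<psi> j))" by (simp add: k_def g_def)
    also have "\<dots> \<le> \<Phi> * (\<Sum>n\<in>{1..N}. g n)"
      using \<psi> L by (intro sum_fibres_le J fib) (auto simp: g_def intro!: divide_nonneg_nonneg add_nonneg_nonneg dist_int_nonneg)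
    also have "(\<Sum>n\<in>{1..N}. g n) = 2 * (\<Sum>n=1..N. 1 / (1 / real L + dist_int (\<alpha> * real n + (- \<alpha> * real (\<psi> i)))))"
      by (simp add: g_def sum_distrib_left)
    also have "\<Phi> * \<dots> \<le> \<Phi> * (2 * (2 * T^3 * (real N / s + 1) * (real L + s)))"
      using L fib[of 0] by (intro mult_left_mono sum_interval_le) (auto intro: order_trans[OF of_nat_0_le_iff])
    finally show "(\<Sum>j\<in>J. k i j) \<le> 4 * T^3 * \<Phi> * (real N / s + 1) * (real L + s)" by (simp add: mult_ac)
  qed (rule k_nonneg)
  finally show ?thesis by (simp add: S_def)
qed

section \<open>Operator norms and order conditions\<close>

text \<open>\<open>B\<close> bounds the matrix \<open>K\<close> as an operator between spaces of
  square summable sequences. The bound has to hold for all coefficients at once: order conditions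
  are imposed by applying it to restrictions of the given coefficients.\<close>

definition op_bounded :: "'i set \<Rightarrow> 'j set \<Rightarrow> ('i \<Rightarrow> 'j \<Rightarrow> real) \<Rightarrow> real \<Rightarrow> bool" where
  "op_bounded I J K B \<longleftrightarrow> (\<forall>a b. \<bar>\<Sum>i\<in>I. \<Sum>j\<in>J. a i * b j * K i j\<bar>
     \<le> B * sqrt (\<Sum>i\<in>I. (a i)\<^sup>2) * sqrt (\<Sum>j\<in>J. (b j)\<^sup>2))"

lemma op_boundedD:
  "op_bounded I J K B \<Longrightarrow> \<bar>\<Sum>i\<in>I. \<Sum>j\<in>J. a i * b j * K i j\<bar>
     \<le> B * sqrt (\<Sum>i\<in>I. (a i)\<^sup>2) * sqrt (\<Sum>j\<in>J. (b j)\<^sup>2)"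
  by (simp add: op_bounded_def)

lemma op_bounded_transpose: "op_bounded I J K B \<Longrightarrow> op_bounded J I (\<lambda>j i. K i j) B"
  unfolding op_bounded_def
proof (intro allI)
  fix a b
  assume *: "\<forall>a b. \<bar>\<Sum>i\<in>I. \<Sum>j\<in>J. a i * b j * K i j\<bar>
     \<le> B * sqrt (\<Sum>i\<in>I. (a i)\<^sup>2) * sqrt (\<Sum>j\<in>J. (b j)\<^sup>2)"
  have "(\<Sum>i\<in>J. \<Sum>j\<in>I. a i * b j * K j i) = (\<Sum>i\<in>I. \<Sum>j\<in>J. b i * a j * K i j)"
    by (subst sum.swap) (simp add: mult_ac)
  with *[rule_format, of b a] show "\<bar>\<Sum>i\<in>J. \<Sum>j\<in>I. a i * b j * K j i\<bar>
      \<le> B * sqrt (\<Sum>i\<in>J. (a i)\<^sup>2) * sqrt (\<Sum>j\<in>I. (b j)\<^sup>2)"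
    by (simp add: mult_ac)
qed

text \<open>Cauchy-Schwarz in the plane. It combines two diagonal blocks with no loss, so that in
  \<open>op_bounded_less\<close> the constant grows linearly with the number of digits and not
  exponentially.\<close>

lemma sqrt_mult_add_le:
  assumes "0 \<le> p" "0 \<le> q" "0 \<le> p'" "0 \<le> q'"
  shows "sqrt p * sqrt q + sqrt p' * sqrt q' \<le> sqrt (p + p') * sqrt (q + q')"
proof (rule power2_le_imp_le)
  have "2 * (sqrt p * sqrt q') * (sqrt p' * sqrt q) \<le> (sqrt p * sqrt q')\<^sup>2 + (sqrt p' * sqrt q)\<^sup>2"
    by (rule sum_squares_bound)
  then show "(sqrt p * sqrt q + sqrt p' * sqrt q')\<^sup>2 \<le> (sqrt (p + p') * sqrt (q + q'))\<^sup>2"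
    using assms by (simp add: power_mult_distrib power2_sum algebra_simps)
qed (use assms in auto)

text \<open>For \<open>u, v < 2 ^ r\<close> the condition \<open>u < v\<close> means that at the first binary digit where they
  differ it is \<open>u\<close> that has the digit 0. Each digit position contributes a block diagonal matrix,
  hence no more than the norm of the full matrix.\<close>

lemma op_bounded_less:
  fixes u :: "'i \<Rightarrow> nat" and v :: "'j \<Rightarrow> nat"
  assumes K: "op_bounded I J K B" and B: "0 \<le> B"
  shows "\<lbrakk>\<And>i. i \<in> I \<Longrightarrow> u i < 2 ^ r; \<And>j. j \<in> J \<Longrightarrow> v j < 2 ^ r\<rbrakk>
    \<Longrightarrow> op_bounded I J (\<lambda>i j. if u i < v j then K i j else 0) (real r * B)"
proof (induction r arbitrary: u v)
  case 0
  then have "(\<Sum>i\<in>I. \<Sum>j\<in>J. a i * b j * (if u i < v j then K i j else 0)) = 0" for a b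
    by (intro sum.neutral ballI) fastforce
  then show ?case by (simp add: op_bounded_def)
next
  case (Suc r)
  define h :: nat where "h = 2 ^ r"
  define u' where "u' i = u i mod h" for i
  define v' where "v' j = v j mod h" for j
  let ?K' = "\<lambda>i j. if u' i < v' j then K i j else 0"
  have IH: "op_bounded I J ?K' (real r * B)"
    by (rule Suc.IH) (auto simp: u'_def v'_def h_def)
  show ?case unfolding op_bounded_def
  proof (intro allI)
    fix a :: "'i \<Rightarrow> real" and b :: "'j \<Rightarrow> real"
    define a0 where "a0 i = (if u i < h then a i else 0)" for i
    define a1 where "a1 i = (if u i < h then 0 else a i)" for i
    define b0 where "b0 j = (if v j < h then b j else 0)" for j
    define b1 where "b1 j = (if v j < h then 0 else b j)" for j
    \<comment> \<open>The suffix of \<open>a0\<close>, \<open>a1\<close>, \<open>b0\<close>,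
      \<open>b1\<close> is the leading binary digit. For digits 0 and 1 the condition holds and the
      full matrix appears; for equal digits it passes to the remainders modulo \<open>h\<close>; for
      1 and 0 it fails.\<close>
    have "(\<Sum>i\<in>I. \<Sum>j\<in>J. a i * b j * (if u i < v j then K i j else 0))
        = (\<Sum>i\<in>I. \<Sum>j\<in>J. a0 i * b1 j * K i j + (a0 i * b0 j * ?K' i j + a1 i * b1 j * ?K' i j))"
    proof (intro sum.cong refl)
      fix i j assume "i \<in> I" "j \<in> J"
      then have "u i < 2 * h" "v j < 2 * h" using Suc.prems by (auto simp: h_def)
      then have "u' i = (if u i < h then u i else u i - h)" "v' j = (if v j < h then v j else v j - h)"
        by (auto simp: u'_def v'_def mod_if)
      then show "a i * b j * (if u i < v j then K i j else 0)
          = a0 i * b1 j * K i j + (a0 i * b0 j * ?K' i j + a1 i * b1 j * ?K' i j)"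
        by (auto simp: a0_def a1_def b0_def b1_def)
    qed
    also have "\<dots> = (\<Sum>i\<in>I. \<Sum>j\<in>J. a0 i * b1 j * K i j)
        + ((\<Sum>i\<in>I. \<Sum>j\<in>J. a0 i * b0 j * ?K' i j) + (\<Sum>i\<in>I. \<Sum>j\<in>J. a1 i * b1 j * ?K' i j))"
      by (simp add: sum.distrib)
    finally have eq: "(\<Sum>i\<in>I. \<Sum>j\<in>J. a i * b j * (if u i < v j then K i j else 0)) = \<dots>" .
    define p p0 p1 where "p = (\<Sum>i\<in>I. (a i)\<^sup>2)" and "p0 = (\<Sum>i\<in>I. (a0 i)\<^sup>2)" and "p1 = (\<Sum>i\<in>I. (a1 i)\<^sup>2)"
    define q q0 q1 where "q = (\<Sum>j\<in>J. (b j)\<^sup>2)" and "q0 = (\<Sum>j\<in>J. (b0 j)\<^sup>2)" and "q1 = (\<Sum>j\<in>J. (b1 j)\<^sup>2)"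
    have nonneg: "0 \<le> p0" "0 \<le> p1" "0 \<le> q0" "0 \<le> q1"
      by (simp_all add: p0_def p1_def q0_def q1_def sum_nonneg)
    have p: "p = p0 + p1" unfolding p_def p0_def p1_def sum.distrib[symmetric]
      by (rule sum.cong) (auto simp: a0_def a1_def)
    have q: "q = q0 + q1" unfolding q_def q0_def q1_def sum.distrib[symmetric]
      by (rule sum.cong) (auto simp: b0_def b1_def)
    have 1: "\<bar>\<Sum>i\<in>I. \<Sum>j\<in>J. a0 i * b1 j * K i j\<bar> \<le> B * sqrt p * sqrt q"
    proof -
      have "\<bar>\<Sum>i\<in>I. \<Sum>j\<in>J. a0 i * b1 j * K i j\<bar> \<le> B * sqrt p0 * sqrt q1"
        unfolding p0_def q1_def by (rule op_boundedD[OF K])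
      also have "\<dots> \<le> B * sqrt p * sqrt q"
        using nonneg B by (intro mult_mono) (auto simp: p q)
      finally show ?thesis .
    qed
    have 2: "\<bar>\<Sum>i\<in>I. \<Sum>j\<in>J. a0 i * b0 j * ?K' i j\<bar> \<le> real r * B * sqrt p0 * sqrt q0"
      unfolding p0_def q0_def by (rule op_boundedD[OF IH])
    have 3: "\<bar>\<Sum>i\<in>I. \<Sum>j\<in>J. a1 i * b1 j * ?K' i j\<bar> \<le> real r * B * sqrt p1 * sqrt q1"
      unfolding p1_def q1_def by (rule op_boundedD[OF IH])
    have "real r * B * (sqrt p0 * sqrt q0 + sqrt p1 * sqrt q1) \<le> real r * B * (sqrt p * sqrt q)"
      unfolding p q using nonneg B by (intro mult_left_mono sqrt_mult_add_le) auto
    with 1 2 3 show "\<bar>\<Sum>i\<in>I. \<Sum>j\<in>J. a i * b j * (if u i < v j then K i j else 0)\<bar>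
        \<le> real (Suc r) * B * sqrt (\<Sum>i\<in>I. (a i)\<^sup>2) * sqrt (\<Sum>j\<in>J. (b j)\<^sup>2)"
      unfolding eq p_def[symmetric] q_def[symmetric] by (simp add: algebra_simps)
  qed
qed

lemma op_bounded_greater:
  fixes u :: "'i \<Rightarrow> nat" and v :: "'j \<Rightarrow> nat"
  assumes "op_bounded I J K B" "0 \<le> B" "\<And>i. i \<in> I \<Longrightarrow> u i < 2 ^ r" "\<And>j. j \<in> J \<Longrightarrow> v j < 2 ^ r"
  shows "op_bounded I J (\<lambda>i j. if v j < u i then K i j else 0) (real r * B)"
  using op_bounded_transpose[OF op_bounded_less[OF op_bounded_transpose[OF assms(1)], of v r u]] assms
  by simp

section \<open>Bilinear sums\<close>

text \<open>\<open>E\<close> is the error aimed at. \<open>E1\<close> and \<open>E2\<close> are the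
  two terms of the bilinear estimate, \<open>E3\<close> belongs to the progressions; for the
  parameters chosen later \<open>E2\<close> is an equality. The divisor bound reaches up to the
  square of \<open>x\<close> because it is applied to products \<open>h * m\<close> with both
  factors at most \<open>x\<close>.\<close>

locale bilinear_setup = separated_multiples +
  fixes x H :: nat and V \<delta> E :: real and \<gamma> :: "nat \<Rightarrow> complex"
  assumes x_eq: "real x = s\<^sup>2" and s_eq: "s = V\<^sup>2" and V1: "1 \<le> V" and s2: "2 \<le> s"
    and H1: "1 \<le> H" and H_le: "H \<le> x" and \<delta>0: "0 < \<delta>"
    and tau_le: "\<And>l. 1 \<le> l \<Longrightarrow> l \<le> x\<^sup>2 \<Longrightarrow> real (card {d. d dvd l}) \<le> T"
    and bits: "\<exists>r. x + 1 < 2 ^ r \<and> real r \<le> T"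
    and \<gamma>_le: "\<And>h. h \<in> {1..<H} \<Longrightarrow> norm (\<gamma> h) \<le> 3 * \<delta>"
    and \<gamma>_square: "(\<Sum>h=1..<H. (norm (\<gamma> h))\<^sup>2) \<le> 3 * \<delta>"
    and E0: "0 \<le> E" and E1: "\<delta> * (real H * s) * real x \<le> 2 * E\<^sup>2" and E2: "\<delta> * (real x / V) * real x \<le> E\<^sup>2"
    and E3: "\<delta> * (real H)\<^sup>2 * s \<le> 4 * E"
begin

definition F :: "nat \<Rightarrow> real" where
  "F n = 2 * Re (\<Sum>h=1..<H. \<gamma> h * unit_exp (real h * (\<alpha> * real n)))"

text \<open>For a single frequency \<open>h\<close> the multiples of \<open>h * \<alpha>\<close> may
  be badly spaced. With \<open>l = h * \<phi> i\<close> as one variable the points are again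
  multiples of \<open>\<alpha>\<close>, and the coefficients enter through their mean square.
  Cauchy-Schwarz over \<open>l\<close> then separates a divisor count from the large sieve.\<close>

lemma bilinear_bound:
  fixes a :: "'i \<Rightarrow> real" and b :: "'j \<Rightarrow> real" and \<phi> :: "'i \<Rightarrow> nat" and \<psi> :: "'j \<Rightarrow> nat"
  assumes I: "finite I" and J: "finite J" and \<phi>: "\<And>i. i \<in> I \<Longrightarrow> \<phi> i \<in> {1..M}" and \<psi>: "\<And>j. j \<in> J \<Longrightarrow> \<psi> j \<in> {1..N}"
    and M: "1 \<le> M" "M \<le> x"
    and fib: "\<And>m. real (card {i\<in>I. \<phi> i = m}) \<le> \<Phi>" "\<And>n. real (card {j\<in>J. \<psi> j = n}) \<le> \<Phi>"
  shows "(\<Sum>i\<in>I. \<Sum>j\<in>J. a i * b j * F (\<phi> i * \<psi> j))\<^sup>2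
    \<le> 48 * \<delta> * T^4 * \<Phi>\<^sup>2 * ((real N / s + 1) * (real H * real M + s)) * (\<Sum>i\<in>I. (a i)\<^sup>2) * (\<Sum>j\<in>J. (b j)\<^sup>2)"
proof -
  let ?S = "\<Sum>i\<in>I. \<Sum>j\<in>J. a i * b j * F (\<phi> i * \<psi> j)"
  let ?u = "\<lambda>h i j. \<gamma> h * a i * (b j * unit_exp (real (h * \<phi> i) * (\<alpha> * real (\<psi> j))))"
  have \<Phi>0: "0 \<le> \<Phi>" using fib(1)[of 0] by (rule order_trans[rotated]) simp
  define S where "S l = (\<Sum>j\<in>J. b j * unit_exp (real l * (\<alpha> * real (\<psi> j))))" for l :: nat
  define P where "P = {1..<H} \<times> I"
  define Pl where "Pl l = {p\<in>P. (case p of (h, i) \<Rightarrow> h * \<phi> i) = l}" for l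
  define A where "A l = (\<Sum>(h, i)\<in>Pl l. \<gamma> h * a i)" for l
  define L where "L = H * M"
  let ?W = "\<lambda>l. \<Sum>(h, i)\<in>Pl l. (norm (\<gamma> h))\<^sup>2 * (a i)\<^sup>2"
  define U where "U = (\<Sum>(h, i)\<in>P. \<gamma> h * a i * S (h * \<phi> i))"
  have finP: "finite P" using I by (simp add: P_def)
  have finPl: "finite (Pl l)" for l using finP by (simp add: Pl_def)
  have range: "(case p of (h, i) \<Rightarrow> h * \<phi> i) \<in> {1..L}" if "p \<in> P" for p
    using that \<phi> unfolding P_def L_def by (force intro!: mult_le_mono)
  have "?S = 2 * Re U"
  proof -
    have "U = (\<Sum>h=1..<H. \<Sum>i\<in>I. \<Sum>j\<in>J. ?u h i j)"
      unfolding U_def P_def S_def sum.cartesian_product[symmetric] sum_distrib_left ..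
    also have "\<dots> = (\<Sum>i\<in>I. \<Sum>h=1..<H. \<Sum>j\<in>J. ?u h i j)"
      by (rule sum.swap)
    also have "\<dots> = (\<Sum>i\<in>I. \<Sum>j\<in>J. \<Sum>h=1..<H. ?u h i j)"
      by (rule sum.cong[OF refl], rule sum.swap)
    also have "\<dots> = (\<Sum>i\<in>I. \<Sum>j\<in>J. of_real (a i * b j) * (\<Sum>h=1..<H. \<gamma> h * unit_exp (real h * (\<alpha> * real (\<phi> i * \<psi> j)))))"
      unfolding sum_distrib_left by (intro sum.cong refl) (simp add: mult_ac)
    finally have "Re U = (\<Sum>i\<in>I. \<Sum>j\<in>J. a i * b j * Re (\<Sum>h=1..<H. \<gamma> h * unit_exp (real h * (\<alpha> * real (\<phi> i * \<psi> j)))))"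
      by (simp add: Re_sum)
    then show ?thesis by (simp add: F_def sum_distrib_left mult_ac)
  qed
  moreover have "\<bar>Re U\<bar> \<le> norm U" by (rule abs_Re_le_cmod)
  ultimately have "\<bar>\<Sum>i\<in>I. \<Sum>j\<in>J. a i * b j * F (\<phi> i * \<psi> j)\<bar> \<le> 2 * norm U" by simp
  then have "?S\<^sup>2 \<le> (2 * norm U)\<^sup>2"
    by (subst power2_le_iff_abs_le) auto
  also have "\<dots> = 4 * (norm U)\<^sup>2" by (simp add: power_mult_distrib)
  also have "(norm U)\<^sup>2 \<le> (\<Sum>l=1..L. (norm (A l))\<^sup>2) * (\<Sum>l=1..L. (norm (S l))\<^sup>2)"
  proof -
    have "U = (\<Sum>l=1..L. \<Sum>p\<in>Pl l. case p of (h, i) \<Rightarrow> \<gamma> h * a i * S (h * \<phi> i))"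
      unfolding U_def Pl_def using finP range by (intro sum.group[symmetric]) auto
    also have "\<dots> = (\<Sum>l=1..L. A l * S l)"
      unfolding A_def sum_distrib_right by (intro sum.cong refl) (auto simp: Pl_def)
    finally have "norm U \<le> (\<Sum>l=1..L. norm (A l) * norm (S l))"
      by (simp add: sum_norm_le norm_mult)
    then have "(norm U)\<^sup>2 \<le> (\<Sum>l=1..L. norm (A l) * norm (S l))\<^sup>2"
      by (intro power_mono) auto
    also have "\<dots> \<le> (\<Sum>l=1..L. (norm (A l))\<^sup>2) * (\<Sum>l=1..L. (norm (S l))\<^sup>2)"
      by (rule Cauchy_Schwarz_ineq_sum)
    finally show ?thesis .
  qed
  also have "(\<Sum>l=1..L. (norm (A l))\<^sup>2) \<le> T * \<Phi> * (3 * \<delta> * (\<Sum>i\<in>I. (a i)\<^sup>2))"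
  proof -
    \<comment> \<open>A pair over \<open>l\<close> is determined by a divisor \<open>h\<close> of
      \<open>l\<close> together with an index \<open>i\<close> such that
      \<open>\<phi> i = l div h\<close>.\<close>
    have "(norm (A l))\<^sup>2 \<le> T * \<Phi> * ?W l" if l: "l \<in> {1..L}" for l
    proof -
      have "L \<le> x * x" unfolding L_def using H_le M by (intro mult_le_mono) auto
      with l have l2: "1 \<le> l" "l \<le> x\<^sup>2" by (auto simp: power2_eq_square)
      have findiv: "finite {d. d dvd l}" using l by simp
      have "Pl l \<subseteq> (SIGMA h:{d. d dvd l}. {i\<in>I. \<phi> i = l div h})"
        by (auto simp: Pl_def P_def)
      then have "card (Pl l) \<le> card (SIGMA h:{d. d dvd l}. {i\<in>I. \<phi> i = l div h})"
        using findiv I by (intro card_mono) auto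
      also have "\<dots> = (\<Sum>h\<in>{d. d dvd l}. card {i\<in>I. \<phi> i = l div h})"
        using findiv I by (intro card_SigmaI) auto
      finally have "real (card (Pl l)) \<le> real (\<Sum>h\<in>{d. d dvd l}. card {i\<in>I. \<phi> i = l div h})"
        by (simp only: of_nat_le_iff)
      also have "\<dots> = (\<Sum>h\<in>{d. d dvd l}. real (card {i\<in>I. \<phi> i = l div h}))"
        by (rule of_nat_sum)
      also have "\<dots> \<le> (\<Sum>h\<in>{d. d dvd l}. \<Phi>)" by (intro sum_mono fib)
      also have "\<dots> \<le> T * \<Phi>" using tau_le[OF l2] \<Phi>0 by (simp add: mult_right_mono)
      finally have card: "real (card (Pl l)) \<le> T * \<Phi>" .
      have "norm (A l) \<le> (\<Sum>p\<in>Pl l. 1 * (case p of (h, i) \<Rightarrow> norm (\<gamma> h) * \<bar>a i\<bar>))"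
        unfolding A_def by (intro sum_norm_le) (auto simp: norm_mult)
      then have "(norm (A l))\<^sup>2 \<le> (\<Sum>p\<in>Pl l. 1 * (case p of (h, i) \<Rightarrow> norm (\<gamma> h) * \<bar>a i\<bar>))\<^sup>2"
        by (intro power_mono) auto
      also have "\<dots> \<le> (\<Sum>p\<in>Pl l. 1\<^sup>2) * (\<Sum>p\<in>Pl l. (case p of (h, i) \<Rightarrow> norm (\<gamma> h) * \<bar>a i\<bar>)\<^sup>2)"
        by (rule Cauchy_Schwarz_ineq_sum)
      also have "\<dots> = real (card (Pl l)) * ?W l"
        by (simp add: case_prod_unfold power_mult_distrib)
      also have "\<dots> \<le> T * \<Phi> * ?W l"
        by (intro mult_right_mono card sum_nonneg) auto
      finally show ?thesis .
    qed
    then have "(\<Sum>l=1..L. (norm (A l))\<^sup>2) \<le> (\<Sum>l=1..L. T * \<Phi> * ?W l)"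
      by (intro sum_mono) auto
    also have "\<dots> = T * \<Phi> * (\<Sum>l=1..L. ?W l)"
      by (simp add: sum_distrib_left)
    also have "(\<Sum>l=1..L. ?W l) = (\<Sum>(h, i)\<in>P. (norm (\<gamma> h))\<^sup>2 * (a i)\<^sup>2)"
      unfolding Pl_def using finP range by (intro sum.group) auto
    also have "\<dots> = (\<Sum>h=1..<H. (norm (\<gamma> h))\<^sup>2) * (\<Sum>i\<in>I. (a i)\<^sup>2)"
      unfolding P_def by (simp add: sum.cartesian_product[symmetric] sum_product)
    also have "T * \<Phi> * \<dots> \<le> T * \<Phi> * (3 * \<delta> * (\<Sum>i\<in>I. (a i)\<^sup>2))"
      using T1 \<Phi>0 by (intro mult_left_mono mult_right_mono \<gamma>_square) (auto simp: sum_nonneg)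
    finally show ?thesis .
  qed
  also have "(\<Sum>l=1..L. (norm (S l))\<^sup>2) \<le> 4 * T^3 * \<Phi> * (real N / s + 1) * (real L + s) * (\<Sum>j\<in>J. (b j)\<^sup>2)"
    unfolding S_def using J \<psi> fib(2) H1 M by (intro large_sieve) (auto simp: L_def)
  also have "4 * (T * \<Phi> * (3 * \<delta> * (\<Sum>i\<in>I. (a i)\<^sup>2)) *
      (4 * T^3 * \<Phi> * (real N / s + 1) * (real L + s) * (\<Sum>j\<in>J. (b j)\<^sup>2)))
    = 48 * \<delta> * T^4 * \<Phi>\<^sup>2 * ((real N / s + 1) * (real H * real M + s)) * (\<Sum>i\<in>I. (a i)\<^sup>2) * (\<Sum>j\<in>J. (b j)\<^sup>2)"
    by (simp add: L_def power2_eq_square eval_nat_numeral)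
  finally show ?thesis
    using T1 \<Phi>0 \<delta>0 by (simp add: mult_left_mono mult_right_mono sum_nonneg)
qed

lemma op_bounded_F:
  fixes \<phi> :: "'i \<Rightarrow> nat" and \<psi> :: "'j \<Rightarrow> nat"
  assumes "finite I" "finite J" "\<And>i. i \<in> I \<Longrightarrow> \<phi> i \<in> {1..M}" "\<And>j. j \<in> J \<Longrightarrow> \<psi> j \<in> {1..N}"
    and "1 \<le> M" "M \<le> x"
    and fib: "\<And>m. real (card {i\<in>I. \<phi> i = m}) \<le> \<Phi>" "\<And>n. real (card {j\<in>J. \<psi> j = n}) \<le> \<Phi>"
    and Z: "(real N / s + 1) * (real H * real M + s) \<le> Z"
  shows "op_bounded I J (\<lambda>i j. F (\<phi> i * \<psi> j)) (sqrt (48 * \<delta> * T^4 * \<Phi>\<^sup>2 * Z))"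
  unfolding op_bounded_def
proof (intro allI)
  fix a :: "'i \<Rightarrow> real" and b :: "'j \<Rightarrow> real"
  have "(\<Sum>i\<in>I. \<Sum>j\<in>J. a i * b j * F (\<phi> i * \<psi> j))\<^sup>2
    \<le> 48 * \<delta> * T^4 * \<Phi>\<^sup>2 * ((real N / s + 1) * (real H * real M + s)) * (\<Sum>i\<in>I. (a i)\<^sup>2) * (\<Sum>j\<in>J. (b j)\<^sup>2)"
    by (rule bilinear_bound) (use assms in auto)
  also have "\<dots> \<le> 48 * \<delta> * T^4 * \<Phi>\<^sup>2 * Z * (\<Sum>i\<in>I. (a i)\<^sup>2) * (\<Sum>j\<in>J. (b j)\<^sup>2)"
    using T1 \<delta>0 Z by (intro mult_right_mono mult_left_mono) (auto simp: sum_nonneg)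
  finally show "\<bar>\<Sum>i\<in>I. \<Sum>j\<in>J. a i * b j * F (\<phi> i * \<psi> j)\<bar>
    \<le> sqrt (48 * \<delta> * T^4 * \<Phi>\<^sup>2 * Z) * sqrt (\<Sum>i\<in>I. (a i)\<^sup>2) * sqrt (\<Sum>j\<in>J. (b j)\<^sup>2)"
    by (simp only: real_sqrt_mult[symmetric] real_sqrt_abs[symmetric]) (rule real_sqrt_le_mono)
qed

text \<open>Dyadic blocks for \<open>\<phi> i\<close> make the ranges of both variables explicit.
  The three free comparisons will express the order of the primes and the two ends of an interval.
  Each of the four conditions costs a factor \<open>r \<le> T\<close>, the number of blocks a fifth,
  and the remaining two come from the operator norm of a block.\<close>

lemma type_II_bound:
  fixes \<phi> :: "'i \<Rightarrow> nat" and \<psi> :: "'j \<Rightarrow> nat" and u1 u2 u3 :: "'i \<Rightarrow> nat" and v1 v2 v3 :: "'j \<Rightarrow> nat"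
  assumes I: "finite I" and J: "finite J"
    and \<phi>: "\<And>i. i \<in> I \<Longrightarrow> V < real (\<phi> i)" "\<And>i. i \<in> I \<Longrightarrow> real (\<phi> i) \<le> V * s"
    and \<psi>: "\<And>j. j \<in> J \<Longrightarrow> 1 \<le> \<psi> j"
    and fib: "\<And>m. real (card {i\<in>I. \<phi> i = m}) \<le> \<Phi>" "\<And>n. real (card {j\<in>J. \<psi> j = n}) \<le> \<Phi>"
    and a: "\<And>i. i \<in> I \<Longrightarrow> \<bar>a i\<bar> \<le> 1" and b: "\<And>j. j \<in> J \<Longrightarrow> \<bar>b j\<bar> \<le> 1"
    and u: "\<And>i. i \<in> I \<Longrightarrow> u1 i \<le> x + 1 \<and> u2 i \<le> x + 1 \<and> u3 i \<le> x + 1"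
    and v: "\<And>j. j \<in> J \<Longrightarrow> v1 j \<le> x + 1 \<and> v2 j \<le> x + 1 \<and> v3 j \<le> x + 1"
  shows "\<bar>\<Sum>i\<in>I. \<Sum>j\<in>J. if u1 i < v1 j \<and> u2 i < v2 j \<and> v3 j < u3 i \<and> \<phi> i * \<psi> j \<le> x
      then a i * b j * F (\<phi> i * \<psi> j) else 0\<bar> \<le> 24 * T^7 * \<Phi>\<^sup>2 * E"
proof -
  obtain r where r: "x + 1 < 2 ^ r" "real r \<le> T" using bits by blast
  have \<Phi>0: "0 \<le> \<Phi>" using fib(1)[of 0] by (rule order_trans[rotated]) simp
  have x1: "1 \<le> x"
  proof -
    have "1 \<le> s\<^sup>2" using s1 by (simp add: one_le_power)
    then show ?thesis using x_eq by linarith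
  qed
  have Vs: "V * s \<le> real x"
  proof -
    have "V * s \<le> V\<^sup>2 * s" using V1 s1 by (intro mult_right_mono) (auto simp: power2_eq_square)
    then show ?thesis by (simp add: x_eq s_eq power2_eq_square)
  qed
  have Vs': "V * s = real x / V" using V1 by (simp add: x_eq s_eq power2_eq_square)
  have \<phi>x: "\<phi> i \<le> x" if "i \<in> I" for i using \<phi>(2)[OF that] Vs by linarith
  have \<phi>1: "1 \<le> \<phi> i" if "i \<in> I" for i using \<phi>(1)[OF that] V1 by linarith
  let ?cond = "\<lambda>i j. u1 i < v1 j \<and> u2 i < v2 j \<and> v3 j < u3 i \<and> \<phi> i * \<psi> j \<le> x"
  let ?g = "\<lambda>i j. if ?cond i j then a i * b j * F (\<phi> i * \<psi> j) else 0"
  define It where "It t = {i\<in>I. 2 ^ t \<le> \<phi> i \<and> \<phi> i < 2 ^ Suc t}" for t :: nat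
  \<comment> \<open>A larger \<open>\<psi> j\<close> violates
    \<open>\<phi> i * \<psi> j \<le> x\<close> for every \<open>i\<close> in the block.\<close>
  define Jt where "Jt t = {j\<in>J. \<psi> j \<le> x div 2 ^ t}" for t :: nat
  have level: "\<exists>t<r. 2 ^ t \<le> n \<and> n < (2::nat) ^ Suc t" if "1 \<le> n" "n \<le> x" for n :: nat
  proof -
    define t where "t = (LEAST t. n < 2 ^ Suc t)"
    have ex: "n < 2 ^ Suc n" by (metis less_exp less_Suc_eq less_trans)
    then have t: "n < 2 ^ Suc t" unfolding t_def by (rule LeastI)
    have "2 ^ t \<le> n"
    proof (cases t)
      case 0 with that show ?thesis by simp
    next
      case (Suc t')
      then have "\<not> n < 2 ^ Suc t'" unfolding t_def by (metis lessI not_less_Least)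
      with Suc show ?thesis by simp
    qed
    moreover have "t < r"
    proof -
      have "(2::nat) ^ t < 2 ^ r" using \<open>2 ^ t \<le> n\<close> that r(1) by linarith
      then show ?thesis by (rule power_less_imp_less_exp[rotated]) simp
    qed
    ultimately show ?thesis using t by blast
  qed
  have disj: "It t \<inter> It t' = {}" if "t \<noteq> t'" for t t'
  proof -
    have "It t \<inter> It t' = {}" if "t < t'" for t t'
    proof -
      have "(2::nat) ^ Suc t \<le> 2 ^ t'" using that by (intro power_increasing) auto
      then show ?thesis by (auto simp: It_def)
    qed
    then show ?thesis using that by (metis inf_commute nat_neq_iff)
  qed
  have Iun: "I = (\<Union>t\<in>{..<r}. It t)"
    using level[OF \<phi>1 \<phi>x] by (auto simp: It_def)
  have piece: "\<bar>\<Sum>i\<in>It t. \<Sum>j\<in>J. ?g i j\<bar> \<le> T^4 * (24 * T\<^sup>2 * \<Phi>\<^sup>2 * E)" for t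
  proof (cases "It t = {}")
    case True
    then show ?thesis using T1 E0 by simp
  next
    case False
    define \<mu> :: real where "\<mu> = 2 ^ t"
    have \<mu>1: "1 \<le> \<mu>" by (simp add: \<mu>_def)
    obtain i0 where i0: "i0 \<in> It t" using False by blast
    have \<mu>_eq: "\<mu> = real (2 ^ t)" by (simp add: \<mu>_def)
    have "2 ^ t \<le> \<phi> i0" "\<phi> i0 < 2 * 2 ^ t" "i0 \<in> I" using i0 by (simp_all add: It_def)
    then have "\<mu> \<le> real (\<phi> i0)" "real (\<phi> i0) < 2 * \<mu>" "i0 \<in> I"
      unfolding \<mu>_eq by linarith+
    then have \<mu>: "V < 2 * \<mu>" "\<mu> \<le> V * s" "\<mu> \<le> real x"
      using \<phi>[of i0] Vs by linarith+
    have finI: "finite (It t)" and finJ: "finite (Jt t)" using I J by (simp_all add: It_def Jt_def)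
    have fibI: "real (card {i\<in>It t. \<phi> i = m}) \<le> \<Phi>" for m
      by (rule order_trans[OF _ fib(1)[of m]]) (use I in \<open>auto simp: It_def intro!: card_mono\<close>)
    have fibJ: "real (card {j\<in>Jt t. \<psi> j = n}) \<le> \<Phi>" for n
      by (rule order_trans[OF _ fib(2)[of n]]) (use J in \<open>auto simp: Jt_def intro!: card_mono\<close>)
    define N where "N = x div 2 ^ t"
    have N: "real N \<le> real x / \<mu>" 
      using of_nat_div_le_of_nat[of x "2 ^ t", where 'a = real] by (simp add: N_def \<mu>_def)
    have N1: "1 \<le> N"
    proof -
      have "2 ^ t \<le> x" using \<mu>(3) by (simp add: \<mu>_def flip: of_nat_le_iff)
      then show ?thesis using div_le_mono[of "2 ^ t" x "2 ^ t"] by (simp add: N_def)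
    qed
    have cardI: "real (card (It t)) \<le> \<Phi> * \<mu>"
    proof -
      have "real (card (It t)) \<le> \<Phi> * real (card {2 ^ t..<(2::nat) ^ Suc t})"
        by (rule card_le_fibres[OF finI _ _ fibI]) (auto simp: It_def)
      then show ?thesis by (simp add: \<mu>_def)
    qed
    have cardJ: "real (card (Jt t)) \<le> \<Phi> * (real x / \<mu>)"
    proof -
      have "real (card (Jt t)) \<le> \<Phi> * real (card {1..N})"
        using \<psi> by (intro card_le_fibres[OF finJ _ _ fibJ]) (auto simp: Jt_def N_def)
      also have "\<dots> \<le> \<Phi> * (real x / \<mu>)" using N \<Phi>0 by (intro mult_left_mono) auto
      finally show ?thesis .
    qed
    \<comment> \<open>Both cases below end here. Besides the term with \<open>H * s\<close> there
      remains \<open>2 * x / \<mu>\<close>, where \<open>\<mu> > V / 2\<close>, or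
      \<open>3 * \<mu>\<close>, where \<open>\<mu> \<le> V * s = x / V\<close>.\<close>
    define Z where "Z = 4 * (real H * s) + 4 * (real x / V)"
    define B where "B = sqrt (48 * \<delta> * T^4 * \<Phi>\<^sup>2 * Z)"
    have Hs: "1 \<le> real H" using H1 by simp
    have xs: "real x = s * s" by (simp add: x_eq power2_eq_square)
    \<comment> \<open>The variable with the shorter range is the one merged with the frequency:
      \<open>\<phi>\<close> when \<open>\<mu> \<le> s\<close>, otherwise \<open>\<psi>\<close>, by
      transposition.\<close>
    have op: "op_bounded (It t) (Jt t) (\<lambda>i j. F (\<phi> i * \<psi> j)) B"
    proof (cases "\<mu> \<le> s")
      case True
      have "(real N / s + 1) * (real H * real (2 ^ Suc t) + s) \<le> (s / \<mu> + 1) * (2 * real H * \<mu> + s)"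
      proof (rule mult_mono)
        have "real N / s \<le> (s * s / \<mu>) / s" using N s1 unfolding xs by (intro divide_right_mono) auto
        then show "real N / s + 1 \<le> s / \<mu> + 1" using s1 by simp
      qed (use \<mu>1 s1 in \<open>auto simp: \<mu>_def intro!: divide_nonneg_nonneg\<close>)
      also have "\<dots> \<le> (2 * s / \<mu>) * (2 * real H * \<mu> + s)"
        using True \<mu>1 s1 by (intro mult_right_mono) (auto simp: field_simps)
      also have "\<dots> = 4 * (real H * s) + 2 * (s * s / \<mu>)" using \<mu>1 by (simp add: field_simps)
      also have "\<dots> \<le> Z"
      proof -
        have "s * s / \<mu> \<le> s * s / (V / 2)" using \<mu> V1 \<mu>1 by (intro divide_left_mono) auto
        then show ?thesis by (simp add: Z_def xs)
      qed
      finally have Z: "(real N / s + 1) * (real H * real (2 ^ Suc t) + s) \<le> Z" .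
      have "real (2 ^ Suc t) \<le> 2 * s" using True by (simp add: \<mu>_def)
      also have "\<dots> \<le> real x" unfolding xs using s2 by (intro mult_right_mono) auto
      finally have M: "2 ^ Suc t \<le> x" by (simp only: of_nat_le_iff)
      show ?thesis unfolding B_def
        by (rule op_bounded_F[OF finI finJ _ _ _ M fibI fibJ Z])
           (use \<phi>1 \<psi> in \<open>auto simp: It_def Jt_def N_def\<close>)
    next
      case False
      have "(real (2 ^ Suc t) / s + 1) * (real H * real N + s) \<le> (2 * \<mu> / s + 1) * (real H * (s * s / \<mu>) + s)"
        using N s1 \<mu>1 unfolding xs by (intro mult_mono add_mono mult_left_mono) (auto simp: \<mu>_def)
      also have "\<dots> \<le> (3 * \<mu> / s) * (real H * (s * s / \<mu>) + s)"
        using False \<mu>1 s1 by (intro mult_right_mono) (auto simp: field_simps)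
      also have "\<dots> = 3 * (real H * s) + 3 * \<mu>" using \<mu>1 s1 by (simp add: field_simps)
      also have "\<dots> \<le> Z"
      proof -
        have "0 \<le> real H * s" "0 \<le> V * s" using s1 V1 by simp_all
        then show ?thesis using \<mu>(2) unfolding Z_def Vs'[symmetric] by linarith
      qed
      finally have Z: "(real (2 ^ Suc t) / s + 1) * (real H * real N + s) \<le> Z" .
      have Nx: "N \<le> x" by (simp add: N_def)
      have "op_bounded (Jt t) (It t) (\<lambda>j i. F (\<psi> j * \<phi> i)) B" unfolding B_def
        by (rule op_bounded_F[OF finJ finI _ _ N1 Nx fibJ fibI Z])
           (use \<phi>1 \<psi> in \<open>auto simp: It_def Jt_def N_def\<close>)
      from op_bounded_transpose[OF this] show ?thesis by (simp add: mult.commute)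
    qed
    have Z0: "0 \<le> Z" using s1 V1 by (simp add: Z_def)
    have B0: "0 \<le> B" unfolding B_def using Z0 T1 \<delta>0 by simp
    \<comment> \<open>This turns \<open>\<phi> i * \<psi> j \<le> x\<close> into a comparison of a
      quantity in \<open>i\<close> with one in \<open>j\<close>; adding 1 makes it strict.\<close>
    define u4 where "u4 i = x div \<phi> i + 1" for i
    have u4: "u4 i \<le> x + 1" for i by (simp add: u4_def)
    have bnd: "u1 i < 2 ^ r" "u2 i < 2 ^ r" "u3 i < 2 ^ r" "u4 i < 2 ^ r" if "i \<in> It t" for i
      using u[of i] u4[of i] that r(1) by (auto simp: It_def)
    have bndv: "v1 j < 2 ^ r" "v2 j < 2 ^ r" "v3 j < 2 ^ r" "\<psi> j < 2 ^ r" if "j \<in> Jt t" for j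
    proof -
      have "\<psi> j \<le> x" using that div_le_dividend[of x "2 ^ t"] unfolding Jt_def by (auto intro: order_trans)
      then show "v1 j < 2 ^ r" "v2 j < 2 ^ r" "v3 j < 2 ^ r" "\<psi> j < 2 ^ r"
        using v[of j] that r(1) by (auto simp: Jt_def)
    qed
    have op4: "op_bounded (It t) (Jt t) (\<lambda>i j. if \<psi> j < u4 i then F (\<phi> i * \<psi> j) else 0) (real r * B)"
      by (rule op_bounded_greater[OF op B0]) (auto intro: bnd bndv)
    have op3: "op_bounded (It t) (Jt t) (\<lambda>i j. if v3 j < u3 i then
        if \<psi> j < u4 i then F (\<phi> i * \<psi> j) else 0 else 0) (real r * (real r * B))"
      by (rule op_bounded_greater[OF op4]) (auto intro: bnd bndv simp: B0)
    have op2: "op_bounded (It t) (Jt t) (\<lambda>i j. if u2 i < v2 j then if v3 j < u3 i then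
        if \<psi> j < u4 i then F (\<phi> i * \<psi> j) else 0 else 0 else 0) (real r * (real r * (real r * B)))"
      by (rule op_bounded_less[OF op3]) (auto intro: bnd bndv simp: B0)
    have op1: "op_bounded (It t) (Jt t) (\<lambda>i j. if u1 i < v1 j then if u2 i < v2 j then if v3 j < u3 i then
        if \<psi> j < u4 i then F (\<phi> i * \<psi> j) else 0 else 0 else 0 else 0) (real r * (real r * (real r * (real r * B))))"
      by (rule op_bounded_less[OF op2]) (auto intro: bnd bndv simp: B0)
    have cond4: "\<phi> i * \<psi> j \<le> x \<longleftrightarrow> \<psi> j < u4 i" if "i \<in> I" for i j
      using \<phi>1[OF that] by (simp add: u4_def less_Suc_eq_le less_eq_div_iff_mult_less_eq mult.commute)
    have "(\<Sum>j\<in>J. ?g i j) = (\<Sum>j\<in>Jt t. ?g i j)" if i: "i \<in> It t" for i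
    proof (rule sum.mono_neutral_right[OF J])
      show "\<forall>j\<in>J - Jt t. ?g i j = 0"
      proof
        fix j assume "j \<in> J - Jt t"
        then have "x div 2 ^ t < \<psi> j" by (auto simp: Jt_def)
        then have "x < \<psi> j * 2 ^ t" by (simp add: div_less_iff_less_mult)
        also have "\<dots> \<le> \<phi> i * \<psi> j" using i by (simp add: It_def mult.commute)
        finally show "?g i j = 0" by simp
      qed
    qed (auto simp: Jt_def)
    then have "(\<Sum>i\<in>It t. \<Sum>j\<in>J. ?g i j) = (\<Sum>i\<in>It t. \<Sum>j\<in>Jt t. ?g i j)"
      by (rule sum.cong[OF refl])
    also have "\<dots> = (\<Sum>i\<in>It t. \<Sum>j\<in>Jt t. a i * b j * (if u1 i < v1 j then if u2 i < v2 j then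
        if v3 j < u3 i then if \<psi> j < u4 i then F (\<phi> i * \<psi> j) else 0 else 0 else 0 else 0))"
      using cond4 by (intro sum.cong refl) (auto simp: It_def)
    finally have "\<bar>\<Sum>i\<in>It t. \<Sum>j\<in>J. ?g i j\<bar>
        \<le> real r * (real r * (real r * (real r * B))) * sqrt (\<Sum>i\<in>It t. (a i)\<^sup>2) * sqrt (\<Sum>j\<in>Jt t. (b j)\<^sup>2)"
      using op_boundedD[OF op1, of a b] by simp
    also have "\<dots> \<le> (T^4 * B) * sqrt (\<Phi> * \<mu>) * sqrt (\<Phi> * (real x / \<mu>))"
    proof (rule mult_mono[OF mult_mono])
      have "real r * (real r * (real r * (real r * B))) = (real r)^4 * B" by (simp add: eval_nat_numeral)
      also have "\<dots> \<le> T^4 * B" using r B0 by (intro mult_right_mono power_mono) auto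
      finally show "real r * (real r * (real r * (real r * B))) \<le> T^4 * B" .
      have "(\<Sum>i\<in>It t. (a i)\<^sup>2) \<le> (\<Sum>i\<in>It t. 1)"
        using a by (intro sum_mono) (auto simp: It_def abs_square_le_1)
      then show "sqrt (\<Sum>i\<in>It t. (a i)\<^sup>2) \<le> sqrt (\<Phi> * \<mu>)" using cardI by simp
      have "(\<Sum>j\<in>Jt t. (b j)\<^sup>2) \<le> (\<Sum>j\<in>Jt t. 1)"
        using b by (intro sum_mono) (auto simp: Jt_def abs_square_le_1)
      then show "sqrt (\<Sum>j\<in>Jt t. (b j)\<^sup>2) \<le> sqrt (\<Phi> * (real x / \<mu>))" using cardJ by simp
    qed (use T1 B0 \<Phi>0 \<mu>1 in \<open>auto simp: sum_nonneg\<close>)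
    also have "\<dots> = T^4 * sqrt (48 * \<delta> * T^4 * \<Phi>\<^sup>2 * Z * (\<Phi> * \<mu> * (\<Phi> * (real x / \<mu>))))"
      by (simp only: B_def real_sqrt_mult[symmetric] mult.assoc)
    also have "48 * \<delta> * T^4 * \<Phi>\<^sup>2 * Z * (\<Phi> * \<mu> * (\<Phi> * (real x / \<mu>)))
        = 48 * (T^4 * \<Phi>^4) * (\<delta> * Z * real x)"
      using \<mu>1 by (simp add: eval_nat_numeral)
    \<comment> \<open>The 12 is \<open>4 * 2 + 4 * 1\<close> from \<open>E1\<close> and
      \<open>E2\<close>, and \<open>48 * 12\<close> is the square of 24.\<close>
    also have "sqrt \<dots> \<le> sqrt (48 * (T^4 * \<Phi>^4) * (12 * E\<^sup>2))"
    proof -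
      have "\<delta> * Z * real x = 4 * (\<delta> * (real H * s) * real x) + 4 * (\<delta> * (real x / V) * real x)"
        by (simp add: Z_def algebra_simps)
      also have "\<dots> \<le> 12 * E\<^sup>2" using E1 E2 by simp
      finally show ?thesis using T1 \<Phi>0 by (intro real_sqrt_le_mono mult_left_mono) auto
    qed
    also have "48 * (T^4 * \<Phi>^4) * (12 * E\<^sup>2) = (24 * T\<^sup>2 * \<Phi>\<^sup>2 * E)\<^sup>2"
      by (simp add: power_mult_distrib power_mult[symmetric])
    also have "sqrt \<dots> = 24 * T\<^sup>2 * \<Phi>\<^sup>2 * E" using T1 \<Phi>0 E0 by (intro real_sqrt_unique) auto
    finally show ?thesis using T1 by (simp add: mult_left_mono)
  qed
  have "(\<Sum>i\<in>I. \<Sum>j\<in>J. ?g i j) = (\<Sum>t<r. \<Sum>i\<in>It t. \<Sum>j\<in>J. ?g i j)"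
    using I disj by (subst Iun, subst sum.UNION_disjoint) (auto simp: It_def)
  also have "\<bar>\<dots>\<bar> \<le> (\<Sum>t<r. T^4 * (24 * T\<^sup>2 * \<Phi>\<^sup>2 * E))"
    by (rule order_trans[OF sum_abs]) (intro sum_mono piece)
  also have "\<dots> = real r * (T^4 * (24 * T\<^sup>2 * \<Phi>\<^sup>2 * E))" by simp
  also have "\<dots> \<le> T * (T^4 * (24 * T\<^sup>2 * \<Phi>\<^sup>2 * E))" using r T1 E0 by (intro mult_right_mono) auto
  also have "\<dots> = 24 * T^7 * \<Phi>\<^sup>2 * E" by (simp add: eval_nat_numeral)
  finally show ?thesis .
qed

end

section \<open>Factorisations of squarefree integers\<close>

lemma prod_primes_pos: "(\<And>p. p \<in> A \<Longrightarrow> prime p) \<Longrightarrow> 0 < \<Prod>A" for A :: "nat set"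
  by (intro prod_pos) (auto simp: prime_gt_0_nat)

lemma prime_dvd_prod_primes_iff:
  fixes A :: "nat set"
  assumes "finite A" "\<And>q. q \<in> A \<Longrightarrow> prime q" "prime p"
  shows "p dvd \<Prod>A \<longleftrightarrow> p \<in> A"
proof
  assume "p dvd \<Prod>A"
  then obtain q where "q \<in> A" "p dvd q" using assms prime_dvd_prod_iff[of A p "\<lambda>q. q"] by auto
  then show "p \<in> A" using assms by (metis primes_dvd_imp_eq)
next
  assume "p \<in> A"
  then show "p dvd \<Prod>A" using dvd_prodI[OF assms(1), of p "\<lambda>q. q"] by simp
qed

lemma inj_on_prod_primes:
  assumes "finite W" "\<And>p. p \<in> W \<Longrightarrow> prime (p :: nat)"
  shows "inj_on \<Prod> (Pow W)"
proof (rule inj_onI)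
  fix A B assume AB: "A \<in> Pow W" "B \<in> Pow W" "\<Prod>A = \<Prod>B"
  have "p \<in> A \<longleftrightarrow> p \<in> B" for p
  proof (cases "prime p")
    case True
    then have "p \<in> A \<longleftrightarrow> p dvd \<Prod>A" "p \<in> B \<longleftrightarrow> p dvd \<Prod>B"
      using AB assms by (subst prime_dvd_prod_primes_iff; auto intro: finite_subset)+
    with AB show ?thesis by simp
  qed (use AB assms in auto)
  then show "A = B" by blast
qed

lemma prod_primes_dvd_iff:
  fixes A :: "nat set"
  assumes "finite A" "\<And>q. q \<in> A \<Longrightarrow> prime q"
  shows "\<Prod>A dvd n \<longleftrightarrow> (\<forall>p\<in>A. p dvd n)"
  using assms
proof (induction A rule: finite_induct)
  case (insert p A)
  have "\<not> p dvd \<Prod>A" using prime_dvd_prod_primes_iff[of A p] insert by auto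
  then have "coprime p (\<Prod>A)" using insert.prems by (intro prime_imp_coprime) auto
  then have "p * \<Prod>A dvd n \<longleftrightarrow> p dvd n \<and> \<Prod>A dvd n"
    by (auto intro: divides_mult dest: dvd_mult_left dvd_mult_right)
  then show ?case using insert by simp
qed simp

lemma squarefree_prod_primes:
  fixes A :: "nat set"
  assumes "finite A" "\<And>q. q \<in> A \<Longrightarrow> prime q"
  shows "squarefree (\<Prod>A)"
  using assms by (intro squarefree_prod_coprime) (auto intro: primes_coprime squarefree_prime)

lemma prod_prime_factors_squarefree:
  assumes "squarefree (n :: nat)"
  shows "\<Prod>(prime_factors n) = n"
proof -
  have n0: "n \<noteq> 0" using assms by (metis not_squarefree_0)
  have "n = (\<Prod>p\<in>prime_factors n. p ^ multiplicity p n)"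
    using n0 by (simp add: prod_prime_factors)
  also have "\<dots> = (\<Prod>p\<in>prime_factors n. p)"
    using assms n0 by (intro prod.cong refl) (simp add: squarefree_factorial_semiring')
  finally show ?thesis by simp
qed

text \<open>Collect the elements of \<open>A\<close> in increasing order until their product exceeds \<open>V\<close>.\<close>

lemma bij_betw_prefix_split:
  fixes W :: "nat set" and V :: real
  notes of_nat_prod [simp del]
  assumes W: "finite W" "\<And>p. p \<in> W \<Longrightarrow> 1 \<le> p" and V: "1 \<le> V"
  shows "bij_betw (\<lambda>(A, B). A \<union> B)
    {(A, B). A \<subseteq> W \<and> A \<noteq> {} \<and> V < real (\<Prod>A) \<and> real (\<Prod>(A - {Max A})) \<le> V \<and> B \<subseteq> W \<and> (\<forall>q\<in>B. Max A < q)}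
    {A. A \<subseteq> W \<and> V < real (\<Prod>A)}"
    (is "bij_betw ?f ?P ?R")
proof (rule bij_betw_imageI)
  have pos: "1 \<le> \<Prod>B" if "B \<subseteq> W" for B
    using that W by (intro prod_ge_1) auto
  have mono: "\<Prod>A \<le> \<Prod>B" if "A \<subseteq> B" "B \<subseteq> W" for A B
  proof -
    have fin: "finite B" using that W(1) finite_subset by blast
    have "\<Prod>B = \<Prod>A * \<Prod>(B - A)" using prod.subset_diff[OF that(1) fin, of "\<lambda>x. x"] by (simp add: mult.commute)
    then show ?thesis using pos[of "B - A"] that by auto
  qed
  \<comment> \<open>Injectivity thereby reduces to showing that equal unions have equal
    maxima.\<close>
  have recover: "A = {p\<in>A \<union> B. p \<le> Max A}" if "(A, B) \<in> ?P" for A B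
    using that W(1) by (auto dest: finite_subset)
  \<comment> \<open>The prefix with the smaller maximum lies within the other prefix deprived of its
    maximum, whose product does not exceed \<open>V\<close>.\<close>
  have less: False
    if P: "(A, B) \<in> ?P" "(A', B') \<in> ?P" "A \<union> B = A' \<union> B'" "Max A < Max A'" for A B A' B'
  proof -
    have finA': "finite A'" using P(2) W(1) finite_subset by auto
    have "A \<subseteq> A' - {Max A'}"
    proof
      fix q assume "q \<in> A"
      then have q: "q \<in> A' \<union> B'" "q \<le> Max A" using recover[OF P(1)] P(3) by auto
      then have "q < Max A'" using P(4) by simp
      with q show "q \<in> A' - {Max A'}" using P(2) by auto
    qed
    then have "\<Prod>A \<le> \<Prod>(A' - {Max A'})" using P(2) by (intro mono) auto
    then have "real (\<Prod>A) \<le> real (\<Prod>(A' - {Max A'}))" by (simp only: of_nat_le_iff)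
    moreover have "V < real (\<Prod>A)" "real (\<Prod>(A' - {Max A'})) \<le> V" using P(1,2) by auto
    ultimately show False by linarith
  qed
  show "inj_on ?f ?P"
  proof (rule inj_onI, clarsimp split del: if_split)
    fix A B A' B'
    assume "A \<subseteq> W" "V < real (\<Prod>A)" "real (\<Prod>(A - {Max A})) \<le> V" "B \<subseteq> W" "\<forall>q\<in>B. Max A < q" "A \<noteq> {}"
      "A' \<subseteq> W" "V < real (\<Prod>A')" "real (\<Prod>(A' - {Max A'})) \<le> V" "B' \<subseteq> W" "\<forall>q\<in>B'. Max A' < q" "A' \<noteq> {}"
      and eq: "A \<union> B = A' \<union> B'"
    then have P: "(A, B) \<in> ?P" "(A', B') \<in> ?P" by auto
    have "Max A = Max A'" using less[OF P eq] less[OF P(2,1) eq[symmetric]] by (meson nat_neq_iff)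
    then have AA': "A = A'" using recover[OF P(1)] recover[OF P(2)] eq by simp
    have "B = {p\<in>A \<union> B. Max A < p}" "B' = {p\<in>A' \<union> B'. Max A' < p}"
      using P W(1) by (auto dest!: finite_subset simp: leD)
    then have "B = B'" unfolding eq \<open>Max A = Max A'\<close> by (rule trans[OF _ sym])
    with AA' show "A = A' \<and> B = B'" by simp
  qed
  show "?f ` ?P = ?R"
  proof (intro equalityI subsetI)
    fix C assume "C \<in> ?f ` ?P"
    then obtain A B where AB: "(A, B) \<in> ?P" "C = A \<union> B" by auto
    then have "\<Prod>A \<le> \<Prod>C" by (intro mono) auto
    then show "C \<in> ?R" using AB by auto
  next
    fix C assume C: "C \<in> ?R"
    then have finC: "finite C" using W(1) finite_subset by auto
    \<comment> \<open>The threshold is a value and not an index. Minimality forces it to be an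
      element of \<open>C\<close>, namely the last one collected.\<close>
    define t where "t = (LEAST t. V < real (\<Prod>{p\<in>C. p \<le> t}))"
    have Cne: "C \<noteq> {}" using C V by auto
    then have "{p\<in>C. p \<le> Max C} = C" using finC by auto
    then have "V < real (\<Prod>{p\<in>C. p \<le> Max C})" using C by simp
    then have t: "V < real (\<Prod>{p\<in>C. p \<le> t})" unfolding t_def by (rule LeastI)
    define A where "A = {p\<in>C. p \<le> t}"
    define B where "B = {p\<in>C. t < p}"
    have below: "real (\<Prod>{p\<in>C. p \<le> t'}) \<le> V" if "t' < t" for t'
      using not_less_Least[OF that[unfolded t_def]] by simp
    have "t \<in> C"
    proof (rule ccontr)
      assume nt: "t \<notin> C"
      show False
      proof (cases t)
        case 0
        then have "{p\<in>C. p \<le> t} = {}" using nt by auto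
        with t V show False by simp
      next
        case (Suc t')
        then have "{p\<in>C. p \<le> t} = {p\<in>C. p \<le> t'}" using nt by (auto simp: le_Suc_eq)
        with t below[of t'] Suc show False by simp
      qed
    qed
    then have maxA: "Max A = t" unfolding A_def using finC by (intro Max_eqI) auto
    have t1: "1 \<le> t" using W(2) C \<open>t \<in> C\<close> by auto
    then have "A - {t} = {p\<in>C. p \<le> t - 1}" unfolding A_def by auto
    then have "real (\<Prod>(A - {Max A})) \<le> V" using below[of "t - 1"] t1 by (simp add: maxA)
    then have "(A, B) \<in> ?P" using t C \<open>t \<in> C\<close> by (auto simp: maxA) (auto simp: A_def B_def)
    moreover have "C = A \<union> B" by (auto simp: A_def B_def)
    ultimately show "C \<in> ?f ` ?P" by force
  qed
qed

section \<open>Legendre's sieve\<close>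

lemma sum_signs_Pow: "(\<Sum>A\<in>Pow Q. (- 1) ^ card A) = (of_bool (Q = {}) :: real)" if "finite Q"
proof -
  have "(\<Prod>q\<in>Q. (1::real) - 1) = (\<Sum>A\<in>Pow Q. (\<Prod>a\<in>A. - 1) * (\<Prod>a\<in>Q - A. 1))"
    using prod_add[OF that, of "\<lambda>_. - 1::real" "\<lambda>_. 1"] by simp
  then show ?thesis using that by (cases "Q = {}") (auto simp: power_0_left)
qed

text \<open>An integer above \<open>s\<close> and at most the square of \<open>s\<close> is prime
  exactly when no prime up to \<open>s\<close> divides it. Sets of primes represent the squarefree
  divisors, and the sign is their Moebius value.\<close>

lemma legendre_prime_indicator:
  fixes s :: real
  assumes s: "1 \<le> s" "s < real k" "real k \<le> s\<^sup>2" and W: "W = {p. prime p \<and> real p \<le> s}"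
  shows "(\<Sum>B\<in>{B. B \<subseteq> W \<and> \<Prod>B dvd k}. (- 1) ^ card B) = (of_bool (prime k) :: real)"
proof -
  define Q where "Q = {p\<in>W. p dvd k}"
  have k0: "0 < k" using s by linarith
  have "W \<subseteq> {..nat \<lfloor>s\<rfloor>}" by (auto simp: W le_nat_floor)
  then have finW: "finite W" by (rule finite_subset) simp
  have "{B. B \<subseteq> W \<and> \<Prod>B dvd k} = Pow Q"
  proof (intro Collect_cong[of _ "\<lambda>B. B \<subseteq> Q", folded Pow_def])
    fix B
    show "B \<subseteq> W \<and> \<Prod>B dvd k \<longleftrightarrow> B \<subseteq> Q"
      using prod_primes_dvd_iff[of B k] finite_subset[OF _ finW, of B] by (auto simp: Q_def W)
  qed
  moreover have "Q = {} \<longleftrightarrow> prime k"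
  proof
    assume "prime k"
    then have "p = k" if "p \<in> Q" for p using that unfolding Q_def W by (metis (mono_tags, lifting) mem_Collect_eq primes_dvd_imp_eq)
    then show "Q = {}" using s by (auto simp: Q_def W)
  next
    assume Q: "Q = {}"
    show "prime k"
    proof (rule ccontr)
      assume np: "\<not> prime k"
      have "k \<noteq> 1" using s by auto
      then obtain p where p: "prime p" "p dvd k" using prime_factor_nat by blast
      then obtain m where m: "k = p * m" by blast
      have "m \<noteq> 1" using np p m by auto
      then obtain q where q: "prime q" "q dvd m" using prime_factor_nat by blast
      have "q \<le> m" using q m k0 by (intro dvd_imp_le) auto
      have "s < real p'" if "prime p'" "p' dvd k" for p'
      proof (rule ccontr)
        assume "\<not> s < real p'"
        then have "p' \<in> Q" using that by (simp add: Q_def W)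
        with Q show False by simp
      qed
      then have "s < real p" "s < real q" using p q m by auto
      then have "s * s < real p * real q" using s by (intro mult_strict_mono) auto
      also have "\<dots> \<le> real p * real m" using \<open>q \<le> m\<close> by (intro mult_left_mono) auto
      finally show False using s m by (simp add: power2_eq_square)
    qed
  qed
  ultimately show ?thesis using sum_signs_Pow[of Q] finW by (simp add: Q_def)
qed

text \<open>An integer up to the square of \<open>s\<close> has at most one prime factor above
  \<open>s\<close>; this is \<open>m\<close>, with 1 standing for its absence. Because
  \<open>y < s\<close>, the lower bound \<open>y\<close> restricts only the primes in
  \<open>W\<close>.\<close>

lemma bij_betw_sqfree_smooth:
  fixes s y z :: real and x :: nat
  assumes x: "real x = s\<^sup>2" and s: "1 \<le> s" and y: "2 \<le> y" "y < s"
    and W: "W = {p. prime p \<and> real p \<le> s \<and> y \<le> real p \<and> real p \<le> z}"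
    and M: "M = insert 1 {p. prime p \<and> s < real p \<and> real p \<le> z}"
  shows "bij_betw (\<lambda>(A, m). \<Prod>A * m) {(A, m). A \<subseteq> W \<and> m \<in> M \<and> \<Prod>A * m \<le> x} (sqfree_smooth (real x) y z)"
proof (rule bij_betw_byWitness[where f' = "\<lambda>n. ({p\<in>prime_factors n. real p \<le> s}, \<Prod>{p\<in>prime_factors n. s < real p})"])
  let ?P = "{(A, m). A \<subseteq> W \<and> m \<in> M \<and> \<Prod>A * m \<le> x}"
  let ?f' = "\<lambda>n. ({p\<in>prime_factors n. real p \<le> s}, \<Prod>{p\<in>prime_factors n. s < real p})"
  have "W \<subseteq> {..nat \<lfloor>s\<rfloor>}" by (auto simp: W le_nat_floor)
  then have finW: "finite W" by (rule finite_subset) simp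
  have pf: "prime_factors (\<Prod>A * m) = A \<union> (if m = 1 then {} else {m})" and pos: "0 < \<Prod>A * m"
    if "A \<subseteq> W" "m \<in> M" for A m
  proof -
    have finA: "finite A" and pA: "\<And>p. p \<in> A \<Longrightarrow> prime p"
      using that finW finite_subset by (auto simp: W)
    have pA0: "0 < \<Prod>A" using pA by (rule prod_primes_pos)
    have m: "m = 1 \<or> prime m" using that by (auto simp: M)
    then show "0 < \<Prod>A * m" using pA0 by (auto simp: prime_gt_0_nat)
    then show "prime_factors (\<Prod>A * m) = A \<union> (if m = 1 then {} else {m})"
      using m prime_dvd_prod_primes_iff[OF finA pA] pA
      by (auto simp: prime_factors_dvd prime_dvd_mult_iff dest: primes_dvd_imp_eq)
  qed
  show "\<forall>am\<in>?P. ?f' (case am of (A, m) \<Rightarrow> \<Prod>A * m) = am"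
  proof
    fix am assume "am \<in> ?P"
    then obtain A m where am: "am = (A, m)" and Am: "A \<subseteq> W" "m \<in> M" "\<Prod>A * m \<le> x" by auto
    have A: "real p \<le> s" if "p \<in> A" for p using Am that by (auto simp: W)
    have "?f' (\<Prod>A * m) = (A, m)"
    proof (cases "m = 1")
      case True
      then have "{p\<in>prime_factors (\<Prod>A * m). real p \<le> s} = A" "{p\<in>prime_factors (\<Prod>A * m). s < real p} = {}"
        unfolding pf[OF Am(1,2)] using A by force+
      with True show ?thesis by (simp only: prod.empty)
    next
      case False
      then have "s < real m" using Am by (auto simp: M)
      then have "{p\<in>prime_factors (\<Prod>A * m). real p \<le> s} = A" "{p\<in>prime_factors (\<Prod>A * m). s < real p} = {m}"
        unfolding pf[OF Am(1,2)] using A False by force+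
      then show ?thesis by (simp only:) simp
    qed
    then show "?f' (case am of (A, m) \<Rightarrow> \<Prod>A * m) = am" by (simp only: am prod.case)
  qed
  have n_facts: "{p\<in>prime_factors n. real p \<le> s} \<subseteq> W \<and> \<Prod>{p\<in>prime_factors n. s < real p} \<in> M
      \<and> \<Prod>{p\<in>prime_factors n. real p \<le> s} * \<Prod>{p\<in>prime_factors n. s < real p} = n"
    if n: "n \<in> sqfree_smooth (real x) y z" for n
  proof -
    have n': "0 < n" "n \<le> x" "squarefree n" "\<And>p. p \<in> prime_factors n \<Longrightarrow> prime p \<and> y \<le> real p \<and> real p \<le> z"
      using n by (auto simp: sqfree_smooth_def prime_factors_dvd)
    let ?S = "{p\<in>prime_factors n. real p \<le> s}" and ?B = "{p\<in>prime_factors n. s < real p}"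
    have "?S \<subseteq> W" using n' by (auto simp: W)
    moreover have split: "\<Prod>?S * \<Prod>?B = n"
    proof -
      have "\<Prod>?S * \<Prod>?B = \<Prod>(?S \<union> ?B)" by (rule prod.union_disjoint[symmetric]) auto
      also have "?S \<union> ?B = prime_factors n" by auto
      finally show ?thesis using prod_prime_factors_squarefree[OF n'(3)] by simp
    qed
    moreover have "\<Prod>?B \<in> M"
    proof (cases "\<exists>p q. p \<in> ?B \<and> q \<in> ?B \<and> p \<noteq> q")
      case True
      then obtain p q where pq: "p \<in> ?B" "q \<in> ?B" "p \<noteq> q" by blast
      then have "p * q dvd n" by (intro divides_mult) (auto simp: prime_factors_dvd intro: primes_coprime)
      then have "p * q \<le> n" using n' by (intro dvd_imp_le) auto
      then have "real p * real q \<le> real x" using n'(2) by (metis of_nat_le_iff of_nat_mult order_trans)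
      moreover have "s * s < real p * real q" using pq s by (intro mult_strict_mono) auto
      ultimately show ?thesis using x by (simp add: power2_eq_square)
    next
      case False
      then have "?B = {} \<or> (\<exists>p. ?B = {p})" by blast
      then show ?thesis
      proof
        assume "\<exists>p. ?B = {p}"
        then obtain p where p: "?B = {p}" by blast
        then have "p \<in> ?B" by simp
        then have "prime p" "s < real p" "real p \<le> z" using n'(4) by auto
        then show ?thesis unfolding p by (simp add: M)
      next
        assume "?B = {}"
        then have "\<Prod>?B = 1" by (simp only: prod.empty)
        then show ?thesis by (simp only: M insertI1)
      qed
    qed
    ultimately show ?thesis by blast
  qed
  then show "\<forall>n\<in>sqfree_smooth (real x) y z. (case ?f' n of (A, m) \<Rightarrow> \<Prod>A * m) = n" by simp
  show "(\<lambda>(A, m). \<Prod>A * m) ` ?P \<subseteq> sqfree_smooth (real x) y z"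
  proof
    fix n assume "n \<in> (\<lambda>(A, m). \<Prod>A * m) ` ?P"
    then obtain A m where n: "n = \<Prod>A * m" and Am: "A \<subseteq> W" "m \<in> M" "\<Prod>A * m \<le> x" by auto
    have finA: "finite A" and pA: "\<And>p. p \<in> A \<Longrightarrow> prime p" 
      using Am finW finite_subset by (auto simp: W)
    have "squarefree (\<Prod>A * m)"
    proof (cases "m = 1")
      case True
      then show ?thesis using squarefree_prod_primes[OF finA pA] by simp
    next
      case False
      then have m: "prime m" "s < real m" using Am by (auto simp: M)
      then have "m \<notin> A" using Am by (auto simp: W)
      then have "\<not> m dvd \<Prod>A" using prime_dvd_prod_primes_iff[OF finA pA m(1)] by simp
      then have "coprime (\<Prod>A) m" using m(1) by (simp add: coprime_commute prime_imp_coprime)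
      then show ?thesis
        by (rule squarefree_mult_coprime[OF _ squarefree_prod_primes[OF finA pA] squarefree_prime[OF m(1)]])
    qed
    moreover have "y \<le> real p \<and> real p \<le> z" if "prime p" "p dvd \<Prod>A * m" for p
    proof -
      have "p \<in> prime_factors (\<Prod>A * m)" using that pos[OF Am(1,2)] by (simp add: prime_factors_dvd)
      then show ?thesis unfolding pf[OF Am(1,2)] using Am y by (auto simp: W M split: if_splits)
    qed
    ultimately show "n \<in> sqfree_smooth (real x) y z"
      using pos[OF Am(1,2)] Am(3) unfolding n sqfree_smooth_def mem_Collect_eq of_nat_le_iff by auto
  qed
  show "?f' ` sqfree_smooth (real x) y z \<subseteq> ?P"
  proof
    fix am assume "am \<in> ?f' ` sqfree_smooth (real x) y z"
    then obtain n where n: "n \<in> sqfree_smooth (real x) y z" "am = ?f' n" by blast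
    have "n \<le> x" using n(1) by (simp add: sqfree_smooth_def)
    then show "am \<in> ?P" using n_facts[OF n(1)] by (simp only: n(2) mem_Collect_eq prod.case simp_thms)
  qed
qed

section \<open>Sums over smooth squarefree integers\<close>

text \<open>Counts factorisations of \<open>l\<close> into three factors: two of them determine the
  third, which is what the injectivity hypothesis expresses.\<close>

lemma card_triple_product_le:
  fixes l :: nat
  assumes l: "0 < l" and \<tau>: "real (card {d. d dvd l}) \<le> T"
    and Q: "inj_on (\<lambda>p. (f p, g p)) Q" "\<And>p. p \<in> Q \<Longrightarrow> f p dvd l \<and> g p dvd l"
  shows "real (card Q) \<le> T\<^sup>2"
proof -
  have fin: "finite {d. d dvd l}" using l by simp
  have "card Q = card ((\<lambda>p. (f p, g p)) ` Q)" using Q(1) by (simp add: card_image)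
  also have "\<dots> \<le> card ({d. d dvd l} \<times> {d. d dvd l})"
    using fin Q(2) by (intro card_mono) auto
  finally have "real (card Q) \<le> real (card {d. d dvd l}) * real (card {d. d dvd l})"
    by (simp add: card_cartesian_product flip: of_nat_mult)
  also have "\<dots> \<le> T * T" using \<tau> by (intro mult_mono) auto
  finally show ?thesis by (simp add: power2_eq_square)
qed

context bilinear_setup
begin

lemma x_pos: "0 < x"
  using x_eq s1 by (metis less_le_trans of_nat_0_less_iff zero_less_one zero_less_power)

lemma s_le_x: "s \<le> real x"
  using s1 mult_left_mono[of 1 s s] by (simp add: x_eq power2_eq_square)

section \<open>Sums over arithmetic progressions\<close>

text \<open>The bound depends neither on the interval nor, except through \<open>h * m\<close>, on
  \<open>m\<close>, so it can be summed over \<open>l = h * m\<close>. If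
  \<open>h * m \<le> s / T\<close>, the distance to the integers exceeds \<open>1 / (T * s)\<close>;
  if not, \<open>m\<close> is so large that the interval has at most \<open>T * H * s\<close>
  elements. In both cases the reciprocal length may be replaced by
  \<open>1 / (T * H * s)\<close>.\<close>

lemma sum_F_progression_le:
  assumes m: "0 < m" and b: "b \<le> x div m"
  shows "\<bar>\<Sum>k\<in>{a<..b}. F (m * k)\<bar>
    \<le> 24 * \<delta> * (\<Sum>h=1..<H. 1 / (1 / (T * real H * s) + dist_int (\<alpha> * real (h * m))))"
proof (cases "a < b")
  case False
  then have "{a<..b} = {}" by auto
  then show ?thesis using \<delta>0 T1 s1
    by (auto intro!: mult_nonneg_nonneg sum_nonneg divide_nonneg_nonneg add_nonneg_nonneg dist_int_nonneg)
next
  case True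
  have "(\<Sum>k\<in>{a<..b}. F (m * k))
      = 2 * Re (\<Sum>k\<in>{a<..b}. \<Sum>h=1..<H. \<gamma> h * unit_exp (real h * (\<alpha> * real (m * k))))"
    by (simp only: F_def Re_sum sum_distrib_left)
  also have "(\<Sum>k\<in>{a<..b}. \<Sum>h=1..<H. \<gamma> h * unit_exp (real h * (\<alpha> * real (m * k))))
      = (\<Sum>h=1..<H. \<gamma> h * (\<Sum>k\<in>{a<..b}. unit_exp (real k * (\<alpha> * real (h * m)))))"
    by (subst sum.swap) (simp add: sum_distrib_left mult_ac)
  finally have "\<bar>\<Sum>k\<in>{a<..b}. F (m * k)\<bar>
      \<le> 2 * norm (\<Sum>h=1..<H. \<gamma> h * (\<Sum>k\<in>{a<..b}. unit_exp (real k * (\<alpha> * real (h * m)))))"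
    by (simp only: abs_mult) (intro mult_mono abs_Re_le_cmod, auto)
  also have "\<dots> \<le> 2 * (\<Sum>h=1..<H. 3 * \<delta> * (4 * (1 / (1 / (T * real H * s) + dist_int (\<alpha> * real (h * m))))))"
  proof (intro mult_left_mono sum_norm_le)
    fix h assume h: "h \<in> {1..<H}"
    define \<theta> where "\<theta> = \<alpha> * real (h * m)"
    define \<nu> where "\<nu> = 1 / (T * real H * s)"
    have nd0: "0 \<le> dist_int \<theta>" by (rule dist_int_nonneg)
    have H0: "1 \<le> real H" using H1 by simp
    have inv0: "0 \<le> 1 / real (b - a)" by simp
    have \<nu>0: "0 < \<nu>" using T1 s1 H0 by (simp add: \<nu>_def)
    have len: "real m / real x \<le> 1 / real (b - a)"
    proof -
      have "b * m \<le> x" using b m by (simp add: less_eq_div_iff_mult_less_eq)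
      then have "m * (b - a) \<le> x" by (metis diff_le_self mult.commute mult_le_mono1 order_trans)
      then have "real m * real (b - a) \<le> real x" by (metis of_nat_le_iff of_nat_mult)
      then show ?thesis using True x_pos by (simp add: field_simps)
    qed
    have "\<nu> \<le> real m / real x \<or> \<nu> \<le> dist_int \<theta>"
    proof (cases "real (h * m) \<le> s / T")
      case True
      then have "1 / (T * s) \<le> dist_int \<theta>" unfolding \<theta>_def using h m by (intro sep) auto
      moreover have "\<nu> \<le> 1 / (T * s)"
        unfolding \<nu>_def using T1 s1 H0 by (intro divide_left_mono) (auto simp: mult_mono)
      ultimately show ?thesis by simp
    next
      case False
      have "real (h * m) \<le> real H * real m" using h by (simp add: mult_right_mono)
      then have "s / T \<le> real H * real m" using False by simp
      then have "s \<le> T * real H * real m" using T1 by (simp add: field_simps)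
      then have "1 * s \<le> real m * (T * real H)" by (simp add: mult_ac)
      then have "\<nu> \<le> real m / real x"
        unfolding \<nu>_def x_eq power2_eq_square using T1 s1 H0 by (simp add: field_simps)
      then show ?thesis by simp
    qed
    have "(\<nu> + dist_int \<theta>) / 2 \<le> 1 / real (b - a) + dist_int \<theta>"
    proof -
      have "(v + n) / 2 \<le> i + n"
        if "v \<le> q \<or> v \<le> n" "q \<le> i" "0 \<le> n" "0 < v" "0 \<le> i" for v q n i :: real
        using that by fastforce
      then show ?thesis
        using \<open>\<nu> \<le> real m / real x \<or> \<nu> \<le> dist_int \<theta>\<close> len nd0 \<nu>0 inv0 by blast
    qed
    then have "2 / (1 / real (b - a) + dist_int \<theta>) \<le> 2 / ((\<nu> + dist_int \<theta>) / 2)"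
      using \<nu>0 nd0 True by (intro divide_left_mono) (auto intro!: mult_pos_pos add_pos_nonneg)
    then have "norm (\<Sum>k\<in>{a<..b}. unit_exp (real k * \<theta>)) \<le> 4 * (1 / (\<nu> + dist_int \<theta>))"
      using norm_sum_unit_exp_le[OF True, of \<theta>] by simp
    then show "norm (\<gamma> h * (\<Sum>k\<in>{a<..b}. unit_exp (real k * (\<alpha> * real (h * m)))))
        \<le> 3 * \<delta> * (4 * (1 / (1 / (T * real H * s) + dist_int (\<alpha> * real (h * m)))))"
      unfolding norm_mult \<theta>_def[symmetric] \<nu>_def[symmetric] using \<gamma>_le[OF h] \<delta>0 by (intro mult_mono) auto
  qed simp
  also have "\<dots> = 24 * \<delta> * (\<Sum>h=1..<H. 1 / (1 / (T * real H * s) + dist_int (\<alpha> * real (h * m))))"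
    by (simp add: sum_distrib_left mult_ac)
  finally show ?thesis .
qed

text \<open>The products \<open>h * d * f\<close> do not exceed
  \<open>H * V\<^sup>2 = H * s\<close>, and each value occurs at most \<open>T\<^sup>2\<close>
  times. So the whole family of progressions is bounded by one application of
  \<open>sum_interval_le\<close>.\<close>

lemma type_I_bound:
  fixes a b :: "nat \<times> nat \<Rightarrow> nat" and w :: "nat \<times> nat \<Rightarrow> real"
  assumes Q: "finite Q" "\<And>d f. (d, f) \<in> Q \<Longrightarrow> 0 < d \<and> 0 < f \<and> real d \<le> V \<and> real f \<le> V"
    and b: "\<And>d f. (d, f) \<in> Q \<Longrightarrow> b (d, f) \<le> x div (d * f)"
    and w: "\<And>p. p \<in> Q \<Longrightarrow> \<bar>w p\<bar> \<le> 1"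
  shows "\<bar>\<Sum>p\<in>Q. w p * (\<Sum>k\<in>{a p<..b p}. F (fst p * snd p * k))\<bar> \<le> 768 * T^6 * E"
proof -
  let ?k = "\<lambda>p. \<Sum>k\<in>{a p<..b p}. F (fst p * snd p * k)"
  define g where "g l = 1 / (1 / (T * real H * s) + dist_int (\<alpha> * real l))" for l :: nat
  let ?g = "\<lambda>p. \<Sum>h=1..<H. g (h * (fst p * snd p))"
  define R where "R = nat \<lfloor>real H * s\<rfloor>"
  have H0: "1 \<le> real H" using H1 by simp
  have THs: "0 < T * real H * s" using T1 s1 H0 by simp
  have g0: "0 \<le> g l" for l unfolding g_def using THs by (intro divide_nonneg_nonneg add_nonneg_nonneg dist_int_nonneg) auto
  have "\<bar>\<Sum>p\<in>Q. w p * (?k p)\<bar>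
      \<le> (\<Sum>p\<in>Q. 24 * \<delta> * ?g p)"
  proof (rule order_trans[OF sum_abs], rule sum_mono)
    fix p assume p: "p \<in> Q"
    have "\<bar>?k p\<bar> \<le> 24 * \<delta> * ?g p"
      unfolding g_def using Q(2)[of "fst p" "snd p"] b[of "fst p" "snd p"] p by (intro sum_F_progression_le) auto
    then have "\<bar>w p\<bar> * \<bar>?k p\<bar> \<le> 1 * (24 * \<delta> * ?g p)"
      using w[OF p] by (intro mult_mono) auto
    then show "\<bar>w p * (?k p)\<bar> \<le> 24 * \<delta> * ?g p"
      by (simp add: abs_mult)
  qed
  also have "\<dots> = 24 * \<delta> * (\<Sum>(p, h)\<in>Q \<times> {1..<H}. g (h * (fst p * snd p)))"
    by (simp add: sum_distrib_left sum.cartesian_product case_prod_unfold)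
  also have "(\<Sum>(p, h)\<in>Q \<times> {1..<H}. g (h * (fst p * snd p))) \<le> T\<^sup>2 * (\<Sum>l\<in>{1..R}. g l)"
  proof -
    have R: "h * (d * f) \<in> {1..R}" if "(d, f) \<in> Q" "h \<in> {1..<H}" for h d f
    proof -
      have "real d * real f \<le> V * V" using Q(2)[OF that(1)] by (intro mult_mono) auto
      then have "real h * (real d * real f) \<le> real H * s"
        using that(2) by (intro mult_mono) (auto simp: s_eq power2_eq_square)
      then have "h * (d * f) \<le> R" unfolding R_def by (intro le_nat_floor) simp
      with Q(2)[OF that(1)] that(2) show ?thesis by (auto simp: Suc_le_eq)
    qed
    have R_le: "R \<le> x\<^sup>2"
    proof -
      have "real R \<le> real H * s" unfolding R_def using s1 by (intro of_nat_floor) simp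
      also have "\<dots> \<le> real x * real x" using H_le s_le_x s1 by (intro mult_mono) auto
      finally show ?thesis by (simp add: power2_eq_square flip: of_nat_mult)
    qed
    have "(\<Sum>q\<in>Q \<times> {1..<H}. g (case q of (p, h) \<Rightarrow> h * (fst p * snd p))) \<le> T\<^sup>2 * (\<Sum>l\<in>{1..R}. g l)"
    proof (rule sum_fibres_le)
      fix l assume l: "l \<in> {1..R}"
      let ?S = "{q \<in> Q \<times> {1..<H}. (case q of (p, h) \<Rightarrow> h * (fst p * snd p)) = l}"
      show "real (card ?S) \<le> T\<^sup>2"
      proof (rule card_triple_product_le[where f = "\<lambda>q. fst (fst q)" and g = "\<lambda>q. snd (fst q)"])
        show "0 < l" using l by simp
        show "real (card {d. d dvd l}) \<le> T" using l R_le by (intro tau_le) auto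
        show "inj_on (\<lambda>q. (fst (fst q), snd (fst q))) ?S"
          using Q(2) l by (auto simp: inj_on_def)
      qed auto
    next
      show "finite (Q \<times> {1..<H})" using Q(1) by simp
      fix q assume "q \<in> Q \<times> {1..<H}"
      then show "(case q of (p, h) \<Rightarrow> h * (fst p * snd p)) \<in> {1..R}"
        using R[of "fst (fst q)" "snd (fst q)" "snd q"] by (simp add: case_prod_unfold mem_Times_iff)
    qed (use g0 in simp_all)
    then show ?thesis by (simp only: case_prod_unfold)
  qed
  also have "(\<Sum>l\<in>{1..R}. g l) \<le> 2 * T^3 * (real R / s + 1) * (T * real H * s + s)"
    unfolding g_def using sum_interval_le[OF THs, where \<theta> = 0 and N = R] by simp
  also have "\<dots> \<le> 2 * T^3 * (2 * real H) * (2 * T * real H * s)"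
  proof (intro mult_mono)
    have "real R \<le> real H * s" unfolding R_def using s1 by (intro of_nat_floor) simp
    then have "real R / s \<le> real H" using s1 by (simp add: field_simps)
    then show "real R / s + 1 \<le> 2 * real H" using H0 by simp
    have "1 * s \<le> T * real H * s" using T1 H0 s1 by (intro mult_right_mono) (auto simp: mult_ge1_I)
    then show "T * real H * s + s \<le> 2 * T * real H * s" by linarith
  qed (use T1 s1 in auto)
  also have "24 * \<delta> * (T\<^sup>2 * (2 * T^3 * (2 * real H) * (2 * T * real H * s)))
      = 192 * T^6 * (\<delta> * (real H)\<^sup>2 * s)"
    by (simp add: power2_eq_square eval_nat_numeral)
  also have "\<dots> \<le> 192 * T^6 * (4 * E)" using E3 T1 by (intro mult_left_mono) auto
  finally show ?thesis using \<delta>0 T1 by (simp add: mult_left_mono)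
qed

end

text \<open>The cofactor gets a range independent of \<open>f\<close>, so that it can be a free
  variable of a bilinear sum.\<close>

lemma sum_multiples_eq:
  fixes g :: "nat \<Rightarrow> real"
  assumes f: "0 < f" and hi: "hi \<le> x"
  shows "(\<Sum>k\<in>{k\<in>{lo<..hi}. f dvd k}. g k) = (\<Sum>k=1..x. if lo < f * k \<and> f * k \<le> hi then g (f * k) else 0)"
proof -
  have "(\<Sum>k=1..x. if lo < f * k \<and> f * k \<le> hi then g (f * k) else 0)
      = (\<Sum>k\<in>{k\<in>{1..x}. lo < f * k \<and> f * k \<le> hi}. g (f * k))"
    by (rule sum.inter_filter[symmetric]) simp
  also have "\<dots> = (\<Sum>k\<in>{k\<in>{lo<..hi}. f dvd k}. g k)"
  proof (rule sum.reindex_bij_witness[of _ "\<lambda>k. k div f" "\<lambda>k. f * k"])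
    fix k assume k: "k \<in> {k\<in>{lo<..hi}. f dvd k}"
    then have "f \<le> k" by (auto intro!: dvd_imp_le)
    then have "1 \<le> k div f" using f by (simp add: Suc_le_eq div_greater_zero_iff)
    moreover have "k div f \<le> x" proof -
      have "k \<le> hi" using k by simp
      then show ?thesis using hi div_le_dividend[of k f] by linarith
    qed
    ultimately show "k div f \<in> {k\<in>{1..x}. lo < f * k \<and> f * k \<le> hi}" using k by auto
  qed (use f in auto)
  finally show ?thesis by simp
qed

context bilinear_setup
begin

text \<open>Stated so as to serve twice. For the large smooth parts \<open>d = 1\<close>, the weight
  is 1 and \<open>k\<close> is 1 or the large prime. In Legendre's formula the set of primes is the
  sieve divisor with its sign, \<open>k\<close> its cofactor in the sieved integer, \<open>d\<close>
  the smooth part, and \<open>lo\<close>, \<open>hi\<close> delimit the sieved integer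
  \<open>\<Prod>A * k\<close>. Multiplicativity of \<open>\<omega>\<close> lets the weight split
  along with the set.\<close>

lemma smooth_type_II_bound:
  fixes W :: "nat set" and Ts :: "(nat \<times> nat) set" and \<omega> :: "nat set \<Rightarrow> real"
  notes of_nat_prod [simp del]
  assumes W: "finite W" "\<And>p. p \<in> W \<Longrightarrow> prime p \<and> real p \<le> s"
    and Ts: "finite Ts" "\<And>d k. (d, k) \<in> Ts \<Longrightarrow> 0 < d \<and> 0 < k"
    and bnds: "lo \<le> x" "hi \<le> x"
    and \<omega>: "\<And>A B. A \<subseteq> W \<Longrightarrow> B \<subseteq> W \<Longrightarrow> A \<inter> B = {} \<Longrightarrow> \<omega> (A \<union> B) = \<omega> A * \<omega> B"
    and \<omega>1: "\<And>A. A \<subseteq> W \<Longrightarrow> \<bar>\<omega> A\<bar> \<le> 1"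
  shows "\<bar>\<Sum>A\<in>{A. A \<subseteq> W \<and> V < real (\<Prod>A)}. \<Sum>(d, k)\<in>Ts.
      if lo < \<Prod>A * k \<and> \<Prod>A * k \<le> hi \<and> \<Prod>A * (d * k) \<le> x then \<omega> A * F (\<Prod>A * (d * k)) else 0\<bar>
    \<le> 24 * T^11 * E"
proof -
  define G where "G A p = (if lo < \<Prod>A * snd p \<and> \<Prod>A * snd p \<le> hi \<and> \<Prod>A * (fst p * snd p) \<le> x
      then \<omega> A * F (\<Prod>A * (fst p * snd p)) else 0)" for A and p :: "nat \<times> nat"
  define I where "I = {A. A \<subseteq> W \<and> A \<noteq> {} \<and> V < real (\<Prod>A) \<and> real (\<Prod>(A - {Max A})) \<le> V}"
  \<comment> \<open>The cofactors are cut off at \<open>x\<close> at once, so that the divisor bound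
    applies to the fibres of \<open>\<psi>\<close>.\<close>
  define J where "J = {j\<in>Pow W \<times> Ts. \<Prod>(fst j) * (fst (snd j) * snd (snd j)) \<le> x}"
  define P where "P = {(A, B). A \<subseteq> W \<and> A \<noteq> {} \<and> V < real (\<Prod>A) \<and> real (\<Prod>(A - {Max A})) \<le> V \<and> B \<subseteq> W \<and> (\<forall>q\<in>B. Max A < q)}"
  \<comment> \<open>The default \<open>x + 1\<close> exceeds every prime in \<open>W\<close>: if no
    primes remain, the order condition is vacuous.\<close>
  define lp where "lp B = (if B = {} then x + 1 else Min B)" for B :: "nat set"
  define \<psi> where "\<psi> j = \<Prod>(fst j) * (fst (snd j) * snd (snd j))" for j :: "nat set \<times> nat \<times> nat"
  let ?k = "\<lambda>A j. if \<forall>q\<in>fst j. Max A < q then G (A \<union> fst j) (snd j) else 0"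
  let ?h = "\<lambda>A j. if Max A < lp (fst j) \<and> lo div \<Prod>A < \<Prod>(fst j) * snd (snd j)
      \<and> \<Prod>(fst j) * snd (snd j) < hi div \<Prod>A + 1 \<and> \<Prod>A * \<psi> j \<le> x
      then \<omega> A * \<omega> (fst j) * F (\<Prod>A * \<psi> j) else 0"
  have finA: "finite A" if "A \<subseteq> W" for A using that W(1) by (rule finite_subset)
  have pos: "0 < \<Prod>A" if "A \<subseteq> W" for A using that W by (intro prod_primes_pos) auto
  have finI: "finite I" by (rule finite_subset[of _ "Pow W"]) (auto simp: I_def W)
  have finJ: "finite J" using W Ts by (simp add: J_def)
  have Wx: "p \<le> x" if "p \<in> W" for p using W(2)[OF that] s_le_x by linarith
  have MaxI: "Max A \<in> W" if "A \<in> I" for A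
  proof -
    have "A \<subseteq> W" "A \<noteq> {}" using that by (auto simp: I_def)
    then show ?thesis using Max_in[OF finA] by blast
  qed
  have lp_iff: "(\<forall>q\<in>B. Max A < q) \<longleftrightarrow> Max A < lp B" if "A \<in> I" "B \<subseteq> W" for A B
    using Wx[OF MaxI[OF that(1)]] finA[OF that(2)] by (auto simp: lp_def)
  have disj: "A \<inter> B = {}" "\<Prod>(A \<union> B) = \<Prod>A * \<Prod>B"
    if "A \<in> I" "B \<subseteq> W" "\<forall>q\<in>B. Max A < q" for A B
  proof -
    have A: "finite A" "A \<subseteq> W" using that finA by (auto simp: I_def)
    show "A \<inter> B = {}" using that(3) Max_ge[OF A(1)] by (auto simp: leD)
    then show "\<Prod>(A \<union> B) = \<Prod>A * \<Prod>B" using A finA[OF that(2)] by (intro prod.union_disjoint)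
  qed
  have "(\<Sum>A\<in>{A. A \<subseteq> W \<and> V < real (\<Prod>A)}. \<Sum>p\<in>Ts. G A p) = (\<Sum>ab\<in>P. \<Sum>p\<in>Ts. G (case ab of (A, B) \<Rightarrow> A \<union> B) p)"
    unfolding P_def using W V1 prime_ge_1_nat
    by (intro sum.reindex_bij_betw[OF bij_betw_prefix_split, symmetric]) auto
  also have "P = {ab\<in>I \<times> Pow W. \<forall>q\<in>snd ab. Max (fst ab) < q}"
    by (auto simp: P_def I_def)
  also have "(\<Sum>ab\<in>\<dots>. \<Sum>p\<in>Ts. G (case ab of (A, B) \<Rightarrow> A \<union> B) p)
      = (\<Sum>ab\<in>I \<times> Pow W. if \<forall>q\<in>snd ab. Max (fst ab) < q then \<Sum>p\<in>Ts. G (case ab of (A, B) \<Rightarrow> A \<union> B) p else 0)"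
    using finI W(1) by (intro sum.inter_filter) auto
  also have "\<dots> = (\<Sum>A\<in>I. \<Sum>B\<in>Pow W. \<Sum>p\<in>Ts. if \<forall>q\<in>B. Max A < q then G (A \<union> B) p else 0)"
  proof -
    have "(if c then \<Sum>p\<in>Ts. G C p else 0) = (\<Sum>p\<in>Ts. if c then G C p else 0)" for c C
      by simp
    moreover have "(\<Sum>ab\<in>I \<times> Pow W. if \<forall>q\<in>snd ab. Max (fst ab) < q then \<Sum>p\<in>Ts. G (case ab of (A, B) \<Rightarrow> A \<union> B) p else 0)
        = (\<Sum>A\<in>I. \<Sum>B\<in>Pow W. if \<forall>q\<in>B. Max A < q then \<Sum>p\<in>Ts. G (A \<union> B) p else 0)"
      by (simp only: sum.cartesian_product case_prod_unfold prod.sel)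
    ultimately show ?thesis by (simp only:)
  qed
  also have "\<dots> = (\<Sum>A\<in>I. \<Sum>j\<in>Pow W \<times> Ts. ?k A j)"
    by (simp add: sum.cartesian_product case_prod_unfold)
  also have "\<dots> = (\<Sum>A\<in>I. \<Sum>j\<in>J. ?h A j)"
  proof (rule sum.cong[OF refl])
    fix A assume A: "A \<in> I"
    then have AW: "A \<subseteq> W" by (auto simp: I_def)
    have A0: "0 < \<Prod>A" by (rule pos[OF AW])
    have G_eq: "G (A \<union> B) p = (if lo div \<Prod>A < \<Prod>B * snd p \<and> \<Prod>B * snd p < hi div \<Prod>A + 1 \<and> \<Prod>A * \<psi> (B, p) \<le> x
        then \<omega> A * \<omega> B * F (\<Prod>A * \<psi> (B, p)) else 0)"
      if B: "B \<subseteq> W" "\<forall>q\<in>B. Max A < q" for B p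
    proof -
      \<comment> \<open>Division by \<open>\<Prod>A\<close> turns the two ends of the interval into
        comparisons between the variables, as \<open>type_II_bound\<close> requires.\<close>
      have "lo < \<Prod>A * (\<Prod>B * snd p) \<longleftrightarrow> lo div \<Prod>A < \<Prod>B * snd p"
        using A0 by (simp add: div_less_iff_less_mult mult.commute)
      moreover have "\<Prod>A * (\<Prod>B * snd p) \<le> hi \<longleftrightarrow> \<Prod>B * snd p < hi div \<Prod>A + 1"
        using A0 by (simp add: less_Suc_eq_le less_eq_div_iff_mult_less_eq mult.commute)
      ultimately show ?thesis
        unfolding G_def disj(2)[OF A B] \<omega>[OF AW B(1) disj(1)[OF A B]] \<psi>_def
        by (simp add: mult.assoc)
    qed
    have "(\<Sum>j\<in>Pow W \<times> Ts. ?k A j)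
        = (\<Sum>j\<in>J. ?k A j)"
    proof (rule sum.mono_neutral_right)
      show "\<forall>j\<in>Pow W \<times> Ts - J. (?k A j) = 0"
      proof
        fix j assume j: "j \<in> Pow W \<times> Ts - J"
        then have "x < \<psi> j" by (auto simp: J_def \<psi>_def)
        also have "\<psi> j \<le> \<Prod>A * \<psi> j" using A0 by simp
        finally have "x < \<Prod>A * \<psi> j" .
        then show "(?k A j) = 0"
          using G_eq[of "fst j" "snd j"] j by auto
      qed
    qed (use W Ts in \<open>auto simp: J_def\<close>)
    also have "\<dots> = (\<Sum>j\<in>J. ?h A j)"
    proof (rule sum.cong[OF refl])
      fix j assume "j \<in> J"
      then have j: "fst j \<subseteq> W" by (auto simp: J_def)
      show "(?k A j)
        = (?h A j)"
        using lp_iff[OF A j] G_eq[OF j, of "snd j"] by simp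
    qed
    finally show "(\<Sum>j\<in>Pow W \<times> Ts. ?k A j) = \<dots>" .
  qed
  \<comment> \<open>The fibres of \<open>\<Prod>\<close> are singletons, whereas
    \<open>\<psi>\<close> is a product of three factors; \<open>T\<^sup>2\<close> serves for
    both.\<close>
  also have "\<bar>\<dots>\<bar> \<le> 24 * T^7 * (T\<^sup>2)\<^sup>2 * E"
  proof (rule type_II_bound[OF finI finJ])
    fix A assume A: "A \<in> I"
    then show "V < real (\<Prod>A)" by (simp add: I_def)
    have AW: "A \<subseteq> W" "finite A" using A finA by (auto simp: I_def)
    have "\<Prod>A = \<Prod>(A - {Max A}) * Max A"
      using AW(2) A Max_in[OF AW(2)] by (simp add: I_def prod.remove[of A "Max A"] mult.commute)
    then have "real (\<Prod>A) = real (\<Prod>(A - {Max A})) * real (Max A)" by simp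
    also have "\<dots> \<le> V * s" using A W(2)[OF MaxI[OF A]] V1 by (intro mult_mono) (auto simp: I_def)
    finally show "real (\<Prod>A) \<le> V * s" .
    show "\<bar>\<omega> A\<bar> \<le> 1" using AW by (intro \<omega>1)
    show "Max A \<le> x + 1 \<and> lo div \<Prod>A \<le> x + 1 \<and> hi div \<Prod>A + 1 \<le> x + 1"
      using Wx[OF MaxI[OF A]] bnds div_le_dividend[of lo "\<Prod>A"] div_le_dividend[of hi "\<Prod>A"] by linarith
  next
    fix j assume j: "j \<in> J"
    then have jW: "fst j \<subseteq> W" and jT: "0 < fst (snd j)" "0 < snd (snd j)" and jx: "\<psi> j \<le> x"
      using Ts(2)[of "fst (snd j)" "snd (snd j)"] by (auto simp: J_def \<psi>_def)
    show "1 \<le> \<psi> j" using pos[OF jW] jT by (simp add: \<psi>_def Suc_le_eq)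
    show "\<bar>\<omega> (fst j)\<bar> \<le> 1" using jW by (rule \<omega>1)
    have "\<Prod>(fst j) * snd (snd j) \<le> \<psi> j" using jT by (simp add: \<psi>_def)
    moreover have "lp (fst j) \<le> x + 1"
    proof (cases "fst j = {}")
      case False
      then have "Min (fst j) \<in> W" using Min_in[OF finA[OF jW]] jW by blast
      from Wx[OF this] False show ?thesis by (simp add: lp_def)
    qed (simp add: lp_def)
    ultimately show "lp (fst j) \<le> x + 1 \<and> \<Prod>(fst j) * snd (snd j) \<le> x + 1 \<and> \<Prod>(fst j) * snd (snd j) \<le> x + 1"
      using jx by linarith
  next
    fix m
    have "card {A\<in>I. \<Prod>A = m} \<le> card {m}"
      using inj_on_prod_primes[OF W(1)] W(2)
      by (intro card_inj_on_le[of \<Prod>]) (auto intro!: inj_on_subset[OF inj_on_prod_primes[OF W(1)]] simp: I_def)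
    then have "real (card {A\<in>I. \<Prod>A = m}) \<le> 1" by simp
    also have "1 \<le> T\<^sup>2" using T1 by (simp add: one_le_power)
    finally show "real (card {A\<in>I. \<Prod>A = m}) \<le> T\<^sup>2" .
  next
    fix n
    let ?S = "{j\<in>J. \<psi> j = n}"
    have props: "fst j \<subseteq> W \<and> 0 < fst (snd j) \<and> 0 < snd (snd j) \<and> \<psi> j \<le> x" if "j \<in> J" for j
      using that Ts(2)[of "fst (snd j)" "snd (snd j)"] by (auto simp: J_def \<psi>_def)
    show "real (card ?S) \<le> T\<^sup>2"
    proof (cases "?S = {}")
      case False
      then obtain j where "j \<in> J" "\<psi> j = n" by blast
      then have n: "0 < n" "n \<le> x" using props[of j] pos[of "fst j"] by (auto simp: \<psi>_def)
      show ?thesis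
      proof (rule card_triple_product_le[where f = "\<lambda>j. \<Prod>(fst j)" and g = "\<lambda>j. fst (snd j)" and l = n])
        have "n \<le> x\<^sup>2" using n by (metis le_square order_trans power2_eq_square)
        then show "real (card {d. d dvd n}) \<le> T" using n by (intro tau_le) auto
        show "inj_on (\<lambda>j. (\<Prod>(fst j), fst (snd j))) ?S"
        proof (rule inj_onI)
          fix i j assume ij: "i \<in> ?S" "j \<in> ?S" "(\<Prod>(fst i), fst (snd i)) = (\<Prod>(fst j), fst (snd j))"
          then have "fst i = fst j"
            using inj_onD[OF inj_on_prod_primes[OF W(1)], of "fst i" "fst j"] W(2) props by auto
          moreover have "snd (snd i) = snd (snd j)"
          proof -
            have "\<psi> i = \<psi> j" using ij by simp
            then show ?thesis using ij props[of j] pos[of "fst j"] by (auto simp: \<psi>_def)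
          qed
          ultimately show "i = j" using ij(3) by (simp add: prod_eq_iff)
        qed
      qed (use n in \<open>auto simp: \<psi>_def\<close>)
    next
      case True
      then show ?thesis by (simp only: card.empty) simp
    qed
  qed
  also have "24 * T^7 * (T\<^sup>2)\<^sup>2 * E = 24 * T^11 * E" by (simp add: eval_nat_numeral)
  finally show ?thesis by (simp add: G_def case_prod_unfold)
qed

end

section \<open>The smoothed sum over smooth squarefree integers\<close>

context bilinear_setup
begin

text \<open>The constant is 24 + 1 + 24 + 768: smooth parts above \<open>V\<close>, smooth integers
  up to \<open>V\<close> counted trivially, and sieve divisors above and up to
  \<open>V\<close>.\<close>

lemma sum_F_sqfree_smooth_le:
  notes of_nat_prod [simp del]
  assumes y: "2 \<le> y" "y < s" and z: "z \<le> real x"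
    and F1: "\<And>n. \<bar>F n\<bar> \<le> 1" and VE: "V \<le> E"
  shows "\<bar>\<Sum>n\<in>sqfree_smooth (real x) y z. F n\<bar> \<le> 817 * T^11 * E"
proof -
  define W where "W = {p. prime p \<and> real p \<le> s \<and> y \<le> real p \<and> real p \<le> z}"
  \<comment> \<open>Legendre's formula sieves by all primes up to \<open>s\<close>, whatever
    \<open>y\<close> and \<open>z\<close> are.\<close>
  define W1 where "W1 = {p. prime p \<and> real p \<le> s}"
  define Mp where "Mp = {p. prime p \<and> s < real p \<and> real p \<le> z}"
  define lo where "lo = nat \<lfloor>s\<rfloor>"
  define hi where "hi = nat \<lfloor>z\<rfloor>"
  have "W1 \<subseteq> {..lo}" by (auto simp: W1_def lo_def le_nat_floor)
  then have finW1: "finite W1" by (rule finite_subset) simp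
  have "W \<subseteq> W1" by (auto simp: W_def W1_def)
  then have finW: "finite W" using finW1 by (rule finite_subset)
  have Wp: "prime p \<and> real p \<le> s" if "p \<in> W" for p using that by (simp add: W_def)
  have W1p: "prime p \<and> real p \<le> s" if "p \<in> W1" for p using that by (simp add: W1_def)
  have lo_iff: "lo < k \<longleftrightarrow> s < real k" for k :: nat
    unfolding lo_def using s1 by linarith
  have hi_iff: "k \<le> hi \<longleftrightarrow> real k \<le> z" if "0 < k" for k :: nat
    unfolding hi_def using that by linarith
  have hi_x: "hi \<le> x"
  proof (cases "hi = 0")
    case False
    then have "real hi \<le> z" using hi_iff[of hi] by simp
    then show ?thesis using z by linarith
  qed simp
  have lo_x: "lo \<le> x"
  proof -
    have "real lo \<le> s" unfolding lo_def using s1 by (intro of_nat_floor) simp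
    then show ?thesis using s_le_x by linarith
  qed
  have Mp_eq: "Mp = {k\<in>{lo<..hi}. prime k}"
    using hi_iff lo_iff by (auto simp: Mp_def prime_gt_0_nat)
  have finMp: "finite Mp" by (simp add: Mp_eq)
  have Mp1: "1 \<notin> Mp" by (simp add: Mp_def)
  have posW: "0 < \<Prod>A" if "A \<subseteq> W" for A using that Wp by (intro prod_primes_pos) auto
  have posW1: "0 < \<Prod>A" if "A \<subseteq> W1" for A using that W1p by (intro prod_primes_pos) auto
  define g where "g n = (if n \<le> x then F n else 0)" for n
  define Sm where "Sm = {A. A \<subseteq> W \<and> real (\<Prod>A) \<le> V}"
  define Bg where "Bg = {A. A \<subseteq> W \<and> V < real (\<Prod>A)}"
  have finSm: "finite Sm" by (rule finite_subset[of _ "Pow W"]) (auto simp: Sm_def finW)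
  have finBg: "finite Bg" by (rule finite_subset[of _ "Pow W"]) (auto simp: Bg_def finW)
  \<comment> \<open>The small smooth parts become integers here, since they will play the role of
    \<open>d\<close> in the bilinear sums and of a modulus in the progressions.\<close>
  define D where "D = \<Prod> ` Sm"
  have finD: "finite D" using finSm by (simp add: D_def)
  have D: "0 < d \<and> real d \<le> V" if "d \<in> D" for d
    using that posW by (auto simp: D_def Sm_def)
  have injSm: "inj_on \<Prod> Sm"
    by (rule inj_on_subset[OF inj_on_prod_primes[OF finW]]) (use Wp in \<open>auto simp: Sm_def\<close>)
  let ?m = "\<lambda>A. \<Sum>m\<in>insert 1 Mp. g (\<Prod>A * m)"

  have "(\<Sum>n\<in>sqfree_smooth (real x) y z. F n)
      = (\<Sum>am\<in>{(A, m). A \<subseteq> W \<and> m \<in> insert 1 Mp \<and> \<Prod>A * m \<le> x}. F (case am of (A, m) \<Rightarrow> \<Prod>A * m))"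
    by (rule sum.reindex_bij_betw[OF bij_betw_sqfree_smooth[OF x_eq s1 y], symmetric])
       (simp_all add: W_def Mp_def)
  also have "{(A, m). A \<subseteq> W \<and> m \<in> insert 1 Mp \<and> \<Prod>A * m \<le> x}
      = {am\<in>Pow W \<times> insert 1 Mp. \<Prod>(fst am) * snd am \<le> x}" by auto
  also have "(\<Sum>am\<in>\<dots>. F (case am of (A, m) \<Rightarrow> \<Prod>A * m))
      = (\<Sum>am\<in>Pow W \<times> insert 1 Mp. g (\<Prod>(fst am) * snd am))"
    unfolding g_def case_prod_unfold using finW finMp by (intro sum.inter_filter) auto
  also have "\<dots> = (\<Sum>A\<in>Pow W. ?m A)"
    by (simp only: sum.cartesian_product case_prod_unfold)
  also have "Pow W = Bg \<union> Sm" by (auto simp: Bg_def Sm_def)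
  also have "(\<Sum>A\<in>Bg \<union> Sm. ?m A)
      = (\<Sum>A\<in>Bg. ?m A) + (\<Sum>A\<in>Sm. ?m A)"
    using finBg finSm by (intro sum.union_disjoint) (auto simp: Bg_def Sm_def)
  also have "(\<Sum>A\<in>Sm. ?m A) = (\<Sum>A\<in>Sm. g (\<Prod>A)) + (\<Sum>A\<in>Sm. \<Sum>m\<in>Mp. g (\<Prod>A * m))"
    using finMp Mp1 by (simp add: sum.distrib)
  also have "(\<Sum>A\<in>Sm. \<Sum>m\<in>Mp. g (\<Prod>A * m)) = (\<Sum>d\<in>D. \<Sum>m\<in>Mp. g (d * m))"
    unfolding D_def using injSm by (simp add: sum.reindex)
  finally have total: "(\<Sum>n\<in>sqfree_smooth (real x) y z. F n)
      = (\<Sum>A\<in>Bg. ?m A) + ((\<Sum>A\<in>Sm. g (\<Prod>A)) + (\<Sum>d\<in>D. \<Sum>m\<in>Mp. g (d * m)))" .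

  have big: "\<bar>\<Sum>A\<in>Bg. ?m A\<bar> \<le> 24 * T^11 * E"
  proof -
    have "(\<Sum>A\<in>Bg. ?m A) = (\<Sum>A\<in>{A. A \<subseteq> W \<and> V < real (\<Prod>A)}. \<Sum>(d, k)\<in>{1} \<times> insert 1 Mp.
      if 0 < \<Prod>A * k \<and> \<Prod>A * k \<le> x \<and> \<Prod>A * (d * k) \<le> x then 1 * F (\<Prod>A * (d * k)) else 0)"
      unfolding Bg_def
    proof (rule sum.cong[OF refl])
      fix A assume A: "A \<in> {A. A \<subseteq> W \<and> V < real (\<Prod>A)}"
      have "(?m A) = (\<Sum>k\<in>insert 1 Mp.
          if 0 < \<Prod>A * k \<and> \<Prod>A * k \<le> x \<and> \<Prod>A * (1 * k) \<le> x then 1 * F (\<Prod>A * (1 * k)) else 0)"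
        using posW[of A] A by (intro sum.cong refl) (auto simp: g_def Mp_def prime_gt_0_nat)
      then show "(?m A) = (\<Sum>(d, k)\<in>{1} \<times> insert 1 Mp.
          if 0 < \<Prod>A * k \<and> \<Prod>A * k \<le> x \<and> \<Prod>A * (d * k) \<le> x then 1 * F (\<Prod>A * (d * k)) else 0)"
        by (simp only: sum.cartesian_product[symmetric] sum.insert finite.emptyI sum.empty empty_iff if_False add_0_right simp_thms)
    qed
    also have "\<bar>\<dots>\<bar> \<le> 24 * T^11 * E"
      by (rule smooth_type_II_bound[OF finW Wp]) (use finMp in \<open>auto simp: Mp_def prime_gt_0_nat\<close>)
    finally show ?thesis .
  qed

  have small: "\<bar>\<Sum>A\<in>Sm. g (\<Prod>A)\<bar> \<le> E"
  proof -
    have "\<bar>\<Sum>A\<in>Sm. g (\<Prod>A)\<bar> \<le> (\<Sum>A\<in>Sm. 1)"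
      using F1 by (intro order_trans[OF sum_abs] sum_mono) (auto simp: g_def)
    also have "\<dots> = real (card D)" unfolding D_def using injSm by (simp add: card_image)
    also have "card D \<le> card {1..nat \<lfloor>V\<rfloor>}"
      using D by (intro card_mono) (auto simp: Suc_le_eq le_nat_floor)
    also have "real (card {1..nat \<lfloor>V\<rfloor>}) \<le> V" using V1 by (simp add: of_nat_floor)
    finally show ?thesis using VE by simp
  qed

  define h where "h d B k = (if lo < \<Prod>B * k \<and> \<Prod>B * k \<le> hi \<and> \<Prod>B * (d * k) \<le> x
      then (- 1) ^ card B * F (\<Prod>B * (d * k)) else 0)" for d B k
  define Sm1 where "Sm1 = {B. B \<subseteq> W1 \<and> real (\<Prod>B) \<le> V}"
  define Bg1 where "Bg1 = {B. B \<subseteq> W1 \<and> V < real (\<Prod>B)}"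
  have finSm1: "finite Sm1" by (rule finite_subset[of _ "Pow W1"]) (auto simp: Sm1_def finW1)
  have finBg1: "finite Bg1" by (rule finite_subset[of _ "Pow W1"]) (auto simp: Bg1_def finW1)
  let ?h = "\<lambda>B. \<Sum>d\<in>D. \<Sum>k=1..x. h d B k"
  have sieve: "(\<Sum>m\<in>Mp. g (d * m)) = (\<Sum>B\<in>Pow W1. \<Sum>k=1..x. h d B k)" for d
  proof -
    have "(\<Sum>m\<in>Mp. g (d * m)) = (\<Sum>k\<in>{lo<..hi}. if prime k then g (d * k) else 0)"
      unfolding Mp_eq by (rule sum.inter_filter) simp
    also have "\<dots> = (\<Sum>k\<in>{lo<..hi}. \<Sum>B\<in>Pow W1. if \<Prod>B dvd k then (- 1) ^ card B * g (d * k) else 0)"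
    proof (rule sum.cong[OF refl])
      fix k assume k: "k \<in> {lo<..hi}"
      then have "s < real k" "real k \<le> s\<^sup>2" using lo_iff hi_x by (auto simp flip: x_eq)
      then have "(\<Sum>B\<in>{B. B \<subseteq> W1 \<and> \<Prod>B dvd k}. (- 1) ^ card B) = (of_bool (prime k) :: real)"
        using s1 by (intro legendre_prime_indicator[where s = s]) (auto simp: W1_def)
      then have "(if prime k then g (d * k) else 0) = (\<Sum>B\<in>{B. B \<subseteq> W1 \<and> \<Prod>B dvd k}. (- 1) ^ card B) * g (d * k)"
        by simp
      also have "\<dots> = (\<Sum>B\<in>{B\<in>Pow W1. \<Prod>B dvd k}. (- 1) ^ card B * g (d * k))"
        by (simp add: sum_distrib_right Pow_def)
      also have "\<dots> = (\<Sum>B\<in>Pow W1. if \<Prod>B dvd k then (- 1) ^ card B * g (d * k) else 0)"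
        using finW1 by (intro sum.inter_filter) simp
      finally show "(if prime k then g (d * k) else 0) = \<dots>" .
    qed
    also have "\<dots> = (\<Sum>B\<in>Pow W1. \<Sum>k\<in>{lo<..hi}. if \<Prod>B dvd k then (- 1) ^ card B * g (d * k) else 0)"
      by (rule sum.swap)
    also have "\<dots> = (\<Sum>B\<in>Pow W1. \<Sum>k=1..x. h d B k)"
    proof (rule sum.cong[OF refl])
      fix B assume B: "B \<in> Pow W1"
      have "(\<Sum>k\<in>{lo<..hi}. if \<Prod>B dvd k then (- 1) ^ card B * g (d * k) else 0)
          = (\<Sum>k\<in>{k\<in>{lo<..hi}. \<Prod>B dvd k}. (- 1) ^ card B * g (d * k))"
        by (rule sum.inter_filter[symmetric]) simp
      also have "\<dots> = (\<Sum>k=1..x. if lo < \<Prod>B * k \<and> \<Prod>B * k \<le> hi then (- 1) ^ card B * g (d * (\<Prod>B * k)) else 0)"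
        using posW1 B hi_x by (intro sum_multiples_eq) auto
      also have "\<dots> = (\<Sum>k=1..x. h d B k)"
        by (intro sum.cong refl) (simp add: h_def g_def mult.left_commute)
      finally show "(\<Sum>k\<in>{lo<..hi}. if \<Prod>B dvd k then (- 1) ^ card B * g (d * k) else 0) = \<dots>" .
    qed
    finally show ?thesis .
  qed
  have "(\<Sum>d\<in>D. \<Sum>m\<in>Mp. g (d * m)) = (\<Sum>B\<in>Pow W1. ?h B)"
    unfolding sieve by (rule sum.swap)
  also have "Pow W1 = Bg1 \<union> Sm1" by (auto simp: Bg1_def Sm1_def)
  also have "(\<Sum>B\<in>Bg1 \<union> Sm1. ?h B)
      = (\<Sum>B\<in>Bg1. ?h B) + (\<Sum>B\<in>Sm1. ?h B)"
    using finBg1 finSm1 by (intro sum.union_disjoint) (auto simp: Bg1_def Sm1_def)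
  finally have primes: "(\<Sum>d\<in>D. \<Sum>m\<in>Mp. g (d * m))
      = (\<Sum>B\<in>Bg1. ?h B) + (\<Sum>B\<in>Sm1. ?h B)" .

  have "\<bar>\<Sum>B\<in>{B. B \<subseteq> W1 \<and> V < real (\<Prod>B)}. \<Sum>(d, k)\<in>D \<times> {1..x}.
      if lo < \<Prod>B * k \<and> \<Prod>B * k \<le> hi \<and> \<Prod>B * (d * k) \<le> x then (- 1) ^ card B * F (\<Prod>B * (d * k)) else 0\<bar> \<le> 24 * T^11 * E"
  proof (rule smooth_type_II_bound[OF finW1 W1p])
    show "finite (D \<times> {1..x})" using finD by simp
    show "(- 1) ^ card (A \<union> B) = (- 1 :: real) ^ card A * (- 1) ^ card B"
      if "A \<subseteq> W1" "B \<subseteq> W1" "A \<inter> B = {}" for A B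
      using that finW1 by (simp add: card_Un_disjoint finite_subset power_add)
  qed (use D lo_x hi_x in \<open>auto simp: power_abs\<close>)
  then have bigB: "\<bar>\<Sum>B\<in>Bg1. ?h B\<bar> \<le> 24 * T^11 * E"
    by (simp only: Bg1_def h_def sum.cartesian_product)

  have injSm1: "inj_on \<Prod> Sm1"
    by (rule inj_on_subset[OF inj_on_prod_primes[OF finW1]]) (use W1p in \<open>auto simp: Sm1_def\<close>)
  \<comment> \<open>The sign of \<open>f\<close>, its Moebius value, is read off the set of primes
    whose product is \<open>f\<close>.\<close>
  define w :: "nat \<times> nat \<Rightarrow> real" where "w p = (- 1) ^ card (inv_into Sm1 \<Prod> (snd p))" for p
  define a where "a p = lo div snd p" for p :: "nat \<times> nat"
  define b where "b p = min (hi div snd p) (x div (fst p * snd p))" for p :: "nat \<times> nat"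
  let ?r = "\<lambda>d B. w (d, \<Prod>B) * (\<Sum>k\<in>{a (d, \<Prod>B)<..b (d, \<Prod>B)}. F (d * \<Prod>B * k))"
  have inner: "(\<Sum>k=1..x. h d B k) = ?r d B"
    if B: "B \<in> Sm1" and d: "d \<in> D" for d B
  proof -
    have f0: "0 < \<Prod>B" using B posW1 by (auto simp: Sm1_def)
    have d0: "0 < d" using D d by auto
    have w: "w (d, \<Prod>B) = (- 1) ^ card B" using injSm1 B by (simp add: w_def)
    have "(\<Sum>k=1..x. h d B k) = (\<Sum>k\<in>{k\<in>{1..x}. lo < \<Prod>B * k \<and> \<Prod>B * k \<le> hi \<and> \<Prod>B * (d * k) \<le> x}.
        (- 1) ^ card B * F (\<Prod>B * (d * k)))"
      unfolding h_def by (rule sum.inter_filter[symmetric]) simp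
    also have "{k\<in>{1..x}. lo < \<Prod>B * k \<and> \<Prod>B * k \<le> hi \<and> \<Prod>B * (d * k) \<le> x} = {a (d, \<Prod>B)<..b (d, \<Prod>B)}"
    proof (intro set_eqI)
      fix k
      have 1: "lo < \<Prod>B * k \<longleftrightarrow> a (d, \<Prod>B) < k"
        using f0 by (simp add: a_def div_less_iff_less_mult mult.commute)
      have 2: "\<Prod>B * k \<le> hi \<longleftrightarrow> k \<le> hi div \<Prod>B"
        using f0 by (simp add: less_eq_div_iff_mult_less_eq mult.commute)
      have 3: "\<Prod>B * (d * k) \<le> x \<longleftrightarrow> k \<le> x div (d * \<Prod>B)"
        using f0 d0 by (simp add: less_eq_div_iff_mult_less_eq mult_ac)
      have "k \<le> x" if "k \<le> x div (d * \<Prod>B)" using that div_le_dividend[of x "d * \<Prod>B"] by (rule order_trans)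
      then show "k \<in> {k\<in>{1..x}. lo < \<Prod>B * k \<and> \<Prod>B * k \<le> hi \<and> \<Prod>B * (d * k) \<le> x} \<longleftrightarrow> k \<in> {a (d, \<Prod>B)<..b (d, \<Prod>B)}"
        unfolding mem_Collect_eq 1 2 3 by (auto simp: b_def)
    qed
    finally show ?thesis unfolding w by (simp add: sum_distrib_left mult_ac)
  qed
  have "(\<Sum>B\<in>Sm1. ?h B)
      = (\<Sum>B\<in>Sm1. \<Sum>d\<in>D. ?r d B)"
    by (intro sum.cong refl inner)
  also have "\<dots> = (\<Sum>d\<in>D. \<Sum>B\<in>Sm1. ?r d B)"
    by (rule sum.swap)
  also have "\<dots> = (\<Sum>d\<in>D. \<Sum>f\<in>\<Prod> ` Sm1. w (d, f) * (\<Sum>k\<in>{a (d, f)<..b (d, f)}. F (d * f * k)))"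
    using injSm1 by (simp add: sum.reindex)
  also have "\<dots> = (\<Sum>p\<in>D \<times> \<Prod> ` Sm1. w p * (\<Sum>k\<in>{a p<..b p}. F (fst p * snd p * k)))"
    by (simp add: sum.cartesian_product case_prod_unfold)
  also have "\<bar>\<dots>\<bar> \<le> 768 * T^6 * E"
  proof (rule type_I_bound)
    show "finite (D \<times> \<Prod> ` Sm1)" using finD finSm1 by simp
    show "0 < d \<and> 0 < f \<and> real d \<le> V \<and> real f \<le> V" if "(d, f) \<in> D \<times> \<Prod> ` Sm1" for d f
      using that D[of d] posW1 by (auto simp: Sm1_def)
    show "b (d, f) \<le> x div (d * f)" for d f by (simp add: b_def)
    show "\<bar>w p\<bar> \<le> 1" for p by (simp add: w_def power_abs)
  qed
  also have "\<dots> \<le> 768 * T^11 * E" using T1 E0 by (intro mult_right_mono mult_left_mono power_increasing) auto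
  finally have smallB: "\<bar>\<Sum>B\<in>Sm1. ?h B\<bar> \<le> 768 * T^11 * E" .

  have "E \<le> T^11 * E" using T1 E0 mult_right_mono[of 1 "T^11" E] by (simp add: one_le_power)
  then show ?thesis using big small bigB smallB unfolding total primes by linarith
qed

end

section \<open>Divisor bound and Diophantine approximation\<close>

lemma card_divisors_prime_power_mult_le:
  fixes p m :: nat
  assumes p: "prime p" and m: "0 < m"
  shows "card {d. d dvd p ^ a * m} \<le> (a + 1) * card {d. d dvd m}"
proof -
  have "{d. d dvd p ^ a * m} \<subseteq> (\<lambda>(i, d). p ^ i * d) ` ({..a} \<times> {d. d dvd m})"
  proof
    fix d assume "d \<in> {d. d dvd p ^ a * m}"
    then obtain b c where bc: "d = b * c" "b dvd p ^ a" "c dvd m"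
      using division_decomp[of d "p ^ a" m] by auto
    then obtain i where "i \<le> a" "b = p ^ i" using p by (auto simp: divides_primepow_nat)
    with bc show "d \<in> (\<lambda>(i, d). p ^ i * d) ` ({..a} \<times> {d. d dvd m})" by force
  qed
  moreover have fin: "finite ({..a} \<times> {d. d dvd m})" using m by simp
  ultimately have "card {d. d dvd p ^ a * m} \<le> card ((\<lambda>(i, d). p ^ i * d) ` ({..a} \<times> {d. d dvd m}))"
    by (intro card_mono finite_imageI)
  also have "\<dots> \<le> card ({..a} \<times> {d. d dvd m})" using fin by (rule card_image_le)
  finally show ?thesis by (simp add: card_cartesian_product)
qed

text \<open>A factor \<open>p ^ a\<close> contributes \<open>a + 1 \<le> p powr (a * \<eta>)\<close> as soon as \<open>p \<ge> 2 powr (1 / \<eta>)\<close>;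
  the finitely many smaller primes contribute a bounded factor.\<close>

lemma divisor_bound:
  fixes \<eta> :: real
  assumes \<eta>: "0 < \<eta>"
  shows "\<exists>C\<ge>1. \<forall>n\<ge>1. real (card {d. d dvd n}) \<le> C * real n powr \<eta>"
proof -
  \<comment> \<open>With \<open>c = \<eta> * ln 2\<close> this is the factor for which
    \<open>a + 1 \<le> K * (1 + a * c)\<close>, while \<open>1 + a * c\<close> is at most
    \<open>2 powr (a * \<eta>)\<close>.\<close>
  define K where "K = 1 + 1 / (\<eta> * ln 2)"
  define P where "P = {p. prime p \<and> real p < 2 powr (1 / \<eta>)}"
  have K1: "1 \<le> K" using \<eta> by (simp add: K_def)
  have "P \<subseteq> {..nat \<lfloor>2 powr (1 / \<eta>)\<rfloor>}" by (auto simp: P_def intro!: le_nat_floor)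
  then have finP: "finite P" by (rule finite_subset) simp
  \<comment> \<open>Counting the small primes that divide \<open>n\<close> makes the induction work:
    splitting off one of them uses up exactly one factor \<open>K\<close>.\<close>
  have main: "real (card {d. d dvd n}) \<le> K ^ card {p\<in>P. p dvd n} * real n powr \<eta>" if "1 \<le> n" for n
    using that
  proof (induction n rule: less_induct)
    case (less n)
    show ?case
    proof (cases "n = 1")
      case False
      then obtain p where p: "prime p" "p dvd n" using prime_factor_nat by blast
      define a where "a = multiplicity p n"
      have n0: "n \<noteq> 0" using less.prems by simp
      obtain m where m: "n = p ^ a * m" "\<not> p dvd m"
        using multiplicity_decompose'[of n p] n0 p(1) unfolding a_def by (metis not_prime_unit)
      have a1: "1 \<le> a" using p n0 unfolding a_def by (simp add: multiplicity_geI Suc_le_eq prime_multiplicity_gt_zero_iff)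
      have m0: "0 < m" using m n0 by (cases m) auto
      have pa: "1 < p ^ a" using a1 prime_gt_1_nat[OF p(1)] by (intro one_less_power) auto
      have "m < n" using m m0 pa by simp
      then have IH: "real (card {d. d dvd m}) \<le> K ^ card {p\<in>P. p dvd m} * real m powr \<eta>"
        using m0 by (intro less.IH) auto
      have "real (card {d. d dvd n}) \<le> real ((a + 1) * card {d. d dvd m})"
        using card_divisors_prime_power_mult_le[OF p(1) m0, of a] m(1) by (simp only: of_nat_le_iff)
      also have "\<dots> \<le> (real a + 1) * (K ^ card {p\<in>P. p dvd m} * real m powr \<eta>)"
        by (simp only: of_nat_mult of_nat_add of_nat_1) (intro mult_left_mono IH, simp)
      also have "\<dots> \<le> (if p \<in> P then K else 1) * real (p ^ a) powr \<eta> * (K ^ card {p\<in>P. p dvd m} * real m powr \<eta>)"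
      proof (rule mult_right_mono)
        have pp: "real (p ^ a) powr \<eta> = (real p powr \<eta>) ^ a"
          using prime_gt_0_nat[OF p(1)] by (simp add: powr_powr powr_realpow[symmetric] mult.commute)
        show "real a + 1 \<le> (if p \<in> P then K else 1) * real (p ^ a) powr \<eta>"
        proof (cases "p \<in> P")
          case True
          have "1 + real a * (\<eta> * ln 2) \<le> exp (real a * (\<eta> * ln 2))" by (rule exp_ge_add_one_self)
          also have "\<dots> = (2 powr \<eta>) ^ a" by (simp add: powr_def exp_of_nat_mult[symmetric] mult_ac)
          also have "\<dots> \<le> (real p powr \<eta>) ^ a"
            using prime_ge_2_nat[OF p(1)] \<eta> by (intro power_mono powr_mono2) auto
          finally have 1: "1 + real a * (\<eta> * ln 2) \<le> (real p powr \<eta>) ^ a" .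
          have c0: "0 < \<eta> * ln 2" using \<eta> by simp
          have "real a + 1 \<le> K * (1 + real a * (\<eta> * ln 2))"
          proof -
            have "(1 + 1 / c) * (1 + real a * c) = real a + 1 + (real a * c + 1 / c)" if "0 < c" for c
              using that by (simp add: field_simps)
            from this[OF c0] show ?thesis unfolding K_def using c0 \<eta> by simp
          qed
          also have "\<dots> \<le> K * (real p powr \<eta>) ^ a" using 1 K1 by (intro mult_left_mono) auto
          finally show ?thesis using True pp by simp
        next
          case False
          then have "2 powr (1 / \<eta>) \<le> real p" using p by (simp add: P_def)
          then have "(2 powr (1 / \<eta>)) powr \<eta> \<le> real p powr \<eta>" using \<eta> by (intro powr_mono2) auto
          then have 2: "2 \<le> real p powr \<eta>" using \<eta> by (simp add: powr_powr)
          have "a + 1 \<le> 2 ^ a" by (simp add: Suc_leI)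
          then have "real (a + 1) \<le> real (2 ^ a)" by (simp only: of_nat_le_iff)
          then have "real a + 1 \<le> 2 ^ a" by simp
          also have "\<dots> \<le> (real p powr \<eta>) ^ a" using 2 by (intro power_mono) auto
          finally show ?thesis using False pp by simp
        qed
      qed (use K1 in auto)
      also have "\<dots> = ((if p \<in> P then K else 1) * K ^ card {p\<in>P. p dvd m}) * real n powr \<eta>"
        using m(1) by (simp add: powr_mult)
      also have "(if p \<in> P then K else 1) * K ^ card {p\<in>P. p dvd m} \<le> K ^ card {p\<in>P. p dvd n}"
      proof (cases "p \<in> P")
        case True
        have "insert p {p\<in>P. p dvd m} \<subseteq> {p\<in>P. p dvd n}" using True p m by auto
        then have "card (insert p {p\<in>P. p dvd m}) \<le> card {p\<in>P. p dvd n}" using finP by (intro card_mono) auto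
        then have "card {p\<in>P. p dvd m} + 1 \<le> card {p\<in>P. p dvd n}" using finP m(2) by simp
        then have "K ^ (card {p\<in>P. p dvd m} + 1) \<le> K ^ card {p\<in>P. p dvd n}" using K1 by (rule power_increasing)
        then show ?thesis using True by simp
      next
        case False
        have "card {p\<in>P. p dvd m} \<le> card {p\<in>P. p dvd n}" using finP m by (intro card_mono) auto
        then show ?thesis using False K1 by (simp add: power_increasing)
      qed
      finally show ?thesis by (simp add: mult_right_mono)
    qed (use K1 in simp)
  qed
  show ?thesis
  proof (intro exI[of _ "K ^ card P"] conjI allI impI)
    show "1 \<le> K ^ card P" using K1 by (rule one_le_power)
    fix n :: nat assume n: "1 \<le> n"
    have "K ^ card {p\<in>P. p dvd n} \<le> K ^ card P" using K1 finP by (intro power_increasing card_mono) auto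
    then show "real (card {d. d dvd n}) \<le> K ^ card P * real n powr \<eta>"
      using main[OF n] by (meson mult_right_mono order_trans powr_ge_zero)
  qed
qed

text \<open>If \<open>t = a + 1 / t'\<close> and \<open>s' = 1 / (a + s)\<close>, then the quotient \<open>(d t - p) (d s + p) / (t + s)\<close>
  only changes its sign when \<open>(t, s, d, p)\<close> is replaced by \<open>(t', s', p - a d, d)\<close>.
  So the descent below loses nothing from one step to the next.\<close>

lemma bounded_cf_form_ge:
  fixes t s :: real and d p A :: nat
  assumes "t > 1" "t \<notin> \<rat>" "\<And>j. partial_quot t j \<le> int A"
    and "0 \<le> s" "s \<le> 1" "0 < p \<or> (0 < d \<and> 1 / (real A + 1) \<le> s)"
  shows "(t + s) / (2 * (real A + 2)) \<le> \<bar>real d * t - real p\<bar> * (real d * s + real p)"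
  using assms
proof (induction "d + p" arbitrary: t s d p rule: less_induct)
  case less
  define a where "a = nat \<lfloor>t\<rfloor>"
  have a: "1 \<le> a" "real a \<le> t" "t < real a + 1"
    using less.prems(1) unfolding a_def by (simp_all add: nat_le_iff le_nat_iff)
  have aA: "real a \<le> real A"
    using less.prems(3)[of 0] a by (simp add: partial_quot_def a_def)
  have tA: "t + s \<le> real A + 2" using a aA less.prems by simp
  \<comment> \<open>The left-hand side never exceeds 1/2, so the descent may stop as soon as the
    product on the right is at least 1.\<close>
  then have ts1: "(t + s) / (2 * (real A + 2)) \<le> 1 / 2"
    by (simp add: field_simps)
  show ?case
  proof (cases "d = 0")
    case True
    then have "1 \<le> real p" using less.prems by simp
    then have "1 * 1 \<le> real p * real p" by (intro mult_mono) auto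
    then have "(t + s) / (2 * (real A + 2)) \<le> real p * real p" using ts1 by linarith
    then show ?thesis using True by simp
  next
    case d: False
    then have d1: "1 \<le> real d" by simp
    show ?thesis
    proof (cases "p = 0")
      case True
      then have s: "1 / (real A + 1) \<le> s" using less.prems by simp
      have "(t + s) / (2 * (real A + 2)) \<le> (2 * t) / (2 * (real A + 2))"
        using less.prems by (intro divide_right_mono) auto
      also have "\<dots> = t * (1 / (real A + 2))" using mult_divide_mult_cancel_left[of 2 t "real A + 2"] by simp
      also have "\<dots> \<le> t * s"
        using s less.prems by (intro mult_left_mono order_trans[OF _ s] divide_left_mono) auto
      also have "\<dots> \<le> (real d * t) * (real d * s)"
        using d1 less.prems mult_mono[of 1 "real d" 1 "real d"] mult_right_mono[of 1 "real d * real d" "t * s"]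
        by (simp add: mult_ac)
      finally show ?thesis using True less.prems by simp
    next
      case p: False
      show ?thesis
      proof (cases "d * a \<le> p")
        \<comment> \<open>Here \<open>p\<close> falls short of \<open>d * a\<close> by an integer,
          so both factors on the right are at least 1.\<close>
        case False
        then have "p + 1 \<le> d * a" by simp
        then have "real p + 1 \<le> real d * real a" by (metis of_nat_1 of_nat_add of_nat_le_iff of_nat_mult)
        also have "\<dots> \<le> real d * t" using a by (intro mult_left_mono) auto
        finally have "1 \<le> \<bar>real d * t - real p\<bar>" by simp
        moreover have "1 \<le> real d * s + real p" using p less.prems(4) by (simp add: add_increasing)
        ultimately have "1 * 1 \<le> \<bar>real d * t - real p\<bar> * (real d * s + real p)" by (intro mult_mono) auto
        then show ?thesis using ts1 by linarith
      next
        case True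
        define d' where "d' = p - d * a"
        define t' where "t' = 1 / (t - real a)"
        define s' where "s' = 1 / (real a + s)"
        have d': "real d' = real p - real d * real a" using True by (simp add: d'_def of_nat_diff)
        have "t \<noteq> real a" using less.prems(2) by auto
        then have ta: "0 < t - real a" "t - real a < 1" using a by auto
        have frac: "frac t = t - real a" using a by (simp add: frac_def a_def)
        have t'1: "1 < t'" using ta by (simp add: t'_def)
        have as: "1 \<le> real a + s" using a(1) less.prems(4) by (simp add: add_increasing2)
        have cq: "complete_quot t' j = complete_quot t (Suc j)" for j
          by (induction j) (simp_all add: t'_def frac)
        have IH: "(t' + s') / (2 * (real A + 2)) \<le> \<bar>real d' * t' - real d\<bar> * (real d' * s' + real d)"
        proof (rule less.hyps)
          have "d \<le> d * a" using a(1) by simp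
          then have "d' + d \<le> p" using True unfolding d'_def by linarith
          then show "d' + d < d + p" using d by simp
          show "t' \<notin> \<rat>"
          proof
            assume "t' \<in> \<rat>"
            then have "1 / t' + real a \<in> \<rat>" by (intro Rats_add Rats_divide) auto
            then show False using less.prems(2) ta by (simp add: t'_def)
          qed
          show "partial_quot t' j \<le> int A" for j
            using less.prems(3)[of "Suc j"] by (simp only: partial_quot_def cq)
        qed (use t'1 as d in \<open>auto simp: s'_def\<close>)
        have e1: "real d * t - real p = - (real d' * t' - real d) / t'"
          using ta unfolding d' t'_def by (simp add: field_simps)
        have e2: "real d * s + real p = (real a + s) * (real d' * s' + real d)"
          using as unfolding d' s'_def by (simp add: field_simps)
        have e3: "t + s = (real a + s) / t' * (t' + s')"
        proof -
          have "w / (1 / u) * (1 / u + 1 / w) = w + u" if "0 < u" "0 < w" for u w :: real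
            using that by (simp add: field_simps)
          from this[OF ta(1), of "real a + s"] show ?thesis using as by (simp add: t'_def s'_def)
        qed
        have "(t + s) / (2 * (real A + 2)) = (real a + s) / t' * ((t' + s') / (2 * (real A + 2)))"
          unfolding e3 by simp
        also have "\<dots> \<le> (real a + s) / t' * (\<bar>real d' * t' - real d\<bar> * (real d' * s' + real d))"
          using IH as t'1 by (intro mult_left_mono) auto
        also have "\<dots> = \<bar>real d * t - real p\<bar> * (real d * s + real p)"
          unfolding e1 e2 using t'1 abs_minus_commute[of "real d" "real d' * t'"] by (simp add: abs_divide)
        finally show ?thesis .
      qed
    qed
  qed
qed

text \<open>The case \<open>s = 0\<close> of \<open>bounded_cf_form_ge\<close>. That lemma needs a
  number above 1 and natural numbers as coefficients, so it is applied to the complete quotient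
  \<open>t = 1 / frac \<alpha>\<close>, with numerator and denominator exchanged:
  \<open>d * u - p\<close> is \<open>- u * (p * t - d)\<close>.\<close>

lemma bounded_cf_badly_approximable:
  assumes "\<alpha> \<in> bounded_cf A" "0 < d"
  shows "1 / (2 * (real A + 2) * real d) \<le> dist_int (\<alpha> * real d)"
proof (rule dist_int_greatest)
  fix m :: int
  have \<alpha>: "\<alpha> \<notin> \<rat>" "\<And>j. \<bar>partial_quot \<alpha> j\<bar> \<le> int A" using assms by (auto simp: bounded_cf_def)
  define u where "u = frac \<alpha>"
  have "u \<noteq> 0" using \<alpha>(1) by (auto simp: u_def frac_eq_0_iff dest: Ints_subset_Rats[THEN subsetD])
  then have u: "0 < u" "u < 1" using frac_lt_1[of \<alpha>] frac_ge_0[of \<alpha>] by (auto simp: u_def)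
  define p where "p = m - \<lfloor>\<alpha>\<rfloor> * int d"
  have eq: "\<alpha> * real d - of_int m = real d * u - of_int p"
    by (simp add: p_def u_def frac_def algebra_simps)
  show "1 / (2 * (real A + 2) * real d) \<le> \<bar>\<alpha> * real d - of_int m\<bar>"
  proof (cases "p < 0")
    case True
    then have "1 \<le> - real_of_int p" by linarith
    moreover have "0 \<le> real d * u" using u by simp
    ultimately have "1 \<le> \<bar>\<alpha> * real d - of_int m\<bar>" unfolding eq by linarith
    moreover have "1 / (2 * (real A + 2) * real d) \<le> 1"
    proof -
      have "1 * 1 \<le> (2 * (real A + 2)) * real d" using assms(2) by (intro mult_mono) auto
      then show ?thesis by simp
    qed
    ultimately show ?thesis by simp
  next
    case False
    define t where "t = 1 / u"
    have cq: "complete_quot t j = complete_quot \<alpha> (Suc j)" for j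
      by (induction j) (simp_all add: t_def u_def)
    have "(t + 0) / (2 * (real A + 2)) \<le> \<bar>real (nat p) * t - real d\<bar> * (real (nat p) * 0 + real d)"
    proof (rule bounded_cf_form_ge)
      show "1 < t" using u by (simp add: t_def)
      show "t \<notin> \<rat>"
      proof
        assume "t \<in> \<rat>"
        then have "1 / t + of_int \<lfloor>\<alpha>\<rfloor> \<in> \<rat>" by (intro Rats_add Rats_divide) auto
        then show False using \<alpha>(1) by (simp add: t_def u_def frac_def)
      qed
      show "partial_quot t j \<le> int A" for j
        using \<alpha>(2)[of "Suc j"] by (simp add: partial_quot_def cq)
    qed (use assms in auto)
    then have "(1 / u) / (2 * (real A + 2)) \<le> \<bar>of_int p * (1 / u) - real d\<bar> * real d"
      using False by (simp add: t_def)
    also have "\<bar>of_int p * (1 / u) - real d\<bar> = \<bar>\<alpha> * real d - of_int m\<bar> / u"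
    proof -
      have "of_int p * (1 / u) - real d = - (real d * u - of_int p) / u" using u by (simp add: field_simps)
      then show ?thesis unfolding eq using u by (simp add: abs_divide)
    qed
    finally have "(1 / u) / (2 * (real A + 2)) * u \<le> \<bar>\<alpha> * real d - of_int m\<bar> / u * real d * u"
      using u by (intro mult_right_mono) auto
    then have "1 / (2 * (real A + 2)) \<le> \<bar>\<alpha> * real d - of_int m\<bar> * real d"
      using u by simp
    then have "1 / (2 * (real A + 2)) / real d \<le> \<bar>\<alpha> * real d - of_int m\<bar> * real d / real d"
      by (rule divide_right_mono) simp
    then show ?thesis using assms(2) by simp
  qed
qed

text \<open>Let \<open>q\<close> be the denominator of a Dirichlet approximation. A multiple
  \<open>d\<close> of the reduced fraction with \<open>0 < d < q\<close> is at least
  \<open>1 / q\<close> away from the integers, and for \<open>2 * d \<le> q\<close> replacing the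
  fraction by \<open>\<alpha>\<close> costs at most half of that.\<close>

lemma irrational_multiples_separated:
  assumes "\<alpha> \<notin> \<rat>"
  shows "\<exists>q>Q. \<forall>d::nat. 1 \<le> d \<and> 2 * d \<le> q \<longrightarrow> 1 / (2 * real q) \<le> dist_int (\<alpha> * real d)"
proof -
  define \<mu> where "\<mu> = Min ((\<lambda>d. dist_int (\<alpha> * real d)) ` {1..Q + 1})"
  have pos: "0 < dist_int (\<alpha> * real d)" if "1 \<le> d" for d
  proof (rule ccontr)
    assume "\<not> 0 < dist_int (\<alpha> * real d)"
    then have "dist_int (\<alpha> * real d) = 0" using dist_int_nonneg[of "\<alpha> * real d"] by simp
    then have "\<alpha> = of_int (round (\<alpha> * real d)) / real d" using that by (simp add: dist_int_eq_round field_simps)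
    then have "\<alpha> \<in> \<rat>" by (metis Rats_divide Rats_of_int Rats_of_nat)
    then show False using assms by simp
  qed
  have \<mu>0: "0 < \<mu>" unfolding \<mu>_def using pos by (subst Min_gr_iff) auto
  \<comment> \<open>This precision forces \<open>q > Q\<close>: no multiple of
    \<open>\<alpha>\<close> by an integer up to \<open>Q\<close> comes within \<open>1 / N\<close>
    of an integer.\<close>
  obtain N :: nat where N: "1 / \<mu> < real N" using reals_Archimedean2 by blast
  have N0: "0 < N" using N \<mu>0 by (metis less_trans of_nat_0_less_iff zero_less_divide_1_iff)
  obtain h k where hk: "coprime h k" "0 < k" "k \<le> int N" "\<bar>of_int k * \<alpha> - of_int h\<bar> < 1 / real N"
    using Dirichlet_approx_coprime[OF N0, of \<alpha>] by blast
  define q where "q = nat k"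
  have q: "0 < q" "int q = k" using hk by (auto simp: q_def)
  then have rq: "real q = of_int k" by (metis of_int_of_nat_eq)
  have "Q < q"
  proof (rule ccontr)
    assume "\<not> Q < q"
    then have "\<mu> \<le> dist_int (\<alpha> * real q)" unfolding \<mu>_def using q by (intro Min_le) auto
    also have "\<dots> \<le> \<bar>\<alpha> * real q - of_int h\<bar>" by (rule dist_int_le)
    also have "\<dots> < 1 / real N" using hk(4) by (simp add: rq mult.commute)
    finally have "\<mu> < 1 / real N" .
    moreover have "1 / real N < \<mu>" using N \<mu>0 N0 by (simp add: field_simps)
    ultimately show False by simp
  qed
  moreover have "1 / (2 * real q) \<le> dist_int (\<alpha> * real d)" if d: "1 \<le> d" "2 * d \<le> q" for d
  proof (rule dist_int_greatest)
    fix m :: int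
    have err: "\<bar>of_int k * \<alpha> - of_int h\<bar> \<le> 1 / real q"
      using hk q by (intro order_trans[OF less_imp_le[OF hk(4)]] divide_left_mono) auto
    have "h * int d - m * k \<noteq> 0"
    proof
      assume "h * int d - m * k = 0"
      then have "k dvd h * int d" by simp
      then have "k dvd int d" using hk(1) by (simp add: coprime_dvd_mult_right_iff coprime_commute)
      then have "k \<le> int d" using d by (intro zdvd_imp_le) auto
      then show False using d q by simp
    qed
    then have "1 \<le> \<bar>h * int d - m * k\<bar>" by linarith
    then have "1 \<le> real_of_int \<bar>h * int d - m * k\<bar>" by linarith
    then have "1 \<le> \<bar>of_int h * real d - of_int m * real q\<bar>" by (simp add: rq)
    moreover have "of_int h * real d - of_int m * real q
        = real q * (\<alpha> * real d - of_int m) - real d * (of_int k * \<alpha> - of_int h)"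
      by (simp add: rq algebra_simps)
    ultimately have "1 \<le> \<bar>real q * (\<alpha> * real d - of_int m)\<bar> + \<bar>real d * (of_int k * \<alpha> - of_int h)\<bar>" by linarith
    also have "\<bar>real d * (of_int k * \<alpha> - of_int h)\<bar> \<le> real d * (1 / real q)"
      unfolding abs_mult using err by (intro mult_mono) auto
    also have "\<dots> \<le> 1 / 2" using d q by (simp add: field_simps)
    finally have "1 / 2 \<le> real q * \<bar>\<alpha> * real d - of_int m\<bar>" by (simp add: abs_mult)
    then show "1 / (2 * real q) \<le> \<bar>\<alpha> * real d - of_int m\<bar>" using q by (simp add: field_simps)
  qed
  ultimately show ?thesis by blast
qed

section \<open>The main estimate\<close>

text \<open>The error is nonnegative, so smoothness of \<open>n\<close> is ignored and all
  \<open>n \<le> x\<close> are summed. Each end point of the arc contributes about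
  \<open>s + x / H\<close>.\<close>

lemma fejer_approximation_error_le:
  fixes x :: nat
  assumes sm: "separated_multiples \<alpha> s T" and x: "real x = s\<^sup>2" and H: "0 < H" "real H \<le> s"
    and E: "s \<le> E" "real x / real H \<le> E"
  shows "(\<Sum>n=1..x. \<bar>of_bool (dist_int (\<alpha> * real n + \<beta>) < \<delta>)
      - (\<Sum>j\<in>grid_near H \<delta>. fejer H (\<alpha> * real n + \<beta> - real j / real H))\<bar>) \<le> 256 * T^4 * E"
proof -
  interpret separated_multiples \<alpha> s T by (rule sm)
  have H1: "1 \<le> real H" using H by simp
  have E0: "0 \<le> E" using E(1) s1 by simp
  have half: "(\<Sum>n=1..x. 1 / (1 + real H * dist_int (\<alpha> * real n + \<theta>))) \<le> 8 * T^3 * E" for \<theta>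
  proof -
    have "1 / (1 + real H * dist_int t) = 1 / real H * (1 / (1 / real H + dist_int t))" for t
      using H1 dist_int_nonneg[of t] by (simp add: field_simps)
    then have "(\<Sum>n=1..x. 1 / (1 + real H * dist_int (\<alpha> * real n + \<theta>)))
        = 1 / real H * (\<Sum>n=1..x. 1 / (1 / real H + dist_int (\<alpha> * real n + \<theta>)))"
      by (simp only: sum_distrib_left)
    also have "\<dots> \<le> 1 / real H * (2 * T^3 * (real x / s + 1) * (real H + s))"
      using H by (intro mult_left_mono sum_interval_le) auto
    also have "\<dots> = 1 / real H * (2 * T^3 * (s + 1) * (real H + s))"
      using s1 by (simp add: x power2_eq_square)
    also have "\<dots> \<le> 1 / real H * (2 * T^3 * (2 * s) * (real H + s))"
      using T1 s1 by (intro mult_left_mono mult_right_mono) auto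
    also have "\<dots> = 4 * T^3 * (s + real x / real H)"
      using H1 by (simp add: x field_simps power2_eq_square)
    also have "\<dots> \<le> 4 * T^3 * (2 * E)" using E T1 by (intro mult_left_mono) auto
    finally show ?thesis by simp
  qed
  have lnH: "2 + ln (real H) \<le> 2 * T"
  proof -
    have "real H \<le> T * s" using H(2) mult_right_mono[OF T1, of s] s1 by linarith
    then have "ln (real H) \<le> ln (T * s)" using H1 by simp
    then show ?thesis using log_le T1 by simp
  qed
  have "(\<Sum>n=1..x. \<bar>of_bool (dist_int (\<alpha> * real n + \<beta>) < \<delta>)
      - (\<Sum>j\<in>grid_near H \<delta>. fejer H (\<alpha> * real n + \<beta> - real j / real H))\<bar>)
      \<le> (\<Sum>n=1..x. 8 * (2 + ln (real H)) * (1 / (1 + real H * dist_int (\<alpha> * real n + (\<beta> - \<delta>)))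
          + 1 / (1 + real H * dist_int (\<alpha> * real n + (\<beta> + \<delta>)))))"
    using fejer_approx[OF H(1), of "\<alpha> * real n + \<beta>" \<delta> for n]
    by (intro sum_mono) (simp add: algebra_simps)
  also have "\<dots> = 8 * (2 + ln (real H)) * ((\<Sum>n=1..x. 1 / (1 + real H * dist_int (\<alpha> * real n + (\<beta> - \<delta>))))
          + (\<Sum>n=1..x. 1 / (1 + real H * dist_int (\<alpha> * real n + (\<beta> + \<delta>)))))"
    by (simp only: sum_distrib_left sum.distrib distrib_left)
  also have "\<dots> \<le> 8 * (2 * T) * (8 * T^3 * E + 8 * T^3 * E)"
    using lnH T1 ln_ge_zero[OF H1] by (intro mult_mono add_mono half) (auto intro!: add_nonneg_nonneg sum_nonneg simp: dist_int_nonneg)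
  also have "\<dots> = 256 * T^4 * E" by (simp add: eval_nat_numeral)
  finally show ?thesis .
qed

definition smooth_discrepancy :: "real \<Rightarrow> real \<Rightarrow> real \<Rightarrow> nat \<Rightarrow> real \<Rightarrow> real \<Rightarrow> real" where
  "smooth_discrepancy \<alpha> \<beta> \<delta> x y z = \<bar>(\<Sum>n | n \<in> sqfree_smooth (real x) y z \<and> dist_int (\<alpha> * real n + \<beta>) < \<delta>. 1)
      - 2 * \<delta> * real (sqfree_smooth_count (real x) y z)\<bar>"

text \<open>The hypothesis of \<open>separated_multiples\<close> with a fixed constant in place of
  \<open>1 / T\<close>. Keeping \<open>c\<close> fixed is what makes the final constants uniform in
  \<open>\<alpha>\<close>.\<close>

definition spread_multiples :: "real \<Rightarrow> real \<Rightarrow> nat \<Rightarrow> bool" where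
  "spread_multiples c \<alpha> x \<longleftrightarrow> (\<forall>d::nat. 1 \<le> d \<and> real d \<le> c * real x powr (1/2)
     \<longrightarrow> c / real x powr (1/2) \<le> dist_int (\<alpha> * real d))"

text \<open>The indicator is \<open>F n + c0\<close> up to the smoothing error, and the mean
  \<open>c0\<close> differs from \<open>2 * \<delta>\<close> by at most \<open>1 / H\<close>. The
  constant is 256 + 817 + 1 for smoothing, oscillating part and mean.\<close>

lemma sqfree_smooth_discrepancy_le:
  fixes x :: nat
  assumes T: "1 \<le> T"
    and sep: "\<And>d::nat. 1 \<le> d \<Longrightarrow> real d \<le> real x powr (1/2) / T \<Longrightarrow> 1 / (T * real x powr (1/2)) \<le> dist_int (\<alpha> * real d)"
    and log: "1 + ln (T * real x powr (1/2)) \<le> T"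
    and tau: "\<And>l. 1 \<le> l \<Longrightarrow> l \<le> x\<^sup>2 \<Longrightarrow> real (card {d. d dvd l}) \<le> T"
    and bits: "\<exists>r. x + 1 < 2 ^ r \<and> real r \<le> T"
    and x: "16 \<le> x" and \<epsilon>: "0 < \<epsilon>" "\<epsilon> < 1/4"
    and \<delta>: "\<delta> = real x powr (-1/4 + \<epsilon>)" "\<delta> \<le> 1/2"
    and y: "2 \<le> y" "y < real x powr (1/2)" and z: "z \<le> real x"
  shows "smooth_discrepancy \<alpha> \<beta> \<delta> x y z \<le> 1074 * T^11 * real x powr (3/4 + \<epsilon>/2)"
proof -
  define X where "X = real x"
  define s where "s = X powr (1/2)"
  define V where "V = X powr (1/4)"
  define E where "E = X powr (3/4 + \<epsilon>/2)"
  \<comment> \<open>The smallest degree with \<open>x / H \<le> E\<close>.\<close>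
  define H where "H = nat \<lceil>X powr (1/4 - \<epsilon>/2)\<rceil>"
  \<comment> \<open>The shift \<open>\<beta>\<close> affects only the phases of the coefficients, so
    every estimate is uniform in it.\<close>
  define \<gamma> where "\<gamma> h = grid_coeff H \<delta> h * unit_exp (real h * \<beta>)" for h
  define c0 where "c0 = real (card (grid_near H \<delta>)) / real H"
  have X16: "16 \<le> X" using x by (simp add: X_def)
  then have X1: "1 \<le> X" and X0: "0 < X" by auto
  have mono: "X powr p \<le> X powr q" if "p \<le> q" for p q using that X1 by (rule powr_mono)
  have ge1: "1 \<le> X powr p" if "0 \<le> p" for p using that X1 by (simp add: ge_one_powr_ge_zero)
  have s_sq: "real x = s\<^sup>2"
    using X0 by (simp add: s_def X_def power2_eq_square flip: powr_add)
  have V_sq: "s = V\<^sup>2" by (simp add: s_def V_def power2_eq_square flip: powr_add)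
  have V2: "2 \<le> V"
  proof -
    have "(16::real) powr (1/4) \<le> V" unfolding V_def using X16 by (intro powr_mono2) auto
    moreover have "(16::real) powr (1/4) = 2"
    proof -
      have "(16::real) = 2 powr 4" by simp
      then show ?thesis by (simp only: powr_powr) simp
    qed
    ultimately show ?thesis by simp
  qed
  have s4: "4 \<le> s" unfolding V_sq using power_mono[OF V2, of 2] by simp
  have \<delta>': "\<delta> = X powr (-1/4 + \<epsilon>)" by (simp add: \<delta> X_def)
  then have \<delta>0: "0 < \<delta>" using X0 by simp
  have base: "1 \<le> X powr (1/4 - \<epsilon>/2)" using \<epsilon> by (intro ge1) auto
  have Hl: "X powr (1/4 - \<epsilon>/2) \<le> real H" unfolding H_def by linarith
  have Hu: "real H \<le> 2 * X powr (1/4 - \<epsilon>/2)"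
    using base unfolding H_def by linarith
  have H1: "1 \<le> H" using Hl base by linarith
  have Hs: "real H \<le> s"
  proof -
    have "real H \<le> V * V" using Hu V2 mono[of "1/4 - \<epsilon>/2" "1/4"] \<epsilon> mult_mono[of 2 V "X powr (1/4 - \<epsilon>/2)" V]
      by (simp add: V_def)
    then show ?thesis by (simp add: V_sq power2_eq_square)
  qed
  have s_le: "s \<le> real x" using s4 mult_right_mono[of 1 s s] by (simp add: s_sq power2_eq_square)
  have E0: "0 < E" unfolding E_def using X0 by simp
  have sE: "s \<le> E" unfolding s_def E_def using \<epsilon> by (intro mono) auto
  have VE: "V \<le> E" unfolding V_def E_def using \<epsilon> by (intro mono) auto
  have xH: "real x / real H \<le> E"
  proof -
    have "real x / real H \<le> X / X powr (1/4 - \<epsilon>/2)"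
      unfolding X_def[symmetric] using Hl X0 base by (intro divide_left_mono) auto
    also have "\<dots> = X powr 1 / X powr (1/4 - \<epsilon>/2)" using X0 by simp
    also have "\<dots> = E" unfolding E_def by (subst powr_diff[symmetric]) simp
    finally show ?thesis .
  qed
  have H\<delta>: "1 / real H \<le> \<delta>"
  proof -
    have "1 \<le> X powr (\<epsilon>/2)" using \<epsilon> by (intro ge1) auto
    also have "X powr (\<epsilon>/2) = \<delta> * X powr (1/4 - \<epsilon>/2)" unfolding \<delta>' by (simp flip: powr_add)
    also have "\<dots> \<le> \<delta> * real H" using Hl \<delta>0 by (intro mult_left_mono) auto
    finally show ?thesis using H1 by (simp add: field_simps)
  qed
  have c0: "\<bar>c0 - 2 * \<delta>\<bar> \<le> 1 / real H"
    unfolding c0_def using \<delta>0 \<delta>(2) H1 by (intro card_grid_near) auto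
  then have c0_3: "c0 \<le> 3 * \<delta>" using H\<delta> by linarith
  have norm_\<gamma>: "norm (\<gamma> h) = norm (grid_coeff H \<delta> h)" for h by (simp add: \<gamma>_def norm_mult)
  have sm: "separated_multiples \<alpha> s T"
    by unfold_locales (use T s4 sep log in \<open>auto simp: s_def X_def\<close>)
  interpret separated_multiples \<alpha> s T by (rule sm)
  interpret bilinear_setup \<alpha> s T x H V \<delta> E \<gamma>
  proof unfold_locales
    show "real x = s\<^sup>2" "s = V\<^sup>2" "1 \<le> V" "2 \<le> s" "1 \<le> H" "0 < \<delta>" "0 \<le> E" using s_sq V_sq V2 s4 H1 \<delta>0 E0 by simp_all
    show "H \<le> x" using Hs s_le by linarith
    show "real (card {d. d dvd l}) \<le> T" if "1 \<le> l" "l \<le> x\<^sup>2" for l using that by (rule tau)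
    show "\<exists>r. x + 1 < 2 ^ r \<and> real r \<le> T" by (rule bits)
    show "norm (\<gamma> h) \<le> 3 * \<delta>" if "h \<in> {1..<H}" for h
      using that norm_grid_coeff_le_card[of h H \<delta>] c0_3 unfolding norm_\<gamma> c0_def by simp
    show "(\<Sum>h=1..<H. (norm (\<gamma> h))\<^sup>2) \<le> 3 * \<delta>"
      using sum_norm_grid_coeff_le[of H \<delta>] H1 c0_3 unfolding norm_\<gamma> c0_def by simp
    have E_sq: "E\<^sup>2 = X powr (3/2 + \<epsilon>)" by (simp add: E_def power2_eq_square flip: powr_add)
    have H0: "0 \<le> real H" by simp
    show "\<delta> * (real H * s) * real x \<le> 2 * E\<^sup>2"
    proof -
      have "\<delta> * (real H * s) * real x \<le> \<delta> * ((2 * X powr (1/4 - \<epsilon>/2)) * s) * X"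
        unfolding X_def[symmetric] using Hu \<delta>0 s4 X0 by (intro mult_right_mono mult_left_mono) auto
      also have "\<dots> = 2 * (X powr (-1/4 + \<epsilon>) * (X powr (1/4 - \<epsilon>/2) * (X powr (1/2) * X powr 1)))"
        using X0 by (simp add: \<delta>' s_def)
      also have "\<dots> = 2 * X powr (3/2 + \<epsilon>/2)"
        unfolding powr_add[symmetric] by (rule arg_cong[of _ _ "\<lambda>p. 2 * X powr p"]) simp
      also have "\<dots> \<le> 2 * E\<^sup>2" unfolding E_sq using \<epsilon> by (intro mult_left_mono mono) auto
      finally show ?thesis .
    qed
    show "\<delta> * (real x / V) * real x \<le> E\<^sup>2"
    proof -
      have "\<delta> * (real x / V) * real x = X powr (-1/4 + \<epsilon>) * (X powr 1 / X powr (1/4)) * X powr 1"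
        using X0 by (simp add: \<delta>' V_def X_def[symmetric])
      also have "\<dots> = X powr (3/2 + \<epsilon>)"
        unfolding powr_diff[symmetric] powr_add[symmetric] by (rule arg_cong[of _ _ "\<lambda>p. X powr p"]) simp
      finally show ?thesis by (simp add: E_sq)
    qed
    show "\<delta> * (real H)\<^sup>2 * s \<le> 4 * E"
    proof -
      have "\<delta> * (real H)\<^sup>2 * s \<le> \<delta> * (2 * X powr (1/4 - \<epsilon>/2))\<^sup>2 * s"
        using Hu \<delta>0 s4 by (intro mult_right_mono mult_left_mono power_mono) auto
      also have "\<dots> = 4 * (X powr (-1/4 + \<epsilon>) * (X powr (1/4 - \<epsilon>/2) * (X powr (1/4 - \<epsilon>/2) * X powr (1/2))))"
        by (simp add: \<delta>' s_def power2_eq_square)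
      also have "\<dots> = 4 * X powr (3/4)"
        unfolding powr_add[symmetric] by (rule arg_cong[of _ _ "\<lambda>p. 4 * X powr p"]) simp
      also have "\<dots> \<le> 4 * E" unfolding E_def using \<epsilon> by (intro mult_left_mono mono) auto
      finally show ?thesis .
    qed
  qed
  define G where "G n = (\<Sum>j\<in>grid_near H \<delta>. fejer H (\<alpha> * real n + \<beta> - real j / real H))" for n :: nat
  have FG: "F n = G n - c0" for n
  proof -
    have "\<gamma> h * unit_exp (real h * (\<alpha> * real n)) = grid_coeff H \<delta> h * unit_exp (real h * (\<alpha> * real n + \<beta>))" for h
      by (simp add: \<gamma>_def distrib_left unit_exp_add mult_ac)
    then show ?thesis
      unfolding F_def G_def c0_def using sum_fejer_grid_eq[of H "\<alpha> * real n + \<beta>" \<delta>] H1 by simp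
  qed
  have G01: "0 \<le> G n" "G n \<le> 1" for n
  proof -
    show "0 \<le> G n" unfolding G_def by (intro sum_nonneg fejer_nonneg)
    have "G n \<le> (\<Sum>j<H. fejer H (\<alpha> * real n + \<beta> - real j / real H))"
      unfolding G_def by (rule sum_mono2) (auto simp: grid_near_def fejer_nonneg)
    then show "G n \<le> 1" using sum_fejer_shifts[of H] H1 by simp
  qed
  have c01: "0 \<le> c0" "c0 \<le> 1"
  proof -
    have "card (grid_near H \<delta>) \<le> card {..<H}" by (intro card_mono) (auto simp: grid_near_def)
    then show "0 \<le> c0" "c0 \<le> 1" using H1 by (simp_all add: c0_def)
  qed
  let ?S = "sqfree_smooth (real x) y z"
  let ?b = "\<lambda>n. of_bool (dist_int (\<alpha> * real n + \<beta>) < \<delta>) :: real"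
  have Ssub: "?S \<subseteq> {1..x}" by (auto simp: sqfree_smooth_def)
  have finS: "finite ?S" by (rule finite_sqfree_smooth)
  have "(\<Sum>n | n \<in> ?S \<and> dist_int (\<alpha> * real n + \<beta>) < \<delta>. 1) = (\<Sum>n\<in>?S. ?b n)"
    unfolding of_bool_def using finS by (rule sum.inter_filter)
  also have "\<dots> - 2 * \<delta> * real (sqfree_smooth_count (real x) y z)
      = (\<Sum>n\<in>?S. (?b n - G n) + F n + (c0 - 2 * \<delta>))"
    by (simp add: FG sum.distrib sum_subtractf sqfree_smooth_count_def algebra_simps)
  also have "\<dots> = (\<Sum>n\<in>?S. ?b n - G n) + (\<Sum>n\<in>?S. F n) + real (card ?S) * (c0 - 2 * \<delta>)"
    by (simp add: sum.distrib)
  finally have eq: "(\<Sum>n | n \<in> ?S \<and> dist_int (\<alpha> * real n + \<beta>) < \<delta>. 1) - 2 * \<delta> * real (sqfree_smooth_count (real x) y z)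
      = (\<Sum>n\<in>?S. ?b n - G n) + (\<Sum>n\<in>?S. F n) + real (card ?S) * (c0 - 2 * \<delta>)" .
  have 1: "\<bar>\<Sum>n\<in>?S. ?b n - G n\<bar> \<le> 256 * T^4 * E"
  proof -
    have "\<bar>\<Sum>n\<in>?S. ?b n - G n\<bar> \<le> (\<Sum>n\<in>?S. \<bar>?b n - G n\<bar>)" by (rule sum_abs)
    also have "\<dots> \<le> (\<Sum>n=1..x. \<bar>?b n - G n\<bar>)" using Ssub by (intro sum_mono2) auto
    also have "\<dots> \<le> 256 * T^4 * E"
      unfolding G_def by (rule fejer_approximation_error_le[OF sm s_sq _ Hs sE xH]) (use H1 in simp)
    finally show ?thesis .
  qed
  have 2: "\<bar>\<Sum>n\<in>?S. F n\<bar> \<le> 817 * T^11 * E"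
  proof (rule sum_F_sqfree_smooth_le[OF y(1) _ z _ VE])
    show "y < s" using y by (simp add: s_def X_def)
    show "\<bar>F n\<bar> \<le> 1" for n using FG[of n] G01[of n] c01 by simp
  qed
  have 3: "\<bar>real (card ?S) * (c0 - 2 * \<delta>)\<bar> \<le> E"
  proof -
    have "card ?S \<le> card {1..x}" using Ssub by (intro card_mono) auto
    then have "real (card ?S) * \<bar>c0 - 2 * \<delta>\<bar> \<le> real x * (1 / real H)"
      using c0 by (intro mult_mono) auto
    then show ?thesis using xH by (simp add: abs_mult)
  qed
  have "T^4 * E \<le> T^11 * E" using T E0 by (intro mult_right_mono power_increasing) auto
  moreover have "E \<le> T^11 * E" using T E0 mult_right_mono[of 1 "T^11" E] by (simp add: one_le_power)
  ultimately have "\<bar>(\<Sum>n\<in>?S. ?b n - G n) + (\<Sum>n\<in>?S. F n) + real (card ?S) * (c0 - 2 * \<delta>)\<bar> \<le> 1074 * T^11 * E"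
    using 1 2 3 by linarith
  then show ?thesis unfolding smooth_discrepancy_def eq E_def X_def .
qed

section \<open>Choice of the parameters for large arguments\<close>

lemma eventually_ln_le_powr:
  fixes A B b :: real
  assumes "0 < b" "0 \<le> A" "0 \<le> B"
  shows "\<exists>K\<ge>1. \<forall>x\<ge>K. A + B * ln x \<le> x powr b"
proof -
  \<comment> \<open>Half of the exponent \<open>b\<close> absorbs this constant, the other half the
    logarithm via \<open>ln x \<le> x powr (b/2) / (b/2)\<close>.\<close>
  define D where "D = A + B * (2 / b) + 1"
  have D1: "1 \<le> D" using assms by (simp add: D_def)
  show ?thesis
  proof (intro exI[of _ "D powr (2 / b)"] conjI allI impI)
    show "1 \<le> D powr (2 / b)" using D1 assms by (simp add: ge_one_powr_ge_zero)
    fix x assume x: "D powr (2 / b) \<le> x"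
    then have x1: "1 \<le> x" using \<open>1 \<le> D powr (2 / b)\<close> by simp
    have "D = (D powr (2 / b)) powr (b / 2)" using D1 assms by (simp add: powr_powr)
    also have "\<dots> \<le> x powr (b / 2)" using x assms by (intro powr_mono2) auto
    finally have Dx: "D \<le> x powr (b / 2)" .
    have xb: "1 \<le> x powr (b / 2)" using D1 Dx by simp
    have "ln x \<le> x powr (b / 2) / (b / 2)" using x1 assms by (intro ln_powr_bound) auto
    then have "A + B * ln x \<le> A + B * (x powr (b / 2) / (b / 2))" using assms by (intro add_left_mono mult_left_mono)
    also have "\<dots> = A * 1 + B * (2 / b) * x powr (b / 2)" by simp
    also have "\<dots> \<le> A * x powr (b / 2) + B * (2 / b) * x powr (b / 2)"
      using assms xb by (intro add_right_mono mult_left_mono)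
    also have "\<dots> \<le> D * x powr (b / 2)" using xb by (simp add: D_def algebra_simps)
    also have "\<dots> \<le> x powr (b / 2) * x powr (b / 2)" using Dx by (intro mult_right_mono) auto
    also have "\<dots> = x powr b" by (simp flip: powr_add)
    finally show "A + B * ln x \<le> x powr b" .
  qed
qed

lemma exists_power_two_greater:
  assumes "1 \<le> x"
  shows "\<exists>r. x + 1 < 2 ^ r \<and> real r \<le> 3 + 2 * ln (real x)"
proof -
  define t where "t = (LEAST t. x + 1 < (2::nat) ^ Suc t)"
  have "x + 1 < 2 ^ Suc x" using less_exp[of "Suc x"] by (simp only: Suc_eq_plus1)
  then have t: "x + 1 < 2 ^ Suc t" unfolding t_def by (rule LeastI)
  have le: "2 ^ t \<le> x + 1"
  proof (cases t)
    case (Suc t')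
    then have "\<not> x + 1 < 2 ^ Suc t'" unfolding t_def by (metis lessI not_less_Least)
    with Suc show ?thesis by simp
  qed simp
  have "real (2 ^ t) \<le> real (x + 1)" using le by (simp only: of_nat_le_iff)
  also have "\<dots> \<le> 2 * real x" using assms by simp
  finally have "ln (real (2 ^ t)) \<le> ln (2 * real x)" using assms by (subst ln_le_cancel_iff) auto
  then have "real t * ln 2 \<le> ln 2 + ln (real x)" using assms by (simp add: ln_realpow ln_mult)
  then have "(real t - 1) * ln 2 \<le> ln (real x)" by (simp add: algebra_simps)
  moreover have "real t - 1 \<le> 2 * ((real t - 1) * ln 2)" if "1 \<le> real t"
    using that mult_left_mono[of "1/2" "ln 2" "real t - 1"] ln2_ge_two_thirds by simp
  moreover have "0 \<le> ln (real x)" using assms by simp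
  ultimately have "real (Suc t) \<le> 3 + 2 * ln (real x)" by (cases "1 \<le> real t") auto
  then show ?thesis using t by blast
qed

text \<open>Since \<open>T\<close> occurs to the power 11, it is taken as
  \<open>C1 * x powr (\<eta> / 11)\<close>. The divisor bound needs half that exponent because its
  arguments go up to the square of \<open>x\<close>. As \<open>C1 \<ge> 1 / c\<close>, the spread
  hypothesis supplies the separation required for \<open>T\<close>.\<close>

lemma sqfree_smooth_discrepancy_uniform:
  fixes c \<epsilon> \<eta> :: real
  assumes c: "0 < c" "c \<le> 1" and \<epsilon>: "0 < \<epsilon>" "\<epsilon> < 1/4" and \<eta>: "0 < \<eta>"
  shows "\<exists>C K. \<forall>x\<ge>K. \<forall>\<alpha> \<beta> y z \<delta>. spread_multiples c \<alpha> x \<and>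
    2 \<le> y \<and> y < real x powr (1/2) \<and> y < z \<and> z \<le> real x \<and> \<delta> = real x powr (-1/4 + \<epsilon>) \<longrightarrow>
    smooth_discrepancy \<alpha> \<beta> \<delta> x y z \<le> C * real x powr (3/4 + \<epsilon>/2 + \<eta>)"
proof -
  obtain C0 where C0: "1 \<le> C0" "\<And>n. 1 \<le> n \<Longrightarrow> real (card {d. d dvd n}) \<le> C0 * real n powr (\<eta> / 22)"
    using divisor_bound[of "\<eta> / 22"] \<eta> by auto
  define C1 where "C1 = max C0 (1 / c)"
  have C1: "1 \<le> C1" "C0 \<le> C1" "1 / c \<le> C1" using C0 by (auto simp: C1_def)
  \<comment> \<open>The two coefficients are chosen to dominate both the logarithm of
    \<open>T * s\<close> and the number of binary digits of \<open>x + 1\<close>.\<close>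
  obtain K1 where K1: "1 \<le> K1" "\<And>x. K1 \<le> x \<Longrightarrow> (3 + ln C1) + (\<eta> + 2) * ln x \<le> x powr (\<eta> / 11)"
    using eventually_ln_le_powr[of "\<eta> / 11" "3 + ln C1" "\<eta> + 2"] \<eta> C1 by auto
  \<comment> \<open>The last entry ensures \<open>\<delta> \<le> 1/2\<close>; it is here that
    \<open>\<epsilon> < 1/4\<close> makes the threshold finite.\<close>
  define K where "K = max 16 (max (nat \<lceil>K1\<rceil>) (nat \<lceil>2 powr (1 / (1/4 - \<epsilon>))\<rceil>))"
  show ?thesis
  proof (intro exI[of _ "1074 * C1^11"] exI[of _ K] allI impI, elim conjE)
    fix x :: nat and \<alpha> \<beta> y z \<delta> :: real
    assume x: "K \<le> x"
      and sep: "spread_multiples c \<alpha> x"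
      and y: "2 \<le> y" "y < real x powr (1/2)" and z: "z \<le> real x"
      and \<delta>: "\<delta> = real x powr (-1/4 + \<epsilon>)"
    have x16: "16 \<le> x" and xK1: "K1 \<le> real x" and x\<epsilon>: "2 powr (1 / (1/4 - \<epsilon>)) \<le> real x"
      using x unfolding K_def by (auto simp: nat_le_iff ceiling_le_iff)
    have x1: "1 \<le> real x" using x16 by simp
    define s where "s = real x powr (1/2)"
    define T where "T = C1 * real x powr (\<eta> / 11)"
    have s1: "1 \<le> s" unfolding s_def using x1 by (simp add: ge_one_powr_ge_zero)
    have xp: "1 \<le> real x powr (\<eta> / 11)" using x1 \<eta> by (simp add: ge_one_powr_ge_zero)
    have C1T: "C1 \<le> T" unfolding T_def using C1 xp mult_left_mono[of 1 "real x powr (\<eta> / 11)" C1] by simp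
    then have T1: "1 \<le> T" using C1 by simp
    have xT: "real x powr (\<eta> / 11) \<le> T" unfolding T_def using C1 xp mult_right_mono[of 1 C1 "real x powr (\<eta> / 11)"] by simp
    have Tc: "1 / T \<le> c"
      using order_trans[OF C1(3) C1T] c T1 by (simp add: field_simps)
    have lnx: "0 \<le> ln (real x)" using x1 by simp
    have lnC1: "0 \<le> ln C1" using C1 by simp
    have big: "(3 + ln C1) + (\<eta> + 2) * ln (real x) \<le> T" using K1(2)[OF xK1] xT by simp
    have pow: "T^11 = C1^11 * real x powr \<eta>"
      using x1 by (simp add: T_def power_mult_distrib powr_powr flip: powr_realpow)
    have "smooth_discrepancy \<alpha> \<beta> \<delta> x y z \<le> 1074 * T^11 * real x powr (3/4 + \<epsilon>/2)"
    proof (rule sqfree_smooth_discrepancy_le[OF T1 _ _ _ _ x16 \<epsilon> \<delta> _ y z])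
      fix d :: nat assume d: "1 \<le> d" "real d \<le> real x powr (1/2) / T"
      have "real x powr (1/2) / T \<le> c * real x powr (1/2)"
        using mult_right_mono[OF Tc, of "real x powr (1/2)"] by simp
      then have "c / real x powr (1/2) \<le> dist_int (\<alpha> * real d)" using sep d unfolding spread_multiples_def by (meson order_trans)
      moreover have "1 / (T * real x powr (1/2)) \<le> c / real x powr (1/2)"
        using divide_right_mono[OF Tc, of "real x powr (1/2)"] by simp
      ultimately show "1 / (T * real x powr (1/2)) \<le> dist_int (\<alpha> * real d)" by simp
    next
      have "ln (T * real x powr (1/2)) = ln C1 + (\<eta> / 11 + 1/2) * ln (real x)"
        using C1 x1 by (simp add: T_def ln_mult ln_powr algebra_simps)
      also have "(\<eta> / 11 + 1/2) * ln (real x) \<le> (\<eta> + 2) * ln (real x)"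
        using \<eta> lnx by (intro mult_right_mono) auto
      finally show "1 + ln (T * real x powr (1/2)) \<le> T" using big by linarith
    next
      fix l assume l: "1 \<le> l" "l \<le> x\<^sup>2"
      have "real l \<le> (real x)\<^sup>2" using l(2) by (metis of_nat_le_iff of_nat_power)
      have "real (card {d. d dvd l}) \<le> C0 * real l powr (\<eta> / 22)" using l C0 by simp
      also have "\<dots> \<le> C1 * ((real x)\<^sup>2) powr (\<eta> / 22)"
        using \<open>real l \<le> (real x)\<^sup>2\<close> C0 C1 \<eta> by (intro mult_mono powr_mono2) auto
      also have "\<dots> = T" using x1 by (simp add: T_def powr_powr flip: powr_numeral)
      finally show "real (card {d. d dvd l}) \<le> T" .
    next
      obtain r where r: "x + 1 < 2 ^ r" "real r \<le> 3 + 2 * ln (real x)"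
        using exists_power_two_greater[of x] x16 by auto
      have "2 * ln (real x) \<le> (\<eta> + 2) * ln (real x)" using \<eta> lnx by (intro mult_right_mono) auto
      then have "real r \<le> T" using r(2) big lnC1 by linarith
      with r(1) show "\<exists>r. x + 1 < 2 ^ r \<and> real r \<le> T" by blast
    next
      have "\<delta> = real x powr (- (1/4 - \<epsilon>))" unfolding \<delta> by (rule arg_cong) simp
      also have "\<dots> \<le> (2 powr (1 / (1/4 - \<epsilon>))) powr (- (1/4 - \<epsilon>))"
        using x\<epsilon> \<epsilon> by (intro powr_mono2') auto
      also have "\<dots> = 2 powr (- 1)"
      proof -
        have "1 / w * - w = - 1" if "0 < w" for w :: real using that by simp
        from this[of "1/4 - \<epsilon>"] have "1 / (1/4 - \<epsilon>) * - (1/4 - \<epsilon>) = - 1" using \<epsilon> by linarith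
        then show ?thesis by (simp only: powr_powr)
      qed
      also have "\<dots> = 1/2" by (simp add: powr_minus_divide)
      finally show "\<delta> \<le> 1/2" .
    qed
    also have "\<dots> = 1074 * C1^11 * real x powr (3/4 + \<epsilon>/2 + \<eta>)"
      by (simp add: pow powr_add)
    finally show "smooth_discrepancy \<alpha> \<beta> \<delta> x y z \<le> 1074 * C1^11 * real x powr (3/4 + \<epsilon>/2 + \<eta>)" .
  qed
qed

theorem theorem2:
  fixes \<beta> :: real
  shows
    "(\<forall>\<alpha>::real. \<alpha> \<notin> \<rat> \<longrightarrow>
       (\<exists>x::nat \<Rightarrow> nat. strict_mono x \<and> (\<forall>k. 0 < x k) \<and>
         (\<forall>\<epsilon>::real. 0 < \<epsilon> \<and> \<epsilon> < 1/4 \<longrightarrow> (\<forall>\<eta>::real. 0 < \<eta> \<longrightarrow>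
           (\<exists>C::real. \<exists>K::nat. \<forall>k\<ge>K. \<forall>y z \<delta> :: real.
             2 \<le> y \<and> y < real (x k) powr (1/2) \<and> y < z \<and> z \<le> real (x k) \<and>
             \<delta> = real (x k) powr (-1/4 + \<epsilon>) \<longrightarrow>
             \<bar>(\<Sum>n | n \<in> sqfree_smooth (real (x k)) y z \<and> dist_int (\<alpha> * real n + \<beta>) < \<delta>. 1)
               - 2 * \<delta> * real (sqfree_smooth_count (real (x k)) y z)\<bar>
             \<le> C * real (x k) powr (3/4 + \<epsilon>/2 + \<eta>))))))
     \<and>
     (\<forall>A::nat. 0 < A \<longrightarrow>
       (\<forall>\<epsilon>::real. 0 < \<epsilon> \<and> \<epsilon> < 1/4 \<longrightarrow> (\<forall>\<eta>::real. 0 < \<eta> \<longrightarrow>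
         (\<exists>C::real. \<exists>K::nat. \<forall>\<alpha>\<in>bounded_cf A. \<forall>k\<ge>K. \<forall>y z \<delta> :: real.
           2 \<le> y \<and> y < real k powr (1/2) \<and> y < z \<and> z \<le> real k \<and>
           \<delta> = real k powr (-1/4 + \<epsilon>) \<longrightarrow>
           \<bar>(\<Sum>n | n \<in> sqfree_smooth (real k) y z \<and> dist_int (\<alpha> * real n + \<beta>) < \<delta>. 1)
             - 2 * \<delta> * real (sqfree_smooth_count (real k) y z)\<bar>
           \<le> C * real k powr (3/4 + \<epsilon>/2 + \<eta>)))))"
proof (intro conjI allI impI, goal_cases)
  case (1 \<alpha>)
  define good where "good q \<longleftrightarrow> (\<forall>d::nat. 1 \<le> d \<and> 2 * d \<le> q \<longrightarrow> 1 / (2 * real q) \<le> dist_int (\<alpha> * real d))" for q :: nat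
  \<comment> \<open>The denominators are chosen before \<open>\<epsilon>\<close> and
    \<open>\<eta>\<close>, each beyond the previous one; the sequence asked for consists of their
    squares, so that its square roots are exactly these denominators.\<close>
  have "\<exists>q. \<forall>n. (0 < q n \<and> good (q n)) \<and> q n < q (Suc n)"
    using irrational_multiples_separated[OF 1] unfolding good_def
    by (intro dependent_nat_choice) (blast intro: less_trans)+
  then obtain q where q: "\<And>n. 0 < q n" "\<And>n. good (q n)" "\<And>n. q n < q (Suc n)" by blast
  have mono_q: "strict_mono q" using q(3) by (simp add: strict_mono_Suc_iff)
  define x where "x k = (q k)\<^sup>2" for k
  have mono_x: "strict_mono x"
    using mono_q unfolding x_def strict_mono_def by (simp add: power_strict_mono)
  have root: "real (x k) powr (1/2) = real (q k)" for k
    by (simp add: x_def powr_half_sqrt)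
  show ?case
  proof (intro exI[of _ x] conjI allI impI, goal_cases)
    case 1
    show ?case by (rule mono_x)
  next
    case (2 k)
    show ?case using q(1)[of k] by (simp add: x_def)
  next
    case (3 \<epsilon> \<eta>)
    obtain C K where CK: "\<forall>x\<ge>K. \<forall>\<alpha> \<beta> y z \<delta>. spread_multiples (1/2) \<alpha> x \<and>
        2 \<le> y \<and> y < real x powr (1/2) \<and> y < z \<and> z \<le> real x \<and> \<delta> = real x powr (-1/4 + \<epsilon>) \<longrightarrow>
        smooth_discrepancy \<alpha> \<beta> \<delta> x y z \<le> C * real x powr (3/4 + \<epsilon>/2 + \<eta>)"
      using sqfree_smooth_discrepancy_uniform[of "1/2" \<epsilon> \<eta>] 3 by auto
    have sep: "spread_multiples (1/2) \<alpha> (x k)" for k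
      unfolding spread_multiples_def
    proof (intro allI impI)
      fix d :: nat assume d: "1 \<le> d \<and> real d \<le> (1/2) * real (x k) powr (1/2)"
      then have "2 * d \<le> q k" unfolding root by linarith
      then have "1 / (2 * real (q k)) \<le> dist_int (\<alpha> * real d)" using q(2)[of k] d by (simp add: good_def)
      then show "(1/2) / real (x k) powr (1/2) \<le> dist_int (\<alpha> * real d)" unfolding root by simp
    qed
    have "K \<le> x k" if "K \<le> k" for k using seq_suble[OF mono_x, of k] that by simp
    then show ?case using CK sep unfolding smooth_discrepancy_def by blast
  qed
next
  case (2 A \<epsilon> \<eta>)
  define c where "c = 1 / (2 * (real A + 2))"
  have c: "0 < c" "c \<le> 1" by (simp_all add: c_def)
  obtain C K where CK: "\<forall>x\<ge>K. \<forall>\<alpha> \<beta> y z \<delta>. spread_multiples c \<alpha> x \<and>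
      2 \<le> y \<and> y < real x powr (1/2) \<and> y < z \<and> z \<le> real x \<and> \<delta> = real x powr (-1/4 + \<epsilon>) \<longrightarrow>
      smooth_discrepancy \<alpha> \<beta> \<delta> x y z \<le> C * real x powr (3/4 + \<epsilon>/2 + \<eta>)"
    using sqfree_smooth_discrepancy_uniform[of c \<epsilon> \<eta>] c 2 by auto
  have sep: "spread_multiples c \<alpha> k"
    if \<alpha>: "\<alpha> \<in> bounded_cf A" for \<alpha> and k :: nat
    unfolding spread_multiples_def
  proof (intro allI impI)
    fix d :: nat assume d: "1 \<le> d \<and> real d \<le> c * real k powr (1/2)"
    have "real d \<le> real k powr (1/2)" using d c mult_right_mono[of c 1 "real k powr (1/2)"] by simp
    moreover have "0 < real d" using d by simp
    \<comment> \<open>Bad approximability gives the distance \<open>c / d\<close>, which for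
      \<open>d\<close> up to the square root of \<open>k\<close> is at least what is
      required.\<close>
    ultimately have "c / real k powr (1/2) \<le> c / real d"
      using c by (intro divide_left_mono mult_pos_pos) linarith+
    also have "\<dots> = 1 / (2 * (real A + 2) * real d)" by (simp add: c_def)
    also have "\<dots> \<le> dist_int (\<alpha> * real d)" using d by (intro bounded_cf_badly_approximable[OF \<alpha>]) auto
    finally show "c / real k powr (1/2) \<le> dist_int (\<alpha> * real d)" .
  qed
  show ?case using CK sep unfolding smooth_discrepancy_def by blast
qed

end
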